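(* Let $\Lambda\colon V\times V\to\mathbb{K}$ be an even continuous bilinear form, $z\in\mathbb{K}$, let $\varphi\in V'$ be an even continuous linear functional and let $R\ge0$. (i) The algebra automorphism $\tau_\varphi^*\colon \mathrm{T}^\bullet_R(V)\to \mathrm{T}^\bullet_R(V)$ is continuous. (ii) For $R\ge\frac12$, the algebra automorphism $\tau_\varphi^*\colon\mathcal{W}_R(V,\star_{z\Lambda})\to\mathcal{W}_R(V,\star_{z\Lambda})$ is continuous. (iii) For $R>\frac12$, the algebra automorphism $\tau_\varphi^*\colon\mathcal{W}_{R^-}(V,\star_{z\Lambda})\to\mathcal{W}_{R^-}(V,\star_{z\Lambda})$ is continuous.
   Context: $\mathbb{K}=\mathbb{R}$ or $\mathbb{C}$, and $V=V_{\mathbf 0}\oplus V_{\mathbf 1}$ is a $\mathbb{Z}_2$-graded Hausdorff locally convex $\mathbb{K}$-vector space with continuous projections onto $V_{\mathbf 0}$, $V_{\mathbf 1}$; $V'$ is its topological dual; $\varphi\in V'$ is even if $\varphi|_{V_{\mathbf 1}}=0$. In exponents of $-1$ a homogeneous vector denotes its parity. Symmetric algebra: $S_n$ acts from the right on $V^{\otimes n}$ by $(v_1\otimes\cdots\otimes v_n)\triangleleft\sigma=\pm\, v_{\sigma(1)}\otimes\cdots\otimes v_{\sigma(n)}$ for homogeneous $v_i$, where $\pm$ is the Koszul sign ($-1$ to the number of pairs $i<j$ with $\sigma(i)>\sigma(j)$ and $v_{\sigma(i)},v_{\sigma(j)}$ both odd). $\mathcal{S}_n(v)=\frac1{n!}\sum_{\sigma}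 v\triangleleft\sigma$, $\mathrm{S}^n(V)=\operatorname{im}\mathcal{S}_n\subseteq V^{\otimes n}$, $\mathrm{S}^0(V)=\mathbb{K}$, $\mathrm{S}^\bullet(V)=\bigoplus_n \mathrm{S}^n(V)\subseteq \mathrm{T}^\bullet(V)=\bigoplus_nV^{\otimes n}$, with product $\mu(v\otimes w)=vw=\mathcal{S}(v\otimes w)$, $\mathcal{S}=\bigoplus_n\mathcal{S}_n$. Translation: $\tau_\varphi^*\colon \mathrm{T}^\bullet(V)\to \mathrm{T}^\bullet(V)$ is the unique unital algebra homomorphism (for $\otimes$) with $v\mapsto v+\varphi(v)1$ for $v\in V$; it restricts to $\mathrm{S}^\bullet(V)$, and is an algebra automorphism of $\mathrm{T}^\bullet(V)$ and of $(\mathrm{S}^\bullet(V),\star_{z\Lambda})$. Star product: $\Lambda$ is even if $\Lambda(v,w)=0$ for homogeneous $v,w$ of different parity. $P_\Lambda$ is the linear extension of $$P_\Lambda(v_1\cdots v_n\otimes w_1\cdots w_m)=\sum_{k=1}^n\sum_{\ell=1}^m(-1)^{v_k(v_{k+1}+\cdots+v_n)+w_\ell(w_1+\cdots+w_{\ell-1})}\Lambda(v_k,w_\ell)\,v_1\cdots\widehat{v_k}\cdots v_n\otimes w_1\cdots\widehat{w_\ell}\cdots w_m$$ on $\mathrm{S}^\bullet(V)\otimes \mathrm{S}^\bullet(V)$ (homogeneous vectors; hats denote omission; $P_\Lambda$ vanishes if one factor is in $\mathrm{S}^0(V)$), and $a\star_{z\Lambda}b=\sum_{k\ge0}\frac{z^k}{k!}\mu(P_\Lambda^k(a\otimes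 b))$. Topology: for a continuous seminorm $p$ on $V$ let $p^n$ be the projective tensor seminorm on $V^{\otimes n}$ ($p^0=|\cdot|$) and $p_R(v)=\sum_np^n(v_n)\,n!^R$ for $v=\sum_nv_n$. $\mathrm{T}^\bullet_R(V)$ is $\mathrm{T}^\bullet(V)$ with the topology of all $p_R$ ($p$ a continuous seminorm on $V$); $\mathcal{W}_R(V,\star_{z\Lambda})$ is $\mathrm{S}^\bullet(V)$ with product $\star_{z\Lambda}$ and the topology of all $p_R$; $\mathcal{W}_{R^-}(V,\star_{z\Lambda})$ is the same algebra with the topology of all $p_{R-\epsilon}$, $\epsilon>0$. *)

theory Defs
  imports "HOL-Analysis.Analysis" "HOL-Library.Function_Algebras" "HOL-Library.Groups_Big_Fun"
    "HOL-Library.Z2" "HOL-Combinatorics.Permutations"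
begin

text \<open>
  The scalar field is a type of class \<^class>\<open>real_normed_field\<close>. By the Gelfand--Mazur theorem the only
  models of this class are the reals and the complex numbers with their usual absolute value.
  A vector space over it is a type with a scalar multiplication \<open>smul\<close> as in
  \<^locale>\<open>vector_space\<close>. The group \<open>\<int>\<^sub>2\<close> of parities is the type \<^typ>\<open>bit\<close>, with even = 0 and odd = 1.
\<close>

section \<open>Graded locally convex spaces\<close>

definition graded_component :: "(bit \<Rightarrow> 'v::ab_group_add set) \<Rightarrow> bit \<Rightarrow> 'v \<Rightarrow> 'v" where
  "graded_component V i v = (THE a. a \<in> V i \<and> v - a \<in> V (i + 1))"

locale graded_lcs = vector_space smul
  for smul :: "'k::real_normed_field \<Rightarrow> 'v::{topological_ab_group_add, t2_space} \<Rightarrow> 'v" +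
  fixes V :: "bit \<Rightarrow> 'v set"
  assumes continuous_smul: "continuous_on UNIV (\<lambda>(c, v). smul c v)"
    and locally_convex: "\<And>U. open U \<Longrightarrow> 0 \<in> U \<Longrightarrow>
      \<exists>C. open C \<and> 0 \<in> C \<and> C \<subseteq> U \<and>
          (\<forall>x\<in>C. \<forall>y\<in>C. \<forall>t\<in>{0..1}. smul (of_real (1 - t)) x + smul (of_real t) y \<in> C)"
    and subspace_graded: "\<And>i. subspace (V i)"
    and direct_sum: "\<And>v. \<exists>!a. a \<in> V 0 \<and> v - a \<in> V 1"
    and continuous_component: "\<And>i. continuous_on UNIV (graded_component V i)"

definition continuous_seminorm ::
    "('k::real_normed_field \<Rightarrow> 'v::{ab_group_add, topological_space} \<Rightarrow> 'v) \<Rightarrow> ('v \<Rightarrow> real) \<Rightarrow> bool" where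
  "continuous_seminorm smul p \<longleftrightarrow>
     (\<forall>c v. p (smul c v) = norm c * p v) \<and> (\<forall>v w. p (v + w) \<le> p v + p w) \<and> continuous_on UNIV p"

definition even_continuous_functional ::
    "('k::real_normed_field \<Rightarrow> 'v::{ab_group_add, topological_space} \<Rightarrow> 'v) \<Rightarrow> (bit \<Rightarrow> 'v set) \<Rightarrow>
     ('v \<Rightarrow> 'k) \<Rightarrow> bool" where
  "even_continuous_functional smul V \<phi> \<longleftrightarrow>
     Vector_Spaces.linear smul (*) \<phi> \<and> continuous_on UNIV \<phi> \<and> (\<forall>v\<in>V 1. \<phi> v = 0)"

definition even_continuous_bilinear_form ::
    "('k::real_normed_field \<Rightarrow> 'v::{ab_group_add, topological_space} \<Rightarrow> 'v) \<Rightarrow> (bit \<Rightarrow> 'v set) \<Rightarrow>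
     ('v \<Rightarrow> 'v \<Rightarrow> 'k) \<Rightarrow> bool" where
  "even_continuous_bilinear_form smul V \<Lambda> \<longleftrightarrow>
     (\<forall>v. Vector_Spaces.linear smul (*) (\<Lambda> v)) \<and>
     (\<forall>w. Vector_Spaces.linear smul (*) (\<lambda>v. \<Lambda> v w)) \<and>
     continuous_on UNIV (\<lambda>(v, w). \<Lambda> v w) \<and>
     (\<forall>i j. i \<noteq> j \<longrightarrow> (\<forall>v\<in>V i. \<forall>w\<in>V j. \<Lambda> v w = 0))"

section \<open>Linear algebra in spaces of scalar-valued functions\<close>

text \<open>Addition of functions is pointwise (\<^theory>\<open>HOL-Library.Function_Algebras\<close>).\<close>

definition fscale :: "'k::field \<Rightarrow> ('a \<Rightarrow> 'k) \<Rightarrow> 'a \<Rightarrow> 'k" where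
  "fscale c t = (\<lambda>x. c * t x)"

global_interpretation fun_vs: vector_space "fscale :: 'k::field \<Rightarrow> ('a \<Rightarrow> 'k) \<Rightarrow> 'a \<Rightarrow> 'k"
  by unfold_locales (auto simp: fscale_def fun_eq_iff algebra_simps)

definition linear_on :: "('a \<Rightarrow> 'k::field) set \<Rightarrow> (('a \<Rightarrow> 'k) \<Rightarrow> 'b \<Rightarrow> 'k) \<Rightarrow> bool" where
  "linear_on D F \<longleftrightarrow>
     (\<forall>a\<in>D. \<forall>b\<in>D. F (a + b) = F a + F b) \<and> (\<forall>c. \<forall>a\<in>D. F (fscale c a) = fscale c (F a))"

text \<open>\<open>linear_extension D G\<close> is the linear map on \<open>D\<close> sending \<open>a\<close> to \<open>b\<close> for all \<open>(a, b) \<in> G\<close>.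
  It is used only where the \<open>a\<close> span \<open>D\<close>.\<close>

definition linear_extension ::
    "('a \<Rightarrow> 'k::field) set \<Rightarrow> (('a \<Rightarrow> 'k) \<times> ('b \<Rightarrow> 'k)) set \<Rightarrow> ('a \<Rightarrow> 'k) \<Rightarrow> 'b \<Rightarrow> 'k" where
  "linear_extension D G = (THE F. F \<in> extensional D \<and> linear_on D F \<and> (\<forall>(a, b)\<in>G. F a = b))"

definition unital_algebra_hom ::
    "('a \<Rightarrow> 'k::field) set \<Rightarrow> (('a \<Rightarrow> 'k) \<Rightarrow> ('a \<Rightarrow> 'k) \<Rightarrow> 'a \<Rightarrow> 'k) \<Rightarrow> ('a \<Rightarrow> 'k) \<Rightarrow>
     (('a \<Rightarrow> 'k) \<Rightarrow> 'a \<Rightarrow> 'k) \<Rightarrow> bool" where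
  "unital_algebra_hom A mul one F \<longleftrightarrow>
     F \<in> A \<rightarrow> A \<and> linear_on A F \<and> (\<forall>a\<in>A. \<forall>b\<in>A. F (mul a b) = mul (F a) (F b)) \<and> F one = one"

definition algebra_automorphism ::
    "('a \<Rightarrow> 'k::field) set \<Rightarrow> (('a \<Rightarrow> 'k) \<Rightarrow> ('a \<Rightarrow> 'k) \<Rightarrow> 'a \<Rightarrow> 'k) \<Rightarrow> ('a \<Rightarrow> 'k) \<Rightarrow>
     (('a \<Rightarrow> 'k) \<Rightarrow> 'a \<Rightarrow> 'k) \<Rightarrow> bool" where
  "algebra_automorphism A mul one F \<longleftrightarrow> unital_algebra_hom A mul one F \<and> bij_betw F A A"

definition seminorm_topology ::
    "('a \<Rightarrow> 'k::field) set \<Rightarrow> (('a \<Rightarrow> 'k) \<Rightarrow> real) set \<Rightarrow> ('a \<Rightarrow> 'k) topology" where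
  "seminorm_topology D Q =
     topology_generated_by {{b \<in> D. q (b - a) < e} |a q e. a \<in> D \<and> q \<in> Q \<and> e > 0}"

section \<open>The tensor algebra\<close>

text \<open>
  \<open>V\<^sup>\<otimes>\<^sup>n\<close> is realised as the span of the evaluation functionals
  \<open>v\<^sub>1 \<otimes> \<dots> \<otimes> v\<^sub>n = (f \<mapsto> f(v\<^sub>1,\<dots>,v\<^sub>n))\<close> on the space of \<open>n\<close>-linear forms. All degrees are treated at
  once by means of functions on lists that are multilinear in every length; the values on
  different lengths being independent, the span of all evaluations is the direct sum of the
  \<open>V\<^sup>\<otimes>\<^sup>n\<close>. Elements vanish, by convention, at functions that are not multilinear.
  The lemma \<open>tensor_universal\<close> below is the universal property of this construction.
\<close>

type_synonym ('k, 'v) tensor = "('v list \<Rightarrow> 'k) \<Rightarrow> 'k"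
type_synonym ('k, 'v) tensor2 = "('v list \<Rightarrow> 'v list \<Rightarrow> 'k) \<Rightarrow> 'k"

definition parity_sign :: "bit \<Rightarrow> 'k::field" where
  "parity_sign b = (if b = 0 then 1 else - 1)"

definition drop_at :: "nat \<Rightarrow> 'a list \<Rightarrow> 'a list" where
  "drop_at k xs = take k xs @ drop (Suc k) xs"

definition koszul_sign :: "(nat \<Rightarrow> nat) \<Rightarrow> bit list \<Rightarrow> 'k::field" where
  "koszul_sign \<sigma> ps =
     (- 1) ^ card {(i, j). i < j \<and> j < length ps \<and> \<sigma> i > \<sigma> j \<and> ps ! \<sigma> i = 1 \<and> ps ! \<sigma> j = 1}"

context
  fixes smul :: "'k::real_normed_field \<Rightarrow> 'v::ab_group_add \<Rightarrow> 'v"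
begin

definition multilinear :: "('v list \<Rightarrow> 'k) \<Rightarrow> bool" where
  "multilinear f \<longleftrightarrow> (\<forall>xs ys. Vector_Spaces.linear smul (*) (\<lambda>v. f (xs @ v # ys)))"

text \<open>\<open>word [v\<^sub>1, \<dots>, v\<^sub>n]\<close> is \<open>v\<^sub>1 \<otimes> \<dots> \<otimes> v\<^sub>n\<close>; in particular \<open>word []\<close> is the unit and \<open>word [v]\<close> is
  \<open>v\<close> viewed in the tensor algebra.\<close>

definition word :: "'v list \<Rightarrow> ('k, 'v) tensor" where
  "word xs = (\<lambda>f. if multilinear f then f xs else 0)"

definition tensor_power :: "nat \<Rightarrow> ('k, 'v) tensor set" where
  "tensor_power n = fun_vs.span {word xs |xs. length xs = n}"

definition tensor_algebra :: "('k, 'v) tensor set" where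
  "tensor_algebra = fun_vs.span (range word)"

definition tensor_mult :: "('k, 'v) tensor \<Rightarrow> ('k, 'v) tensor \<Rightarrow> ('k, 'v) tensor" where
  "tensor_mult s t = (\<lambda>f. if multilinear f then s (\<lambda>xs. t (\<lambda>ys. f (xs @ ys))) else 0)"

text \<open>The projection onto \<open>V\<^sup>\<otimes>\<^sup>n\<close>.\<close>

definition tensor_component :: "nat \<Rightarrow> ('k, 'v) tensor \<Rightarrow> ('k, 'v) tensor" where
  "tensor_component n =
     linear_extension tensor_algebra {(word xs, if length xs = n then word xs else 0) |xs. True}"

definition translation :: "('v \<Rightarrow> 'k) \<Rightarrow> ('k, 'v) tensor \<Rightarrow> ('k, 'v) tensor" where
  "translation \<phi> = (THE F. F \<in> extensional tensor_algebra \<and>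
     unital_algebra_hom tensor_algebra tensor_mult (word []) F \<and>
     (\<forall>v. F (word [v]) = word [v] + fscale (\<phi> v) (word [])))"

text \<open>Elements \<open>a \<otimes> b\<close> of the tensor square of the tensor algebra, realised in the same way;
  the symbol \<open>\<otimes>\<close> here is not the product of the tensor algebra.\<close>

definition bimultilinear :: "('v list \<Rightarrow> 'v list \<Rightarrow> 'k) \<Rightarrow> bool" where
  "bimultilinear g \<longleftrightarrow> (\<forall>xs. multilinear (g xs)) \<and> (\<forall>ys. multilinear (\<lambda>xs. g xs ys))"

definition outer :: "('k, 'v) tensor \<Rightarrow> ('k, 'v) tensor \<Rightarrow> ('k, 'v) tensor2" where
  "outer a b = (\<lambda>g. if bimultilinear g then a (\<lambda>xs. b (g xs)) else 0)"

text \<open>The scalar coefficients are redundant for \<open>n > 0\<close>; for \<open>n = 0\<close> they make the seminorm equal to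
  the absolute value.\<close>

definition projective_seminorm :: "('v \<Rightarrow> real) \<Rightarrow> nat \<Rightarrow> ('k, 'v) tensor \<Rightarrow> real" where
  "projective_seminorm p n t =
     Inf {(\<Sum>(c, xs)\<leftarrow>L. norm c * prod_list (map p xs)) |L.
          (\<forall>(c, xs)\<in>set L. length xs = n) \<and> t = (\<Sum>(c, xs)\<leftarrow>L. fscale c (word xs))}"

definition tensor_seminorm :: "('v \<Rightarrow> real) \<Rightarrow> real \<Rightarrow> ('k, 'v) tensor \<Rightarrow> real" where
  "tensor_seminorm p R t =
     Sum_any (\<lambda>n. projective_seminorm p n (tensor_component n t) * fact n powr R)"

end

lemma tensor_mult_word: "tensor_mult smul (word smul xs) (word smul ys) = word smul (xs @ ys)"
proof -
  have "multilinear smul (\<lambda>ys. f (xs @ ys))" "multilinear smul (\<lambda>xs. f (xs @ ys))"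
    if "multilinear smul f" for f xs ys
  proof -
    have "Vector_Spaces.linear smul (*) (\<lambda>v. f (as @ v # bs))" for as bs
      using that by (simp add: multilinear_def)
    from this[of "_ @ _"] this[of _ "_ @ _"]
    show "multilinear smul (\<lambda>ys. f (xs @ ys))" "multilinear smul (\<lambda>xs. f (xs @ ys))"
      by (simp_all add: multilinear_def)
  qed
  then show ?thesis by (auto simp: tensor_mult_def word_def fun_eq_iff)
qed

lemma tensor_universal:
  fixes smul :: "'k::real_normed_field \<Rightarrow> 'v::ab_group_add \<Rightarrow> 'v"
    and smulW :: "'k \<Rightarrow> 'w::ab_group_add \<Rightarrow> 'w"
  assumes W: "vector_space smulW"
    and g: "\<And>xs ys. Vector_Spaces.linear smul smulW (\<lambda>v. g (xs @ v # ys))"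
  shows "\<exists>F. Vector_Spaces.linear fscale smulW F \<and> (\<forall>xs. F (word smul xs) = g xs)"
proof -
  interpret W: vector_space smulW by (rule W)
  interpret WK: vector_space_pair smulW "(*) :: 'k \<Rightarrow> 'k \<Rightarrow> 'k"
    by unfold_locales (auto simp: algebra_simps)
  interpret FW: vector_space_pair "fscale :: 'k \<Rightarrow> ('k, 'v) tensor \<Rightarrow> ('k, 'v) tensor" smulW ..
  interpret FK: vector_space_pair "fscale :: 'k \<Rightarrow> ('k, 'v) tensor \<Rightarrow> ('k, 'v) tensor" "(*) :: 'k \<Rightarrow> 'k \<Rightarrow> 'k"
    by unfold_locales (auto simp: algebra_simps)
  obtain B where B: "B \<subseteq> range (word smul)" "fun_vs.independent B" "range (word smul) \<subseteq> fun_vs.span B"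
    using fun_vs.maximal_independent_subset[of "range (word smul)"] by blast
  define h where "h b = g (SOME xs. word smul xs = b)" for b
  obtain F where F: "Vector_Spaces.linear fscale smulW F" "\<forall>b\<in>B. F b = h b"
    using FW.linear_independent_extend[OF B(2)] by blast
  have point: "w = 0" if "\<And>l. Vector_Spaces.linear smulW (*) l \<Longrightarrow> l w = 0" for w
  proof (rule ccontr)
    assume "w \<noteq> 0"
    then have "W.independent {w}" by simp
    then obtain l where "Vector_Spaces.linear smulW (*) l" "\<forall>b\<in>{w}. l b = (1::'k)"
      using WK.linear_independent_extend[of "{w}" "\<lambda>_. 1"] by blast
    then show False using that[of l] by simp
  qed
  have ev: "t (\<lambda>xs. l (g xs)) = l (F t)"
    if l: "Vector_Spaces.linear smulW (*) l" and t: "t \<in> fun_vs.span B" for l t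
  proof -
    have m: "multilinear smul (\<lambda>xs. l (g xs))"
      unfolding multilinear_def using Vector_Spaces.linear_compose[OF g l] by (simp add: o_def)
    have lin1: "Vector_Spaces.linear fscale (*) (\<lambda>t :: ('k, 'v) tensor. t (\<lambda>xs. l (g xs)))"
      by unfold_locales (auto simp: fscale_def algebra_simps)
    have lin2: "Vector_Spaces.linear fscale (*) (\<lambda>t. l (F t))"
      using Vector_Spaces.linear_compose[OF F(1) l] by (simp add: o_def)
    have "b (\<lambda>xs. l (g xs)) = l (F b)" if "b \<in> B" for b
    proof -
      have "\<exists>xs. word smul xs = b" using that B(1) by auto
      then have "word smul (SOME xs. word smul xs = b) = b" by (rule someI_ex)
      then have "b (\<lambda>xs. l (g xs)) = l (h b)"
        unfolding h_def by (metis (lifting) m word_def)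
      then show ?thesis using F(2) that by simp
    qed
    then show ?thesis using FK.linear_eq_on_span[OF lin1 lin2] t by blast
  qed
  have "F (word smul xs) = g xs" for xs
  proof -
    have "F (word smul xs) - g xs = 0"
    proof (rule point)
      fix l assume l: "Vector_Spaces.linear smulW ((*) :: 'k \<Rightarrow> 'k \<Rightarrow> 'k) l"
      have m: "multilinear smul (\<lambda>xs. l (g xs))"
        unfolding multilinear_def using Vector_Spaces.linear_compose[OF g l] by (simp add: o_def)
      have "word smul xs \<in> fun_vs.span B" using B(3) by auto
      from ev[OF l this] have "l (F (word smul xs)) = l (g xs)"
        using m by (simp add: word_def)
      then show "l (F (word smul xs) - g xs) = 0"
        using WK.linear_diff[OF l] by simp
    qed
    then show ?thesis by simp
  qed
  with F(1) show ?thesis by blast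
qed

section \<open>The symmetric algebra and the star product\<close>

context
  fixes smul :: "'k::real_normed_field \<Rightarrow> 'v::ab_group_add \<Rightarrow> 'v"
    and V :: "bit \<Rightarrow> 'v set"
begin

text \<open>\<open>homogeneous ps vs\<close>: each \<open>v\<^sub>i\<close> is homogeneous of parity \<open>p\<^sub>i\<close>. The vector 0 has both
  parities, which is harmless since a tensor with a factor 0 vanishes.\<close>

definition homogeneous :: "bit list \<Rightarrow> 'v list \<Rightarrow> bool" where
  "homogeneous ps vs \<longleftrightarrow> list_all2 (\<lambda>p v. v \<in> V p) ps vs"

definition perm_action :: "nat \<Rightarrow> (nat \<Rightarrow> nat) \<Rightarrow> ('k, 'v) tensor \<Rightarrow> ('k, 'v) tensor" where
  "perm_action n \<sigma> = linear_extension (tensor_power smul n)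
     {(word smul vs, fscale (koszul_sign \<sigma> ps) (word smul (permute_list \<sigma> vs))) |ps vs.
        homogeneous ps vs \<and> length vs = n}"

definition symmetrize_degree :: "nat \<Rightarrow> ('k, 'v) tensor \<Rightarrow> ('k, 'v) tensor" where
  "symmetrize_degree n t = fscale (1 / fact n) (\<Sum>\<sigma> | \<sigma> permutes {..<n}. perm_action n \<sigma> t)"

definition symmetrize :: "('k, 'v) tensor \<Rightarrow> ('k, 'v) tensor" where
  "symmetrize t = Sum_any (\<lambda>n. symmetrize_degree n (tensor_component smul n t))"

definition sym_power :: "nat \<Rightarrow> ('k, 'v) tensor set" where
  "sym_power n = symmetrize_degree n ` tensor_power smul n"

definition sym_algebra :: "('k, 'v) tensor set" where
  "sym_algebra = fun_vs.span (\<Union>n. sym_power n)"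

definition sym_square :: "('k, 'v) tensor2 set" where
  "sym_square = fun_vs.span {outer smul a b |a b. a \<in> sym_algebra \<and> b \<in> sym_algebra}"

definition sym_mult :: "('k, 'v) tensor2 \<Rightarrow> ('k, 'v) tensor" where
  "sym_mult = linear_extension sym_square
     {(outer smul a b, symmetrize (tensor_mult smul a b)) |a b. a \<in> sym_algebra \<and> b \<in> sym_algebra}"

text \<open>\<open>sym_word [v\<^sub>1, \<dots>, v\<^sub>n]\<close> is the product \<open>v\<^sub>1\<cdots>v\<^sub>n\<close> in the symmetric algebra.\<close>

definition sym_word :: "'v list \<Rightarrow> ('k, 'v) tensor" where
  "sym_word vs = symmetrize (word smul vs)"

text \<open>Positions are counted from 0. In degree 0 on either side the double sum is empty.\<close>

definition P_form :: "('v \<Rightarrow> 'v \<Rightarrow> 'k) \<Rightarrow> ('k, 'v) tensor2 \<Rightarrow> ('k, 'v) tensor2" where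
  "P_form \<Lambda> = linear_extension sym_square
     {(outer smul (sym_word vs) (sym_word ws),
       \<Sum>k<length vs. \<Sum>l<length ws.
         fscale (parity_sign (ps ! k * (\<Sum>i\<in>{k<..<length vs}. ps ! i) + qs ! l * (\<Sum>j<l. qs ! j))
                 * \<Lambda> (vs ! k) (ws ! l))
           (outer smul (sym_word (drop_at k vs)) (sym_word (drop_at l ws)))) |ps vs qs ws.
      homogeneous ps vs \<and> homogeneous qs ws}"

text \<open>The sum over \<open>k\<close> has only finitely many nonzero terms, because every application of
  \<open>P_form\<close> lowers the degrees.\<close>

definition star :: "('v \<Rightarrow> 'v \<Rightarrow> 'k) \<Rightarrow> 'k \<Rightarrow> ('k, 'v) tensor \<Rightarrow> ('k, 'v) tensor \<Rightarrow> ('k, 'v) tensor" where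
  "star \<Lambda> z a b =
     Sum_any (\<lambda>k. fscale (z ^ k / fact k) (sym_mult ((P_form \<Lambda> ^^ k) (outer smul a b))))"

end

section \<open>Topologies\<close>

context
  fixes smul :: "'k::real_normed_field \<Rightarrow> 'v::{ab_group_add, topological_space} \<Rightarrow> 'v"
    and V :: "bit \<Rightarrow> 'v set"
begin

definition tensor_topology :: "real \<Rightarrow> ('k, 'v) tensor topology" where
  "tensor_topology R = seminorm_topology (tensor_algebra smul)
     {tensor_seminorm smul p R |p. continuous_seminorm smul p}"

definition weyl_topology :: "real \<Rightarrow> ('k, 'v) tensor topology" where
  "weyl_topology R = seminorm_topology (sym_algebra smul V)
     {tensor_seminorm smul p R |p. continuous_seminorm smul p}"

definition weyl_minus_topology :: "real \<Rightarrow> ('k, 'v) tensor topology" where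
  "weyl_minus_topology R = seminorm_topology (sym_algebra smul V)
     {tensor_seminorm smul p (R - \<epsilon>) |p \<epsilon>. continuous_seminorm smul p \<and> \<epsilon> > 0}"

end

end

theory Submission
  imports Defs
begin

text \<open>
  A homomorphism on the tensor algebra \<open>T\<close> is determined by its values on letters, so the
  translation by \<open>\<phi>\<close> exists and is inverted by the translation by \<open>-\<phi>\<close> (\<open>translation_automorphism\<close>). It
  remains to see that it is compatible with symmetrization and with the operator \<open>P\<^sub>\<Lambda>\<close>.

  Symmetrization is the projection onto the symmetric tensors whose kernel is the two-sided ideal generated
  by graded commutators (\<open>Sym_commutator_ideal\<close>, \<open>Sym_congruent\<close>). The translation \<open>\<tau>\<close> preserves this ideal because
  it is multiplicative and \<open>\<phi>\<close> vanishes on odd letters. It preserves symmetric tensors as well: for a symmetric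
  \<open>t\<close>, the tensor \<open>\<tau> t\<close> is a combination of iterated contractions of the first letter of \<open>t\<close> with \<open>\<phi>\<close>, and these
  are symmetric (\<open>translate_from_in_span\<close>). A map that preserves kernel and image of a projection commutes
  with it (\<open>Sym_translate\<close>).

  The operator \<open>P\<^sub>\<Lambda>\<close> is first defined on all of \<open>T \<otimes> T\<close>. If a homogeneous word is fixed in one factor, it acts
  on the other one by signed contractions with linear forms. Such contractions are graded derivations up to
  sign, hence preserve the commutator ideal (\<open>contraction_commutator_ideal\<close>), which shows that \<open>P\<^sub>\<Lambda>\<close> is well defined on
  \<open>S(V) \<otimes> S(V)\<close>. They also commute with translations, because the letters that a translation deletes are
  even and thus carry no sign (\<open>contraction_translate\<close>). Therefore \<open>\<tau> \<otimes> \<tau>\<close> commutes with \<open>P\<^sub>\<Lambda>\<close>, and since \<open>\<tau>\<close> also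
  respects the product, \<open>\<tau> (a \<star> b) = \<tau> a \<star> \<tau> b\<close> holds term by term (\<open>translate_star\<close>).

  For continuity, expand \<open>(v\<^sub>1 + \<phi>(v\<^sub>1)) \<otimes> \<dots> \<otimes> (v\<^sub>n + \<phi>(v\<^sub>n))\<close> into words \<open>c w\<^sub>1 \<otimes> \<dots> \<otimes> w\<^sub>k\<close> with scalars \<open>c\<close>. The numbers
  \<open>|c| p(w\<^sub>1) \<cdots> p(w\<^sub>k)\<close> add up to \<open>q(v\<^sub>1) \<cdots> q(v\<^sub>n)\<close> with the continuous seminorm \<open>q = p + |\<phi>|\<close>, and \<open>k \<le> n\<close>, so that the
  weights \<open>k!\<^sup>R\<close> are at most \<open>n!\<^sup>R\<close>. Hence \<open>p\<^sub>R (\<tau> t) \<le> q\<^sub>R t\<close> for \<open>R \<ge> 0\<close> (\<open>tensor_seminorm_translate\<close>). This one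
  estimate gives all three continuity statements.
\<close>

section \<open>Linear maps between spaces of functions\<close>

text \<open>Tensors are functions, but their equations are algebraic: sums are evaluated pointwise only on demand.\<close>

declare plus_fun_apply [simp del] zero_fun_apply [simp del] minus_apply [simp del]

lemma fscale_apply: "fscale c t x = c * t x"
  by (simp add: fscale_def)

lemmas fun_apply = plus_fun_apply zero_fun_apply minus_apply fscale_apply

lemma linear_onI:
  assumes "\<And>a b. a \<in> D \<Longrightarrow> b \<in> D \<Longrightarrow> F (a + b) = F a + F b"
    and "\<And>c a. a \<in> D \<Longrightarrow> F (fscale c a) = fscale c (F a)"
  shows "linear_on D F"
  using assms by (simp add: linear_on_def)

lemma linear_on_add: "linear_on D F \<Longrightarrow> a \<in> D \<Longrightarrow> b \<in> D \<Longrightarrow> F (a + b) = F a + F b"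
  and linear_on_scale: "linear_on D F \<Longrightarrow> a \<in> D \<Longrightarrow> F (fscale c a) = fscale c (F a)"
  by (simp_all add: linear_on_def)

lemma linear_on_subset: "linear_on E F \<Longrightarrow> D \<subseteq> E \<Longrightarrow> linear_on D F"
  by (simp add: linear_on_def subset_iff)

lemma linear_on_zero: "linear_on D F \<Longrightarrow> 0 \<in> D \<Longrightarrow> F 0 = 0"
  using linear_on_scale[of D F 0 0] by simp

lemma linear_on_diff:
  assumes "linear_on D F" "fun_vs.subspace D" "a \<in> D" "b \<in> D"
  shows "F (a - b) = F a - F b"
proof -
  have "F (a + fscale (- 1) b) = F a + fscale (- 1) (F b)"
    using assms by (simp only: linear_on_add linear_on_scale fun_vs.subspace_scale)
  moreover have "a + fscale (- 1) b = a - b" "F a + fscale (- 1) (F b) = F a - F b"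
    by (simp_all add: fun_eq_iff fun_apply)
  ultimately show ?thesis by simp
qed

lemma linear_on_sum:
  assumes "linear_on D F" "fun_vs.subspace D" "\<And>i. i \<in> A \<Longrightarrow> g i \<in> D"
  shows "F (sum g A) = (\<Sum>i\<in>A. F (g i))"
  using assms(3)
proof (induction A rule: infinite_finite_induct)
  case (insert x A)
  then show ?case
    using linear_on_add[OF assms(1), of "g x" "sum g A"] assms(2)
    by (simp add: fun_vs.subspace_sum)
qed (use assms in \<open>auto simp: linear_on_zero fun_vs.subspace_0\<close>)

lemma linear_on_compose:
  "linear_on D F \<Longrightarrow> (\<And>a. a \<in> D \<Longrightarrow> F a \<in> E) \<Longrightarrow> linear_on E G \<Longrightarrow> linear_on D (\<lambda>a. G (F a))"
  by (simp add: linear_on_def)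

lemma linear_on_ident: "linear_on D (\<lambda>a. a)"
  by (simp add: linear_on_def)

lemma linear_on_const_zero: "linear_on D (\<lambda>a. 0)"
  by (simp add: linear_on_def)

lemma linear_on_plus: "linear_on D F \<Longrightarrow> linear_on D G \<Longrightarrow> linear_on D (\<lambda>a. F a + G a)"
  by (simp add: linear_on_def fun_vs.scale_right_distrib add_ac)

lemma linear_on_fscale: "linear_on D F \<Longrightarrow> linear_on D (\<lambda>a. fscale c (F a))"
  by (simp add: linear_on_def fun_vs.scale_right_distrib mult.commute)

lemma linear_on_sum_maps:
  "(\<And>i. i \<in> A \<Longrightarrow> linear_on D (F i)) \<Longrightarrow> linear_on D (\<lambda>a. \<Sum>i\<in>A. F i a)"
  by (induction A rule: infinite_finite_induct)
    (auto simp: linear_on_const_zero intro!: linear_on_plus)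

lemma span_combination_induct [consumes 1, case_names zero step]:
  assumes "x \<in> fun_vs.span S" and "P 0"
    and "\<And>c x y. x \<in> S \<Longrightarrow> y \<in> fun_vs.span S \<Longrightarrow> P y \<Longrightarrow> P (fscale c x + y)"
  shows "P x"
proof -
  from assms(1) have "x \<in> fun_vs.span S \<and> P x"
  proof (induction rule: fun_vs.span_induct_alt)
    case base
    then show ?case using assms(2) by (simp add: fun_vs.span_zero)
  next
    case (step c x y)
    then show ?case
      using assms(3) by (simp add: fun_vs.span_add fun_vs.span_base fun_vs.span_scale)
  qed
  then show ?thesis ..
qed

lemma linear_on_span_eqI:
  assumes "linear_on (fun_vs.span S) F" "linear_on (fun_vs.span S) G"
    and "\<And>x. x \<in> S \<Longrightarrow> F x = G x" and "x \<in> fun_vs.span S"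
  shows "F x = G x"
  using assms(4)
proof (induction rule: span_combination_induct)
  case zero
  then show ?case using assms by (simp add: linear_on_zero[of "fun_vs.span S"] fun_vs.span_zero)
next
  case (step c x y)
  then show ?case
    using assms(1-3)
    by (simp add: linear_on_add[of "fun_vs.span S"] linear_on_scale[of "fun_vs.span S"]
        fun_vs.span_base fun_vs.span_scale)
qed

lemma linear_on_span_into:
  assumes "linear_on (fun_vs.span S) F" "fun_vs.subspace U"
    and "\<And>x. x \<in> S \<Longrightarrow> F x \<in> U" and "x \<in> fun_vs.span S"
  shows "F x \<in> U"
  using assms(4)
proof (induction rule: span_combination_induct)
  case zero
  then show ?case
    using assms by (simp add: linear_on_zero[of "fun_vs.span S"] fun_vs.span_zero fun_vs.subspace_0)
next
  case (step c x y)
  then show ?case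
    using assms(1-3)
    by (simp add: linear_on_add[of "fun_vs.span S"] linear_on_scale[of "fun_vs.span S"]
        fun_vs.span_base fun_vs.span_scale fun_vs.subspace_add fun_vs.subspace_scale)
qed

lemma linear_on_span_zeroI:
  assumes "linear_on (fun_vs.span S) F" and "\<And>x. x \<in> S \<Longrightarrow> F x = 0" and "x \<in> fun_vs.span S"
  shows "F x = 0"
  using linear_on_span_eqI[OF assms(1) linear_on_const_zero] assms(2,3) by blast

text \<open>The description operator in \<^const>\<open>linear_extension\<close> picks out a map as soon as some linear
  map takes the prescribed values: uniqueness is automatic because the prescribed arguments span.\<close>

lemma linear_extension_eq:
  assumes D: "D = fun_vs.span (fst ` G)" and F: "linear_on D F"
    and G: "\<And>a b. (a, b) \<in> G \<Longrightarrow> F a = b" and x: "x \<in> D"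
  shows "linear_extension D G x = F x"
proof -
  have "linear_extension D G = restrict F D"
    unfolding linear_extension_def
  proof (rule the_equality)
    have "linear_on D (restrict F D)"
      by (rule linear_onI)
        (simp_all add: linear_on_add[OF F] linear_on_scale[OF F] D fun_vs.span_add fun_vs.span_scale)
    moreover have "restrict F D a = b" if "(a, b) \<in> G" for a b
      using that G[OF that] by (auto simp: D intro!: fun_vs.span_base image_eqI[where x = "(a, b)"])
    ultimately show "restrict F D \<in> extensional D \<and> linear_on D (restrict F D) \<and>
        (\<forall>(a, b)\<in>G. restrict F D a = b)"
      by auto
  next
    fix H assume H: "H \<in> extensional D \<and> linear_on D H \<and> (\<forall>(a, b)\<in>G. H a = b)"
    have "H a = F a" if "a \<in> D" for a
    proof (rule linear_on_span_eqI[of "fst ` G"])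
      show "linear_on (fun_vs.span (fst ` G)) H" "linear_on (fun_vs.span (fst ` G)) F"
        using H F D by simp_all
      show "H x = F x" if x: "x \<in> fst ` G" for x
      proof -
        obtain b where b: "(x, b) \<in> G" using x by force
        then have "H x = b" using H by auto
        then show ?thesis using G[OF b] by simp
      qed
    qed (use that D in simp)
    then show "H = restrict F D"
      using H by (auto simp: extensional_def)
  qed
  then show ?thesis using x by simp
qed

definition bilinear_on :: "('a \<Rightarrow> 'k::field) set \<Rightarrow> ('b \<Rightarrow> 'k) set \<Rightarrow>
    (('a \<Rightarrow> 'k) \<Rightarrow> ('b \<Rightarrow> 'k) \<Rightarrow> 'c \<Rightarrow> 'k) \<Rightarrow> bool" where
  "bilinear_on D E F \<longleftrightarrow>
     (\<forall>a\<in>D. linear_on E (F a)) \<and> (\<forall>b\<in>E. linear_on D (\<lambda>a. F a b))"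

lemma bilinear_onI:
  "(\<And>a. a \<in> D \<Longrightarrow> linear_on E (F a)) \<Longrightarrow> (\<And>b. b \<in> E \<Longrightarrow> linear_on D (\<lambda>a. F a b)) \<Longrightarrow> bilinear_on D E F"
  by (simp add: bilinear_on_def)

lemma bilinear_on_left: "bilinear_on D E F \<Longrightarrow> b \<in> E \<Longrightarrow> linear_on D (\<lambda>a. F a b)"
  and bilinear_on_right: "bilinear_on D E F \<Longrightarrow> a \<in> D \<Longrightarrow> linear_on E (F a)"
  by (simp_all add: bilinear_on_def)

lemma bilinear_on_compose_left:
  "bilinear_on D E F \<Longrightarrow> linear_on D' A \<Longrightarrow> (\<And>a. a \<in> D' \<Longrightarrow> A a \<in> D) \<Longrightarrow> bilinear_on D' E (\<lambda>a b. F (A a) b)"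
  by (auto simp: bilinear_on_def linear_on_def)

lemma bilinear_on_compose_right:
  "bilinear_on D E F \<Longrightarrow> linear_on E' B \<Longrightarrow> (\<And>b. b \<in> E' \<Longrightarrow> B b \<in> E) \<Longrightarrow> bilinear_on D E' (\<lambda>a b. F a (B b))"
  by (auto simp: bilinear_on_def linear_on_def)

lemma linear_on_compose_bilinear:
  assumes "bilinear_on D E F" "linear_on C G" "\<And>a b. a \<in> D \<Longrightarrow> b \<in> E \<Longrightarrow> F a b \<in> C"
  shows "bilinear_on D E (\<lambda>a b. G (F a b))"
  by (intro bilinear_onI linear_on_compose[OF _ _ assms(2)])
    (auto intro: assms bilinear_on_left[OF assms(1)] bilinear_on_right[OF assms(1)])

lemma bilinear_on_span_eqI:
  assumes F: "bilinear_on (fun_vs.span S) (fun_vs.span S') F"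
    and G: "bilinear_on (fun_vs.span S) (fun_vs.span S') G"
    and eq: "\<And>x y. x \<in> S \<Longrightarrow> y \<in> S' \<Longrightarrow> F x y = G x y"
    and "x \<in> fun_vs.span S" "y \<in> fun_vs.span S'"
  shows "F x y = G x y"
proof -
  have "F s y = G s y" if "s \<in> S" for s
    by (rule linear_on_span_eqI[OF bilinear_on_right[OF F] bilinear_on_right[OF G] eq[OF that] assms(5)])
      (simp_all add: that fun_vs.span_base)
  then show ?thesis
    using linear_on_span_eqI[OF bilinear_on_left[OF F] bilinear_on_left[OF G]] assms(4,5) by blast
qed

lemma bilinear_on_span_into:
  assumes F: "bilinear_on (fun_vs.span S) (fun_vs.span S') F" and U: "fun_vs.subspace U"
    and mem: "\<And>x y. x \<in> S \<Longrightarrow> y \<in> S' \<Longrightarrow> F x y \<in> U"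
    and "x \<in> fun_vs.span S" "y \<in> fun_vs.span S'"
  shows "F x y \<in> U"
proof -
  have "F s y \<in> U" if "s \<in> S" for s
    using linear_on_span_into[OF bilinear_on_right[OF F fun_vs.span_base[OF that]] U] mem that assms(5)
    by blast
  then show ?thesis
    using linear_on_span_into[OF bilinear_on_left[OF F] U] assms(4,5) by blast
qed

section \<open>Tensors as functionals on multilinear functions\<close>

lemma vector_space_field: "vector_space ((*) :: 'k::field \<Rightarrow> 'k \<Rightarrow> 'k)"
  by unfold_locales (auto simp: algebra_simps)

lemma sum_fun_apply: "(\<Sum>i\<in>A. f i) x = (\<Sum>i\<in>A. f i x :: 'k::comm_monoid_add)"
  by (induction A rule: infinite_finite_induct) (auto simp: fun_apply)

locale tensor_space = vector_space smul
  for smul :: "'k::real_normed_field \<Rightarrow> 'v::ab_group_add \<Rightarrow> 'v"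
begin

abbreviation T :: "('k, 'v) tensor set" where "T \<equiv> tensor_algebra smul"
abbreviation W :: "'v list \<Rightarrow> ('k, 'v) tensor" where "W \<equiv> word smul"
abbreviation mult (infixl "\<otimes>" 70) where "s \<otimes> t \<equiv> tensor_mult smul s t"
abbreviation outer_product (infixl "\<boxtimes>" 65) where "s \<boxtimes> t \<equiv> outer smul s t"

lemma multilinear_iff:
  "multilinear smul f \<longleftrightarrow>
     (\<forall>xs ys v w. f (xs @ (v + w) # ys) = f (xs @ v # ys) + f (xs @ w # ys)) \<and>
     (\<forall>xs ys c v. f (xs @ smul c v # ys) = c * f (xs @ v # ys))"
  unfolding multilinear_def Vector_Spaces.linear_iff
  by (auto simp: vector_space_field vector_space_axioms)

lemma multilinearI:
  assumes "\<And>xs ys v w. f (xs @ (v + w) # ys) = f (xs @ v # ys) + f (xs @ w # ys)"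
    and "\<And>xs ys c v. f (xs @ smul c v # ys) = c * f (xs @ v # ys)"
  shows "multilinear smul f"
  using assms by (simp add: multilinear_iff)

lemma multilinear_add: "multilinear smul f \<Longrightarrow> f (xs @ (v + w) # ys) = f (xs @ v # ys) + f (xs @ w # ys)"
  and multilinear_scale: "multilinear smul f \<Longrightarrow> f (xs @ smul c v # ys) = c * f (xs @ v # ys)"
  by (simp_all add: multilinear_iff)

lemma multilinear_zero: "multilinear smul (\<lambda>xs. 0)"
  by (simp add: multilinear_iff)

lemma multilinear_plus:
  "multilinear smul f \<Longrightarrow> multilinear smul g \<Longrightarrow> multilinear smul (\<lambda>xs. f xs + g xs)"
  by (auto simp: multilinear_iff algebra_simps)

lemma multilinear_times: "multilinear smul f \<Longrightarrow> multilinear smul (\<lambda>xs. c * f xs)"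
  by (auto simp: multilinear_iff algebra_simps)

lemma multilinear_sum:
  "(\<And>i. i \<in> A \<Longrightarrow> multilinear smul (f i)) \<Longrightarrow> multilinear smul (\<lambda>xs. \<Sum>i\<in>A. f i xs)"
  by (induction A rule: infinite_finite_induct)
    (auto simp: multilinear_zero intro!: multilinear_plus)

lemma multilinear_Cons: "multilinear smul f \<Longrightarrow> multilinear smul (\<lambda>ys. f (x # ys))"
  unfolding multilinear_iff by (metis append_Cons)

lemma multilinear_append:
  "multilinear smul f \<Longrightarrow> multilinear smul (\<lambda>ys. f (xs @ ys))"
  "multilinear smul f \<Longrightarrow> multilinear smul (\<lambda>xs. f (xs @ ys))"
  unfolding multilinear_iff append_assoc append_Cons
  by (auto simp only: append_assoc[symmetric])

lemma bimultilinear_append: "multilinear smul f \<Longrightarrow> bimultilinear smul (\<lambda>xs ys. f (xs @ ys))"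
  by (simp add: bimultilinear_def multilinear_append)

lemma word_add: "W (xs @ (v + w) # ys) = W (xs @ v # ys) + W (xs @ w # ys)"
  by (auto simp: word_def fun_eq_iff fun_apply multilinear_add)

lemma word_scale: "W (xs @ smul c v # ys) = fscale c (W (xs @ v # ys))"
  by (auto simp: word_def fun_eq_iff fun_apply multilinear_scale)

lemma word_in_T [simp]: "W xs \<in> T"
  by (simp add: tensor_algebra_def fun_vs.span_base)

lemma subspace_T [simp]: "fun_vs.subspace T"
  by (simp add: tensor_algebra_def)

lemma T_closed [simp]:
  "0 \<in> T" "a \<in> T \<Longrightarrow> b \<in> T \<Longrightarrow> a + b \<in> T" "a \<in> T \<Longrightarrow> b \<in> T \<Longrightarrow> a - b \<in> T"
  "a \<in> T \<Longrightarrow> fscale c a \<in> T"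
  by (simp_all add: tensor_algebra_def fun_vs.span_zero fun_vs.span_add fun_vs.span_diff fun_vs.span_scale)

lemma T_sum: "(\<And>i. i \<in> A \<Longrightarrow> f i \<in> T) \<Longrightarrow> sum f A \<in> T"
  by (rule fun_vs.subspace_sum) simp_all

lemma T_eqI:
  assumes "linear_on T F" "linear_on T G" "\<And>xs. F (W xs) = G (W xs)" "t \<in> T"
  shows "F t = G t"
  using linear_on_span_eqI[of "range W" F G t] assms by (auto simp: tensor_algebra_def)

lemma linear_on_T_into:
  assumes "linear_on T F" "fun_vs.subspace U" "\<And>xs. F (W xs) \<in> U" "t \<in> T"
  shows "F t \<in> U"
  using linear_on_span_into[of "range W" F U t] assms by (auto simp: tensor_algebra_def)

lemma T_bilinear_eqI:
  assumes "bilinear_on T T F" "bilinear_on T T G" "\<And>xs ys. F (W xs) (W ys) = G (W xs) (W ys)"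
    "s \<in> T" "t \<in> T"
  shows "F s t = G s t"
  using bilinear_on_span_eqI[of "range W" "range W" F G s t] assms by (auto simp: tensor_algebra_def)

lemma multilinear_linear_on_word:
  assumes "linear_on T F"
  shows "multilinear smul (\<lambda>xs. F (W xs) y)"
  by (rule multilinearI) (simp_all add: word_add word_scale fun_apply linear_on_add[OF assms] linear_on_scale[OF assms])

text \<open>A tensor is linear on multilinear functions only, since it vanishes on all others. This is why the
  two products below are bilinear on \<open>T\<close>, but not on the whole function space.\<close>

lemma tensor_functional:
  assumes "t \<in> T"
  shows tensor_add: "multilinear smul f \<Longrightarrow> multilinear smul g \<Longrightarrow> t (\<lambda>xs. f xs + g xs) = t f + t g"
    and tensor_times: "multilinear smul f \<Longrightarrow> t (\<lambda>xs. c * f xs) = c * t f"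
proof -
  have "(multilinear smul f \<longrightarrow> multilinear smul g \<longrightarrow> t (\<lambda>xs. f xs + g xs) = t f + t g) \<and>
    (multilinear smul f \<longrightarrow> t (\<lambda>xs. c * f xs) = c * t f)"
    using assms unfolding tensor_algebra_def
  proof (induction rule: span_combination_induct)
    case zero
    then show ?case by (simp add: fun_apply)
  next
    case (step d w t)
    then obtain xs where "w = W xs" by auto
    with step.IH show ?case
      by (auto simp: word_def fun_apply multilinear_plus multilinear_times algebra_simps)
  qed
  then show "multilinear smul f \<Longrightarrow> multilinear smul g \<Longrightarrow> t (\<lambda>xs. f xs + g xs) = t f + t g"
    "multilinear smul f \<Longrightarrow> t (\<lambda>xs. c * f xs) = c * t f"
    by blast+
qed

text \<open>The inner evaluation in \<^const>\<open>outer\<close> and \<^const>\<open>tensor_mult\<close> hands a multilinear function to the outer tensor,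
  so the linearity of the latter applies.\<close>

lemma multilinear_partial:
  assumes "bimultilinear smul g" "t \<in> T"
  shows "multilinear smul (\<lambda>xs. t (g xs))"
proof (rule multilinearI)
  have g: "multilinear smul (g xs)" "multilinear smul (\<lambda>xs. g xs ys)" for xs ys
    using assms(1) by (auto simp: bimultilinear_def)
  show "t (g (xs @ (v + w) # ys)) = t (g (xs @ v # ys)) + t (g (xs @ w # ys))" for xs v w ys
    using tensor_add[OF assms(2) g(1)[of "xs @ v # ys"] g(1)[of "xs @ w # ys"]]
    by (simp add: multilinear_add[OF g(2), symmetric])
  show "t (g (xs @ smul c v # ys)) = c * t (g (xs @ v # ys))" for xs c v ys
    using tensor_times[OF assms(2) g(1)[of "xs @ v # ys"], of c]
    by (simp add: multilinear_scale[OF g(2), symmetric])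
qed

lemma bilinear_on_outer: "bilinear_on T T (\<lambda>a b. a \<boxtimes> b)"
proof (rule bilinear_onI; rule linear_onI)
  fix a b b' :: "('k, 'v) tensor" and c
  assume a: "a \<in> T" and b: "b \<in> T"
  show "a \<boxtimes> fscale c b = fscale c (a \<boxtimes> b)"
    using tensor_times[OF a multilinear_partial[OF _ b]] by (auto simp: outer_def fun_eq_iff fun_apply)
  assume b': "b' \<in> T"
  show "a \<boxtimes> (b + b') = (a \<boxtimes> b) + (a \<boxtimes> b')"
    using tensor_add[OF a multilinear_partial[OF _ b] multilinear_partial[OF _ b']]
    by (auto simp: outer_def fun_eq_iff fun_apply)
qed (auto simp: outer_def fun_eq_iff fun_apply)

lemma bilinear_on_mult: "bilinear_on T T (\<lambda>a b. a \<otimes> b)"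
proof (rule bilinear_onI; rule linear_onI)
  fix a b b' :: "('k, 'v) tensor" and c
  assume a: "a \<in> T" and b: "b \<in> T"
  show "a \<otimes> fscale c b = fscale c (a \<otimes> b)"
    using tensor_times[OF a multilinear_partial[OF bimultilinear_append b]]
    by (auto simp: tensor_mult_def fun_eq_iff fun_apply)
  assume b': "b' \<in> T"
  show "a \<otimes> (b + b') = (a \<otimes> b) + (a \<otimes> b')"
    using tensor_add[OF a multilinear_partial[OF bimultilinear_append b]
        multilinear_partial[OF bimultilinear_append b']]
    by (auto simp: tensor_mult_def fun_eq_iff fun_apply)
qed (auto simp: tensor_mult_def fun_eq_iff fun_apply)

lemmas mult_linear_left = bilinear_on_left[OF bilinear_on_mult]
  and mult_linear_right = bilinear_on_right[OF bilinear_on_mult]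
  and outer_linear_left = bilinear_on_left[OF bilinear_on_outer]
  and outer_linear_right = bilinear_on_right[OF bilinear_on_outer]

lemma mult_in_T [simp]:
  assumes "s \<in> T" "t \<in> T"
  shows "s \<otimes> t \<in> T"
proof (rule bilinear_on_span_into[where F = "tensor_mult smul" and S = "range W" and S' = "range W"])
  show "bilinear_on (fun_vs.span (range W)) (fun_vs.span (range W)) (\<lambda>a b. a \<otimes> b)"
    using bilinear_on_mult by (simp add: tensor_algebra_def)
qed (use assms in \<open>auto simp: tensor_algebra_def[symmetric] tensor_mult_word\<close>)

lemma mult_one [simp]: "t \<in> T \<Longrightarrow> W [] \<otimes> t = t" "t \<in> T \<Longrightarrow> t \<otimes> W [] = t"
  by (rule T_eqI[where t = t], auto simp: tensor_mult_word linear_on_ident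
      intro: mult_linear_left mult_linear_right)+

lemma mult_assoc:
  assumes "r \<in> T" "s \<in> T" "t \<in> T"
  shows "r \<otimes> s \<otimes> t = r \<otimes> (s \<otimes> t)"
proof -
  have *: "W xs \<otimes> s \<otimes> t = W xs \<otimes> (s \<otimes> t)" for xs
  proof (rule T_bilinear_eqI[where s = s and t = t])
    show "bilinear_on T T (\<lambda>s t. W xs \<otimes> s \<otimes> t)"
      by (rule bilinear_on_compose_left[OF bilinear_on_mult]) (auto intro: mult_linear_right)
    show "bilinear_on T T (\<lambda>s t. W xs \<otimes> (s \<otimes> t))"
      by (rule linear_on_compose_bilinear[OF bilinear_on_mult mult_linear_right]) auto
  qed (use assms in \<open>auto simp: tensor_mult_word\<close>)
  show ?thesis
    by (rule T_eqI[where t = r]; (intro linear_on_compose[OF mult_linear_left _ mult_linear_left]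
          mult_linear_left)?) (use assms * in auto)
qed

text \<open>Linear maps into spaces of functions are obtained by transposition: apply the tensor, a
  functional, to each coordinate of a multilinear map.\<close>

definition lift :: "('v list \<Rightarrow> 'c \<Rightarrow> 'k) \<Rightarrow> ('k, 'v) tensor \<Rightarrow> 'c \<Rightarrow> 'k" where
  "lift g t = (\<lambda>y. t (\<lambda>xs. g xs y))"

definition lift2 :: "('v list \<Rightarrow> 'v list \<Rightarrow> 'c \<Rightarrow> 'k) \<Rightarrow> ('k, 'v) tensor2 \<Rightarrow> 'c \<Rightarrow> 'k" where
  "lift2 g u = (\<lambda>y. u (\<lambda>xs ys. g xs ys y))"

lemma linear_on_lift: "linear_on D (lift g)"
  by (rule linear_onI) (auto simp: lift_def fun_eq_iff fun_apply)

lemma linear_on_lift2: "linear_on D (lift2 g)"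
  by (rule linear_onI) (auto simp: lift2_def fun_eq_iff fun_apply)

lemma lift_word: "(\<And>y. multilinear smul (\<lambda>xs. g xs y)) \<Longrightarrow> lift g (W xs) = g xs"
  by (auto simp: lift_def word_def)

lemma outer_word: "W xs \<boxtimes> W ys = (\<lambda>g. if bimultilinear smul g then g xs ys else 0)"
  by (auto simp: outer_def word_def bimultilinear_def fun_eq_iff)

lemma lift2_word:
  "(\<And>y. bimultilinear smul (\<lambda>xs ys. g xs ys y)) \<Longrightarrow> lift2 g (W xs \<boxtimes> W ys) = g xs ys"
  by (auto simp: lift2_def outer_word)

definition T2 :: "('k, 'v) tensor2 set" where
  "T2 = fun_vs.span {W xs \<boxtimes> W ys |xs ys. True}"

lemma subspace_T2 [simp]: "fun_vs.subspace T2"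
  by (simp add: T2_def)

lemma outer_in_T2 [simp]:
  assumes "s \<in> T" "t \<in> T"
  shows "s \<boxtimes> t \<in> T2"
proof (rule bilinear_on_span_into[where F = "outer smul" and S = "range W" and S' = "range W"])
  show "bilinear_on (fun_vs.span (range W)) (fun_vs.span (range W)) (\<lambda>a b. a \<boxtimes> b)"
    using bilinear_on_outer by (simp add: tensor_algebra_def)
  show "x \<boxtimes> y \<in> T2" if "x \<in> range W" "y \<in> range W" for x y
    using that by (auto simp: T2_def intro!: fun_vs.span_base)
qed (use assms in \<open>auto simp: tensor_algebra_def[symmetric]\<close>)

lemma T2_eqI:
  assumes "linear_on T2 F" "linear_on T2 G" "\<And>xs ys. F (W xs \<boxtimes> W ys) = G (W xs \<boxtimes> W ys)" "u \<in> T2"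
  shows "F u = G u"
  using linear_on_span_eqI[of "{W xs \<boxtimes> W ys |xs ys. True}" F G u] assms by (auto simp: T2_def)

text \<open>The universal property of the tensor square.\<close>

lemma lift2_outer:
  assumes F: "bilinear_on T T F" and "s \<in> T" "t \<in> T"
  shows "lift2 (\<lambda>xs ys. F (W xs) (W ys)) (s \<boxtimes> t) = F s t"
proof (rule T_bilinear_eqI[where s = s and t = t])
  show "bilinear_on T T (\<lambda>s t. lift2 (\<lambda>xs ys. F (W xs) (W ys)) (s \<boxtimes> t))"
    by (rule linear_on_compose_bilinear[OF bilinear_on_outer linear_on_lift2]) auto
  show "lift2 (\<lambda>xs ys. F (W xs) (W ys)) (W xs \<boxtimes> W ys) = F (W xs) (W ys)" for xs ys
    by (rule lift2_word)
      (simp add: bimultilinear_def multilinear_linear_on_word bilinear_on_right[OF F]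
        multilinear_linear_on_word[OF bilinear_on_left[OF F word_in_T]])
qed (use assms in auto)

definition tensor_maps ::
    "(('k, 'v) tensor \<Rightarrow> ('k, 'v) tensor) \<Rightarrow> (('k, 'v) tensor \<Rightarrow> ('k, 'v) tensor) \<Rightarrow>
     ('k, 'v) tensor2 \<Rightarrow> ('k, 'v) tensor2" where
  "tensor_maps A B = lift2 (\<lambda>xs ys. A (W xs) \<boxtimes> B (W ys))"

lemma linear_on_tensor_maps: "linear_on D (tensor_maps A B)"
  by (simp add: tensor_maps_def linear_on_lift2)

lemma tensor_maps_outer:
  assumes "linear_on T A" "linear_on T B" "\<And>t. t \<in> T \<Longrightarrow> A t \<in> T" "\<And>t. t \<in> T \<Longrightarrow> B t \<in> T" "s \<in> T" "t \<in> T"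
  shows "tensor_maps A B (s \<boxtimes> t) = A s \<boxtimes> B t"
  unfolding tensor_maps_def
  by (rule lift2_outer[OF bilinear_on_compose_left[OF bilinear_on_compose_right[OF bilinear_on_outer]]])
    (use assms in auto)

end

section \<open>The translation automorphism of the tensor algebra\<close>

context tensor_space
begin

abbreviation linear_form :: "('v \<Rightarrow> 'k) \<Rightarrow> bool" where
  "linear_form \<phi> \<equiv> Vector_Spaces.linear smul (*) \<phi>"

lemma linear_form_add: "linear_form \<phi> \<Longrightarrow> \<phi> (v + w) = \<phi> v + \<phi> w"
  and linear_form_scale: "linear_form \<phi> \<Longrightarrow> \<phi> (smul c v) = c * \<phi> v"
  by (simp_all add: Vector_Spaces.linear_iff)

lemma linear_form_uminus: "linear_form \<phi> \<Longrightarrow> linear_form (\<lambda>v. - \<phi> v)"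
  by (simp add: Vector_Spaces.linear_iff)

primrec translate_word :: "('v \<Rightarrow> 'k) \<Rightarrow> 'v list \<Rightarrow> ('k, 'v) tensor" where
  "translate_word \<phi> [] = W []"
| "translate_word \<phi> (x # xs) = (W [x] \<otimes> translate_word \<phi> xs) + fscale (\<phi> x) (translate_word \<phi> xs)"

definition translate :: "('v \<Rightarrow> 'k) \<Rightarrow> ('k, 'v) tensor \<Rightarrow> ('k, 'v) tensor" where
  "translate \<phi> = lift (translate_word \<phi>)"

lemma translate_word_in_T [simp]: "translate_word \<phi> xs \<in> T"
  by (induction xs) simp_all

lemma translate_word_append:
  "translate_word \<phi> (xs @ ys) = translate_word \<phi> xs \<otimes> translate_word \<phi> ys"
  by (induction xs)
    (simp_all add: mult_assoc linear_on_add[OF mult_linear_left] linear_on_scale[OF mult_linear_left])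

lemma translate_word_add:
  assumes "linear_form \<phi>"
  shows "translate_word \<phi> (xs @ (v + w) # ys) = translate_word \<phi> (xs @ v # ys) + translate_word \<phi> (xs @ w # ys)"
  using word_add[of "[]" v w "[]"]
  by (simp add: translate_word_append linear_form_add[OF assms] fun_vs.scale_left_distrib
      linear_on_add[OF mult_linear_left] linear_on_add[OF mult_linear_right] add_ac)

lemma translate_word_scale:
  assumes "linear_form \<phi>"
  shows "translate_word \<phi> (xs @ smul c v # ys) = fscale c (translate_word \<phi> (xs @ v # ys))"
  using word_scale[of "[]" c v "[]"]
  by (simp add: translate_word_append linear_form_scale[OF assms] fun_vs.scale_right_distrib
      linear_on_scale[OF mult_linear_left] linear_on_scale[OF mult_linear_right]
      linear_on_add[OF mult_linear_right] flip: fun_vs.scale_scale)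

lemma translate_W [simp]: "linear_form \<phi> \<Longrightarrow> translate \<phi> (W xs) = translate_word \<phi> xs"
  unfolding translate_def
  by (rule lift_word, rule multilinearI) (simp_all add: translate_word_add translate_word_scale fun_apply)

lemma linear_on_translate: "linear_on D (translate \<phi>)"
  by (simp add: translate_def linear_on_lift)

lemma translate_in_T [simp]: "linear_form \<phi> \<Longrightarrow> t \<in> T \<Longrightarrow> translate \<phi> t \<in> T"
  by (rule linear_on_T_into[OF linear_on_translate]) simp_all

lemma translate_mult:
  assumes "linear_form \<phi>" "s \<in> T" "t \<in> T"
  shows "translate \<phi> (s \<otimes> t) = translate \<phi> s \<otimes> translate \<phi> t"
proof (rule T_bilinear_eqI[where s = s and t = t])
  show "bilinear_on T T (\<lambda>s t. translate \<phi> (s \<otimes> t))"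
    by (rule linear_on_compose_bilinear[OF bilinear_on_mult linear_on_translate]) auto
  show "bilinear_on T T (\<lambda>s t. translate \<phi> s \<otimes> translate \<phi> t)"
    by (rule bilinear_on_compose_left[OF bilinear_on_compose_right[OF bilinear_on_mult]])
      (auto simp: assms linear_on_translate)
qed (use assms in \<open>auto simp: tensor_mult_word translate_word_append\<close>)

text \<open>The composite is multiplicative and fixes every letter.\<close>

lemma translate_uminus:
  assumes "linear_form \<phi>" "t \<in> T"
  shows "translate (\<lambda>v. - \<phi> v) (translate \<phi> t) = t"
proof (rule T_eqI[where t = t])
  note \<phi> = assms(1) and \<psi> = linear_form_uminus[OF assms(1)]
  show "translate (\<lambda>v. - \<phi> v) (translate \<phi> (W xs)) = W xs" for xs
  proof (induction xs)
    case Nil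
    then show ?case using \<phi> \<psi> by simp
  next
    case (Cons x xs)
    have "translate (\<lambda>v. - \<phi> v) (W [x] \<otimes> translate_word \<phi> xs) =
        (W [x] + fscale (- \<phi> x) (W [])) \<otimes> W xs"
      using \<phi> \<psi> Cons by (simp add: translate_mult del: fun_vs.scale_minus_left)
    then show ?case
      using Cons \<phi> tensor_mult_word[of smul "[x]" xs]
      by (simp add: linear_on_add[OF linear_on_translate[of UNIV]]
          linear_on_scale[OF linear_on_translate[of UNIV]] linear_on_add[OF mult_linear_left]
          linear_on_scale[OF mult_linear_left] del: fun_vs.scale_minus_left)
        (simp add: fun_eq_iff fun_apply)
  qed
qed (use assms in \<open>auto intro!: linear_on_ident linear_on_compose[OF linear_on_translate _ linear_on_translate]\<close>)

lemma translate_bij_tensor_algebra: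
  assumes "linear_form \<phi>"
  shows "bij_betw (translate \<phi>) T T"
  using assms translate_uminus[OF linear_form_uminus[OF assms]]
  by (intro bij_betw_byWitness[where f' = "translate (\<lambda>v. - \<phi> v)"])
    (auto simp: translate_uminus linear_form_uminus)

lemma translation_eq:
  assumes \<phi>: "linear_form \<phi>"
  shows "translation smul \<phi> = restrict (translate \<phi>) T"
  unfolding translation_def
proof (rule the_equality)
  show "restrict (translate \<phi>) T \<in> extensional T \<and>
    unital_algebra_hom T (tensor_mult smul) (W []) (restrict (translate \<phi>) T) \<and>
    (\<forall>v. restrict (translate \<phi>) T (W [v]) = W [v] + fscale (\<phi> v) (W []))"
    using \<phi> linear_on_translate[of T \<phi>]
    by (auto simp: unital_algebra_hom_def translate_mult linear_on_def)
next
  fix F assume F: "F \<in> extensional T \<and> unital_algebra_hom T (tensor_mult smul) (W []) F \<and>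
    (\<forall>v. F (W [v]) = W [v] + fscale (\<phi> v) (W []))"
  then have lin: "linear_on T F" and mult: "\<And>s t. s \<in> T \<Longrightarrow> t \<in> T \<Longrightarrow> F (s \<otimes> t) = F s \<otimes> F t"
    and one: "F (W []) = W []"
    by (auto simp: unital_algebra_hom_def)
  have "F (W xs) = translate \<phi> (W xs)" for xs
  proof (induction xs)
    case (Cons x xs)
    then show ?case
      using \<phi> F mult[of "W [x]" "W xs"]
      by (simp add: tensor_mult_word linear_on_add[OF mult_linear_left] linear_on_scale[OF mult_linear_left])
  qed (simp add: one \<phi>)
  then have "F t = translate \<phi> t" if "t \<in> T" for t
    using T_eqI[OF lin linear_on_translate] that by blast
  then show "F = restrict (translate \<phi>) T"
    using F by (auto simp: extensional_def)
qed

lemma translation_automorphism: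
  assumes "linear_form \<phi>"
  shows "algebra_automorphism T (tensor_mult smul) (W []) (translation smul \<phi>)"
  using assms linear_on_translate[of T \<phi>] translate_bij_tensor_algebra[OF assms]
  by (auto simp: algebra_automorphism_def unital_algebra_hom_def translation_eq translate_mult
      linear_on_def cong: bij_betw_cong)

end

section \<open>Homogeneous vectors\<close>

lemma bit_add_self [simp]: "p + p = (0::bit)" "p + (p + q) = q"
  by (cases p; cases q; simp)+

declare add_bit_eq_xor [simp del] mult_bit_eq_and [simp del]

lemma parity_sign_simps [simp]:
  "parity_sign 0 = 1" "parity_sign 1 = - 1" "parity_sign (p + q) = parity_sign p * parity_sign q"
  "parity_sign p * parity_sign p = 1" "parity_sign p * (parity_sign p * c) = c"
  by (cases p; cases q; simp add: parity_sign_def)+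

locale graded_space = tensor_space smul
  for smul :: "'k::real_normed_field \<Rightarrow> 'v::ab_group_add \<Rightarrow> 'v" +
  fixes V :: "bit \<Rightarrow> 'v set"
  assumes subspace_graded: "\<And>i. subspace (V i)"
    and direct_sum: "\<And>v. \<exists>!a. a \<in> V 0 \<and> v - a \<in> V 1"
begin

abbreviation part :: "bit \<Rightarrow> 'v \<Rightarrow> 'v" where "part \<equiv> graded_component V"

lemma zero_in_V [simp]: "0 \<in> V p"
  using subspace_graded by (rule subspace_0)

lemma ex1_part: "\<exists>!a. a \<in> V p \<and> v - a \<in> V (p + 1)"
proof (cases "p = 0")
  case True
  then show ?thesis using direct_sum[of v] by simp
next
  case False
  then have 1: "p = 1" by simp
  obtain a where a: "a \<in> V 0" "v - a \<in> V 1" and uniq: "\<And>b. b \<in> V 0 \<Longrightarrow> v - b \<in> V 1 \<Longrightarrow> b = a"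
    using direct_sum[of v] by blast
  show ?thesis
  proof (rule ex1I[of _ "v - a"])
    show "v - a \<in> V p \<and> v - (v - a) \<in> V (p + 1)" using a 1 by simp
    show "b = v - a" if "b \<in> V p \<and> v - b \<in> V (p + 1)" for b
      using uniq[of "v - b"] that 1 by (auto simp: algebra_simps)
  qed
qed

lemma part_in_V [simp]: "part p v \<in> V p" and part_complement: "v - part p v \<in> V (p + 1)"
  using theI'[OF ex1_part[of p v]] by (simp_all add: graded_component_def)

lemma part_eqI: "a \<in> V p \<Longrightarrow> v - a \<in> V (p + 1) \<Longrightarrow> part p v = a"
  using the1_equality[OF ex1_part[of p v], of a] by (simp add: graded_component_def)

lemma part_same [simp]: "v \<in> V p \<Longrightarrow> part p v = v"
  by (rule part_eqI) simp_all

lemma part_other: "v \<in> V p \<Longrightarrow> q \<noteq> p \<Longrightarrow> part q v = 0"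
  by (rule part_eqI) (cases p; cases q; simp)+

lemma part_add: "part p (v + w) = part p v + part p w"
proof (rule part_eqI)
  show "v + w - (part p v + part p w) \<in> V (p + 1)"
    using subspace_add[OF subspace_graded part_complement[of v p] part_complement[of w p]]
    by (simp add: algebra_simps)
qed (simp add: subspace_add[OF subspace_graded])

lemma part_scale: "part p (smul c v) = smul c (part p v)"
proof (rule part_eqI)
  show "smul c v - smul c (part p v) \<in> V (p + 1)"
    using subspace_scale[OF subspace_graded part_complement[of v p], of c]
    by (simp add: scale_right_diff_distrib)
qed (simp add: subspace_scale[OF subspace_graded])

lemma parts_sum: "part 0 v + part 1 v = v"
proof -
  have "part 1 v = v - part 0 v"
    by (rule part_eqI) (use part_complement[of v 0] in simp_all)
  then show ?thesis by simp
qed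

text \<open>A form that vanishes on one parity sees only letters of the other one.\<close>

lemma even_form_parity:
  "linear_form f \<Longrightarrow> (\<And>v. v \<in> V (s + 1) \<Longrightarrow> f v = 0) \<Longrightarrow> v \<in> V p \<Longrightarrow> f v \<noteq> 0 \<Longrightarrow> p = s"
  by (cases p; cases s) auto

lemma homogeneous_simps [simp]:
  "homogeneous V [] vs \<longleftrightarrow> vs = []" "homogeneous V ps [] \<longleftrightarrow> ps = []"
  "homogeneous V (p # ps) (v # vs) \<longleftrightarrow> v \<in> V p \<and> homogeneous V ps vs"
  by (simp_all add: homogeneous_def)

lemma homogeneous_length: "homogeneous V ps vs \<Longrightarrow> length ps = length vs"
  by (simp add: homogeneous_def list_all2_lengthD)

lemma homogeneous_append:
  "homogeneous V ps vs \<Longrightarrow> homogeneous V qs ws \<Longrightarrow> homogeneous V (ps @ qs) (vs @ ws)"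
  by (simp add: homogeneous_def list_all2_appendI)

lemma homogeneous_nth: "homogeneous V ps vs \<Longrightarrow> i < length vs \<Longrightarrow> vs ! i \<in> V (ps ! i)"
  unfolding homogeneous_def by (metis list_all2_conv_all_nth)

lemma homogeneous_ConsE:
  assumes "homogeneous V ps (v # vs)"
  obtains p qs where "ps = p # qs" "v \<in> V p" "homogeneous V qs vs"
  using assms by (cases ps) auto

lemma word_in_span_homogeneous_append:
  assumes "homogeneous V ps as"
  shows "W (as @ xs) \<in> fun_vs.span {W vs |ps vs. homogeneous V ps vs \<and> length vs = length as + length xs}"
  using assms
proof (induction xs arbitrary: ps as)
  case Nil
  then show ?case by (auto intro!: fun_vs.span_base)
next
  case (Cons x xs)
  have "W ((as @ [part p x]) @ xs) \<in>
      fun_vs.span {W vs |ps vs. homogeneous V ps vs \<and> length vs = length as + length (x # xs)}" for p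
    using Cons.IH[of "ps @ [p]" "as @ [part p x]"] Cons.prems by (simp add: homogeneous_append)
  from fun_vs.span_add[OF this[of 0] this[of 1]] show ?case
    using word_add[of as "part 0 x" "part 1 x" xs] by (simp add: parts_sum)
qed

lemma tensor_power_homogeneous:
  "tensor_power smul n = fun_vs.span {W vs |ps vs. homogeneous V ps vs \<and> length vs = n}"
proof (rule antisym)
  show "tensor_power smul n \<subseteq> fun_vs.span {W vs |ps vs. homogeneous V ps vs \<and> length vs = n}"
    unfolding tensor_power_def
    using word_in_span_homogeneous_append[of "[]" "[]"]
    by (intro fun_vs.span_minimal) auto
  show "fun_vs.span {W vs |ps vs. homogeneous V ps vs \<and> length vs = n} \<subseteq> tensor_power smul n"
    unfolding tensor_power_def by (rule fun_vs.span_mono) blast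
qed

lemma T_homogeneous: "T = fun_vs.span {W vs |ps vs. homogeneous V ps vs}"
proof (rule antisym)
  have "W xs \<in> fun_vs.span {W vs |ps vs. homogeneous V ps vs}" for xs
    using word_in_span_homogeneous_append[of "[]" "[]" xs]
      fun_vs.span_mono[of "{W vs |ps vs. homogeneous V ps vs \<and> length vs = length xs}"
        "{W vs |ps vs. homogeneous V ps vs}"] by auto
  then show "T \<subseteq> fun_vs.span {W vs |ps vs. homogeneous V ps vs}"
    unfolding tensor_algebra_def by (intro fun_vs.span_minimal) auto
  show "fun_vs.span {W vs |ps vs. homogeneous V ps vs} \<subseteq> T"
    unfolding tensor_algebra_def by (rule fun_vs.span_mono) blast
qed

lemma T_eqI_homogeneous:
  assumes "linear_on T F" "linear_on T G" "\<And>ps vs. homogeneous V ps vs \<Longrightarrow> F (W vs) = G (W vs)" "t \<in> T"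
  shows "F t = G t"
  using linear_on_span_eqI[of "{W vs |ps vs. homogeneous V ps vs}" F G t] assms
  unfolding T_homogeneous[symmetric] by blast

lemma linear_on_T_into_homogeneous:
  assumes "linear_on T F" "fun_vs.subspace U" "\<And>ps vs. homogeneous V ps vs \<Longrightarrow> F (W vs) \<in> U" "t \<in> T"
  shows "F t \<in> U"
  using linear_on_span_into[of "{W vs |ps vs. homogeneous V ps vs}" F U t] assms
  unfolding T_homogeneous[symmetric] by blast

lemma tensor_power_eqI_homogeneous:
  assumes "linear_on (tensor_power smul n) F" "linear_on (tensor_power smul n) G"
    "\<And>ps vs. homogeneous V ps vs \<Longrightarrow> length vs = n \<Longrightarrow> F (W vs) = G (W vs)" "t \<in> tensor_power smul n"
  shows "F t = G t"
  using linear_on_span_eqI[of "{W vs |ps vs. homogeneous V ps vs \<and> length vs = n}" F G t] assms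
  unfolding tensor_power_homogeneous[symmetric] by blast

text \<open>Signed operations are given on homogeneous words only. They are extended to all words by splitting each
  letter into its even and its odd part; the recursion expands the sum over all lists of parities.\<close>

primrec homogeneous_ext :: "'v list \<Rightarrow> (bit list \<Rightarrow> 'v list \<Rightarrow> 'k) \<Rightarrow> 'k" where
  "homogeneous_ext [] h = h [] []"
| "homogeneous_ext (v # vs) h =
     homogeneous_ext vs (\<lambda>ps ws. h (0 # ps) (part 0 v # ws)) +
     homogeneous_ext vs (\<lambda>ps ws. h (1 # ps) (part 1 v # ws))"

lemma homogeneous_ext_linear:
  "homogeneous_ext vs (\<lambda>ps ws. h ps ws + h' ps ws) = homogeneous_ext vs h + homogeneous_ext vs h'"
  "homogeneous_ext vs (\<lambda>ps ws. c * h ps ws) = c * homogeneous_ext vs h"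
  "homogeneous_ext vs (\<lambda>ps ws. 0) = 0"
  by (induction vs arbitrary: h h') (simp_all add: algebra_simps)

lemma multilinear_homogeneous_ext:
  assumes "\<And>ps. multilinear smul (h ps)"
  shows "multilinear smul (\<lambda>vs. homogeneous_ext vs h)"
proof (rule multilinearI)
  show "homogeneous_ext (xs @ (v + w) # ys) h = homogeneous_ext (xs @ v # ys) h + homogeneous_ext (xs @ w # ys) h"
    for xs v w ys
    using assms
  proof (induction xs arbitrary: h)
    case Nil
    then show ?case
      using multilinear_add[OF Nil, of _ "[]"]
      by (simp add: part_add homogeneous_ext_linear)
  next
    case (Cons x xs)
    then show ?case by (simp add: multilinear_Cons)
  qed
  show "homogeneous_ext (xs @ smul c v # ys) h = c * homogeneous_ext (xs @ v # ys) h" for xs c v ys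
    using assms
  proof (induction xs arbitrary: h)
    case Nil
    then show ?case
      using multilinear_scale[OF Nil, of _ "[]"]
      by (simp add: part_scale homogeneous_ext_linear algebra_simps)
  next
    case (Cons x xs)
    then show ?case by (simp add: multilinear_Cons algebra_simps)
  qed
qed

lemma multilinear_homogeneous_ext_parameter:
  assumes "\<And>ps ws. multilinear smul (h ps ws)"
  shows "multilinear smul (\<lambda>vs. homogeneous_ext ws (\<lambda>ps ws. h ps ws vs))"
  using assms by (induction ws arbitrary: h) (simp_all add: multilinear_plus)

text \<open>At most one part of a homogeneous letter is non-zero. The letter 0 has both parities, but there \<open>h\<close> vanishes.\<close>

lemma homogeneous_ext_eq:
  assumes "\<And>ps. multilinear smul (h ps)" "homogeneous V ps vs"
  shows "homogeneous_ext vs h = h ps vs"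
  using assms
proof (induction vs arbitrary: ps h)
  case (Cons v vs)
  from Cons.prems(2) obtain p qs where p: "ps = p # qs" "v \<in> V p" "homogeneous V qs vs"
    by (rule homogeneous_ConsE)
  have zero: "h ps (0 # ws) = 0" for ps ws
    using multilinear_scale[OF Cons.prems(1), of ps "[]" 0 0 ws] by simp
  have "homogeneous_ext vs (\<lambda>ps ws. h (p # ps) (part p v # ws)) = h ps (v # vs)"
    using Cons.IH[of "\<lambda>ps ws. h (p # ps) (v # ws)" qs] Cons.prems(1) p by (simp add: multilinear_Cons)
  moreover have "homogeneous_ext vs (\<lambda>ps ws. h ((p + 1) # ps) (part (p + 1) v # ws)) = 0"
    using part_other[OF p(2), of "p + 1"] by (simp add: zero homogeneous_ext_linear)
  ultimately show ?case by (cases p) auto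
qed simp

definition homogeneous_lift :: "(bit list \<Rightarrow> 'v list \<Rightarrow> 'c \<Rightarrow> 'k) \<Rightarrow> ('k, 'v) tensor \<Rightarrow> 'c \<Rightarrow> 'k" where
  "homogeneous_lift h = lift (\<lambda>vs y. homogeneous_ext vs (\<lambda>ps ws. h ps ws y))"

lemma linear_on_homogeneous_lift: "linear_on D (homogeneous_lift h)"
  by (simp add: homogeneous_lift_def linear_on_lift)

lemma homogeneous_lift_word:
  assumes "\<And>ps y. multilinear smul (\<lambda>vs. h ps vs y)" "homogeneous V ps vs"
  shows "homogeneous_lift h (W vs) = h ps vs"
  by (simp add: homogeneous_lift_def lift_word multilinear_homogeneous_ext assms
      homogeneous_ext_eq[OF _ assms(2)])

end

section \<open>Koszul signs\<close>

text \<open>As a product over pairs of positions the sign can be compared pair by pair.\<close>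

lemma koszul_sign_prod:
  "koszul_sign \<sigma> ps = (\<Prod>(i, j)\<in>{(i, j). i < j \<and> j < length ps}.
     if \<sigma> i > \<sigma> j \<and> ps ! \<sigma> i = 1 \<and> ps ! \<sigma> j = 1 then - 1 else 1 :: 'k::field)"
proof -
  have fin: "finite {(i, j). i < j \<and> j < length ps}"
    by (rule finite_subset[of _ "{..<length ps} \<times> {..<length ps}"]) auto
  have "koszul_sign \<sigma> ps = (\<Prod>x\<in>{x \<in> {(i, j). i < j \<and> j < length ps}.
      (case x of (i, j) \<Rightarrow> \<sigma> i > \<sigma> j \<and> ps ! \<sigma> i = 1 \<and> ps ! \<sigma> j = 1)}. - 1 :: 'k)"
    by (simp add: koszul_sign_def) (rule arg_cong[where f = "\<lambda>A. (- 1) ^ card A"], auto)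
  then show ?thesis
    by (subst (asm) prod.inter_filter[OF fin]) (simp add: case_prod_unfold)
qed

lemma prod_pairs_permute:
  fixes F :: "nat \<Rightarrow> nat \<Rightarrow> 'k::field"
  assumes \<rho>: "\<rho> permutes {..<n}" and sym: "\<And>i j. F i j = F j i"
  shows "(\<Prod>(i, j)\<in>{(i, j). i < j \<and> j < n}. F (\<rho> i) (\<rho> j)) = (\<Prod>(i, j)\<in>{(i, j). i < j \<and> j < n}. F i j)"
proof -
  define sorted_pair where "sorted_pair f = (\<lambda>(i, j). (min (f i) (f j), max (f i) (f j :: nat)))" for f :: "nat \<Rightarrow> nat"
  have maps: "sorted_pair f x \<in> {(i, j). i < j \<and> j < n}"
    if f: "f permutes {..<n}" and x: "x \<in> {(i, j). i < j \<and> j < n}" for f x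
  proof -
    obtain i j where x: "x = (i, j)" "i < j" "j < n" using x by auto
    have "f i < n" "f j < n" "f i \<noteq> f j"
      using permutes_in_image[OF f, of i] permutes_in_image[OF f, of j] x
        inj_eq[OF permutes_inj[OF f], of i j] by auto
    then show ?thesis by (auto simp: sorted_pair_def x min_def max_def)
  qed
  have inverse: "sorted_pair g (sorted_pair f x) = x"
    if "x \<in> {(i, j). i < j \<and> j < n}" "\<And>i. g (f i) = i" for f g x
    using that by (auto simp: sorted_pair_def min_def max_def)
  show ?thesis
  proof (rule prod.reindex_bij_witness[where j = "sorted_pair \<rho>" and i = "sorted_pair (inv \<rho>)"])
    fix x assume x: "x \<in> {(i, j). i < j \<and> j < n}"
    show "sorted_pair (inv \<rho>) (sorted_pair \<rho> x) = x" "sorted_pair \<rho> (sorted_pair (inv \<rho>) x) = x"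
      using permutes_inverses[OF \<rho>] inverse[OF x] by blast+
    show "sorted_pair \<rho> x \<in> {(i, j). i < j \<and> j < n}" "sorted_pair (inv \<rho>) x \<in> {(i, j). i < j \<and> j < n}"
      using maps[OF \<rho> x] maps[OF permutes_inv[OF \<rho>] x] by blast+
    show "(case sorted_pair \<rho> x of (i, j) \<Rightarrow> F i j) = (case x of (i, j) \<Rightarrow> F (\<rho> i) (\<rho> j))"
      using sym by (cases x) (simp add: sorted_pair_def min_def max_def)
  qed
qed

text \<open>The cocycle identity behind the action of the symmetric group: a pair of positions is inverted by
  \<open>\<sigma> \<circ> \<rho>\<close> iff either \<open>\<rho>\<close> inverts it or \<open>\<sigma>\<close> inverts its image under \<open>\<rho>\<close>, but not both.\<close>

lemma koszul_sign_compose: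
  assumes \<sigma>: "\<sigma> permutes {..<length ps}" and \<rho>: "\<rho> permutes {..<length ps}"
  shows "koszul_sign (\<sigma> \<circ> \<rho>) ps = (koszul_sign \<sigma> ps * koszul_sign \<rho> (permute_list \<sigma> ps) :: 'k::field)"
proof -
  let ?P = "{(i, j). i < j \<and> j < length ps}"
  define F :: "nat \<Rightarrow> nat \<Rightarrow> 'k" where
    "F i j = (if (i < j) \<noteq> (\<sigma> i < \<sigma> j) \<and> ps ! \<sigma> i = 1 \<and> ps ! \<sigma> j = 1 then - 1 else 1)" for i j
  have inj: "\<sigma> i = \<sigma> j \<longleftrightarrow> i = j" "\<rho> i = \<rho> j \<longleftrightarrow> i = j" for i j
    using \<sigma> \<rho> by (auto dest!: permutes_inj simp: inj_eq)
  have sym: "F i j = F j i" for i j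
    using inj(1)[of i j] by (auto simp: F_def)
  have "koszul_sign \<sigma> ps = (\<Prod>(i, j)\<in>?P. F i j)"
    unfolding koszul_sign_prod by (rule prod.cong) (auto simp: F_def inj(1) order.strict_iff_order)
  also have "\<dots> = (\<Prod>(i, j)\<in>?P. F (\<rho> i) (\<rho> j))"
    using prod_pairs_permute[of \<rho> _ F, OF \<rho> sym] by simp
  finally have *: "koszul_sign \<sigma> ps = (\<Prod>(i, j)\<in>?P. F (\<rho> i) (\<rho> j))" .
  have "koszul_sign \<sigma> ps * koszul_sign \<rho> (permute_list \<sigma> ps) = (\<Prod>(i, j)\<in>?P. F (\<rho> i) (\<rho> j) *
      (if \<rho> i > \<rho> j \<and> permute_list \<sigma> ps ! \<rho> i = 1 \<and> permute_list \<sigma> ps ! \<rho> j = 1 then - 1 else 1))"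
    unfolding * koszul_sign_prod[of \<rho>] by (simp add: case_prod_unfold flip: prod.distrib)
  also have "\<dots> = koszul_sign (\<sigma> \<circ> \<rho>) ps"
    unfolding koszul_sign_prod
  proof (rule prod.cong; clarify)
    fix i j assume ij: "i < j" "j < length ps"
    have lt: "\<rho> i < length ps" "\<rho> j < length ps"
      using permutes_in_image[OF \<rho>, of i] permutes_in_image[OF \<rho>, of j] ij by auto
    have nth: "permute_list \<sigma> ps ! \<rho> i = ps ! \<sigma> (\<rho> i)" "permute_list \<sigma> ps ! \<rho> j = ps ! \<sigma> (\<rho> j)"
      using permute_list_nth[OF \<sigma>] lt by auto
    have "\<rho> i \<noteq> \<rho> j" "\<sigma> (\<rho> i) \<noteq> \<sigma> (\<rho> j)"
      using ij inj by auto
    then show "F (\<rho> i) (\<rho> j) *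
      (if \<rho> j < \<rho> i \<and> permute_list \<sigma> ps ! \<rho> i = 1 \<and> permute_list \<sigma> ps ! \<rho> j = 1 then - 1 else 1) =
      (if (\<sigma> \<circ> \<rho>) j < (\<sigma> \<circ> \<rho>) i \<and> ps ! (\<sigma> \<circ> \<rho>) i = 1 \<and> ps ! (\<sigma> \<circ> \<rho>) j = 1 then - 1 else 1)"
      unfolding nth F_def by auto
  qed
  finally show ?thesis ..
qed

lemma koszul_sign_id [simp]: "koszul_sign id ps = 1"
  unfolding koszul_sign_prod by (rule prod.neutral) auto

abbreviation adjacent_swap :: "nat \<Rightarrow> nat \<Rightarrow> nat" where
  "adjacent_swap i \<equiv> Transposition.transpose i (Suc i)"

lemma koszul_sign_adjacent_swap:
  assumes "Suc i < length ps"
  shows "koszul_sign (adjacent_swap i) ps = (parity_sign (ps ! i * ps ! Suc i) :: 'k::field)"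
proof -
  have "{(k, l). k < l \<and> l < length ps \<and> adjacent_swap i k > adjacent_swap i l \<and>
      ps ! adjacent_swap i k = 1 \<and> ps ! adjacent_swap i l = 1} =
      (if ps ! i = 1 \<and> ps ! Suc i = 1 then {(i, Suc i)} else {})"
    using assms by (auto simp: Transposition.transpose_def split: if_splits)
  then show ?thesis
    by (simp add: koszul_sign_def parity_sign_def)
qed

lemma permute_list_adjacent_swap:
  "permute_list (adjacent_swap (length as)) (as @ x # y # bs) = as @ y # x # bs"
proof (rule nth_equalityI)
  fix i assume i: "i < length (permute_list (adjacent_swap (length as)) (as @ x # y # bs))"
  have "permute_list (adjacent_swap (length as)) (as @ x # y # bs) ! i =
      (as @ x # y # bs) ! adjacent_swap (length as) i"
    by (rule permute_list_nth) (use i in \<open>auto intro: permutes_swap_id\<close>)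
  moreover consider "i < length as" | "i = length as" | "i = Suc (length as)"
    | k where "i = length as + Suc (Suc k)"
    by (metis add_Suc_right less_iff_Suc_add linorder_neqE_nat not_less_eq)
  ultimately show "permute_list (adjacent_swap (length as)) (as @ x # y # bs) ! i = (as @ y # x # bs) ! i"
    by cases (simp_all add: Transposition.transpose_def nth_append)
qed simp

text \<open>Adjacent swaps generate the symmetric group. For them both the sign and the effect on a word are explicit,
  so no index bookkeeping for general permutations is needed later on.\<close>

lemma permutes_adjacent_induct [consumes 1, case_names id swap]:
  assumes "\<sigma> permutes {..<n::nat}" and "P id"
    and swap: "\<And>i \<sigma>. Suc i < n \<Longrightarrow> \<sigma> permutes {..<n} \<Longrightarrow> P \<sigma> \<Longrightarrow> P (\<sigma> \<circ> adjacent_swap i)"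
  shows "P \<sigma>"
proof -
  have transps: "P (\<rho> \<circ> apply_adj_transps ks)"
    if "\<rho> permutes {..<n}" "P \<rho>" "\<forall>i\<in>set ks. Suc i < n" for \<rho> ks
    using that
  proof (induction ks arbitrary: \<rho>)
    case (Cons i ks)
    have "P ((\<rho> \<circ> adjacent_swap i) \<circ> apply_adj_transps ks)"
    proof (rule Cons.IH)
      show "\<rho> \<circ> adjacent_swap i permutes {..<n}"
        using Cons.prems by (intro permutes_compose permutes_swap_id) auto
    qed (use Cons.prems in \<open>auto intro: swap simp del: comp_apply\<close>)
    then show ?case by (simp only: apply_adj_transps_Cons o_assoc Suc_eq_plus1)
  qed (simp add: apply_adj_transps_def)
  have lt: "P (\<rho> \<circ> Transposition.transpose a b)" if "a < b" "b < n" "\<rho> permutes {..<n}" "P \<rho>" for a b \<rho>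
    using transps[OF that(3,4), of "adj_transp_seq a b"] that(1,2)
    by (simp add: adj_transp_seq_correct set_adj_transp_seq)
  have finite: "finite {..<n}" by simp
  from finite assms(1) show ?thesis
  proof (induction rule: permutes_rev_induct)
    case (swap a b p)
    then show ?case
      using lt[of a b p] lt[of b a p]
      by (cases "a < b") (auto simp: transpose_commute[of b a] comp_def)
  qed (rule assms(2))
qed

section \<open>Homogeneous components of tensors\<close>

context tensor_space
begin

abbreviation TP :: "nat \<Rightarrow> ('k, 'v) tensor set" where "TP \<equiv> tensor_power smul"

definition component :: "nat \<Rightarrow> ('k, 'v) tensor \<Rightarrow> ('k, 'v) tensor" where
  "component n = lift (\<lambda>xs. if length xs = n then W xs else 0)"

lemma linear_on_component: "linear_on D (component n)"
  by (simp add: component_def linear_on_lift)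

lemma component_word: "component n (W xs) = (if length xs = n then W xs else 0)"
  unfolding component_def
proof (rule lift_word, rule multilinearI)
  show "(if length (xs @ (v + w) # ys) = n then W (xs @ (v + w) # ys) else 0) y =
      (if length (xs @ v # ys) = n then W (xs @ v # ys) else 0) y +
      (if length (xs @ w # ys) = n then W (xs @ w # ys) else 0) y" for y xs ys v w
    by (simp add: word_add fun_apply)
qed (simp add: word_scale fun_apply)

lemma subspace_TP [simp]: "fun_vs.subspace (TP n)"
  by (simp add: tensor_power_def)

lemma word_in_TP [simp]: "length xs = n \<Longrightarrow> W xs \<in> TP n"
  unfolding tensor_power_def by (rule fun_vs.span_base) auto

lemma TP_subset_T: "TP n \<subseteq> T"
  unfolding tensor_power_def tensor_algebra_def by (rule fun_vs.span_mono) auto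

lemma TP_in_T: "t \<in> TP n \<Longrightarrow> t \<in> T"
  using TP_subset_T by blast

lemma component_in_TP: "t \<in> T \<Longrightarrow> component n t \<in> TP n"
  by (rule linear_on_T_into[OF linear_on_component])
    (auto simp: component_word fun_vs.subspace_0)

lemma linear_on_TP_into:
  assumes "linear_on T F" "fun_vs.subspace U" "\<And>xs. length xs = n \<Longrightarrow> F (W xs) \<in> U" "t \<in> TP n"
  shows "F t \<in> U"
  using linear_on_subset[OF assms(1) TP_subset_T] assms(2) _ assms(4)
  unfolding tensor_power_def by (rule linear_on_span_into) (use assms(3) in auto)

lemma tensor_component_eq: "t \<in> T \<Longrightarrow> tensor_component smul n t = component n t"
  unfolding tensor_component_def
  by (rule linear_extension_eq[OF _ linear_on_component])
    (auto simp: component_word tensor_algebra_def image_def intro!: arg_cong[where f = fun_vs.span])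

lemma components_finite:
  assumes "t \<in> T"
  shows "\<exists>N. (\<forall>n\<ge>N. component n t = 0) \<and> t = (\<Sum>n<N. component n t)"
proof -
  have "eventually (\<lambda>N. component N t = 0 \<and> (\<Sum>n<N. component n t) = t) sequentially"
    using assms unfolding tensor_algebra_def
  proof (induction rule: span_combination_induct)
    case zero
    have "component n 0 = 0" for n
      using linear_on_zero[OF linear_on_component[of UNIV]] by simp
    then show ?case by simp
  next
    case (step c w t)
    then obtain xs where w: "w = W xs" by auto
    have "eventually (\<lambda>N. N > length xs) sequentially" by (rule eventually_gt_at_top)
    with step.IH show ?case
    proof eventually_elim
      case (elim N)
      have "(\<Sum>n<N. component n (W xs)) = W xs"
        using elim(2) by (simp add: component_word)
      with elim show ?case
        by (simp add: w linear_on_add[OF linear_on_component[of UNIV]] component_word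
            linear_on_scale[OF linear_on_component[of UNIV]] sum.distrib flip: fun_vs.scale_sum_right)
    qed
  qed
  then show ?thesis
    unfolding eventually_sequentially by (metis order_refl)
qed

lemma Sum_any_component:
  assumes "t \<in> T" "linear_on T F"
  shows "Sum_any (\<lambda>n. F (component n t)) = F t"
proof -
  obtain N where N: "\<forall>n\<ge>N. component n t = 0" "t = (\<Sum>n<N. component n t)"
    using components_finite[OF assms(1)] by blast
  have "n < N" if "F (component n t) \<noteq> 0" for n
    using N(1) linear_on_zero[OF assms(2)] that by (cases "n < N") simp_all
  then have "{n. F (component n t) \<noteq> 0} \<subseteq> {..<N}"
    by blast
  then have "Sum_any (\<lambda>n. F (component n t)) = (\<Sum>n<N. F (component n t))"
    by (simp add: Sum_any.expand_superset)
  also have "\<dots> = F t"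
    using linear_on_sum[OF assms(2), of "{..<N}" "\<lambda>n. component n t"] N(2) assms(1)
    by (simp add: TP_in_T[OF component_in_TP])
  finally show ?thesis .
qed

lemma multilinear_permute_list:
  assumes \<sigma>: "\<sigma> permutes {..<n}" and f: "multilinear smul f"
  shows "multilinear smul (\<lambda>vs. if length vs = n then f (permute_list \<sigma> vs) else 0)"
proof -
  have "\<exists>as bs. \<forall>v. permute_list \<sigma> (xs @ v # ys) = as @ v # bs"
    if n: "length xs + Suc (length ys) = n" for xs ys :: "'v list"
  proof (intro exI allI)
    fix v
    define k where "k = inv \<sigma> (length xs)"
    have k: "\<sigma> k = length xs" "\<And>i. i \<noteq> k \<Longrightarrow> \<sigma> i \<noteq> length xs"
      unfolding k_def by (metis permutes_inv_eq[OF \<sigma>])+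
    have "k < n"
      using permutes_in_image[OF permutes_inv[OF \<sigma>], of "length xs"] n by (simp add: k_def)
    moreover have "permute_list \<sigma> (xs @ v # ys) = (permute_list \<sigma> (xs @ 0 # ys))[k := v]"
    proof (rule nth_equalityI)
      fix i assume "i < length (permute_list \<sigma> (xs @ v # ys))"
      then have i: "i < n" using n by simp
      have nth: "permute_list \<sigma> (xs @ u # ys) ! i = (xs @ u # ys) ! \<sigma> i" for u
        by (rule permute_list_nth) (use \<sigma> n i in simp_all)
      show "permute_list \<sigma> (xs @ v # ys) ! i = (permute_list \<sigma> (xs @ 0 # ys))[k := v] ! i"
      proof (cases "i = k")
        case True
        then show ?thesis using i n k(1) nth[of v] by (simp add: nth_append)
      next
        case False
        then have "\<sigma> i < length xs \<or> (\<exists>j. \<sigma> i = length xs + Suc j)"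
          using k(2)[of i] by (metis less_iff_Suc_add add_Suc_right linorder_neqE_nat)
        then show ?thesis using False nth by (auto simp: nth_append)
      qed
    qed simp
    ultimately show "permute_list \<sigma> (xs @ v # ys) = take k (permute_list \<sigma> (xs @ 0 # ys)) @ v #
        drop (Suc k) (permute_list \<sigma> (xs @ 0 # ys))"
      using n by (simp add: upd_conv_take_nth_drop)
  qed
  then show ?thesis
    using f unfolding multilinear_iff
    by (intro conjI allI; simp; metis)
qed

end

section \<open>Symmetrization\<close>

context graded_space
begin

definition perm :: "nat \<Rightarrow> (nat \<Rightarrow> nat) \<Rightarrow> ('k, 'v) tensor \<Rightarrow> ('k, 'v) tensor" where
  "perm n \<sigma> = homogeneous_lift (\<lambda>ps vs.
     if length vs = n then fscale (koszul_sign \<sigma> ps) (W (permute_list \<sigma> vs)) else 0)"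

lemma linear_on_perm: "linear_on D (perm n \<sigma>)"
  by (simp add: perm_def linear_on_homogeneous_lift)

lemma perm_word:
  assumes "\<sigma> permutes {..<length vs}" "homogeneous V ps vs"
  shows "perm (length vs) \<sigma> (W vs) = fscale (koszul_sign \<sigma> ps) (W (permute_list \<sigma> vs))"
proof -
  have "(if length ws = n then fscale c (W (permute_list \<sigma> ws)) else 0) y =
      (if length ws = n then c * W (permute_list \<sigma> ws) y else 0)" for ws n c y
    by (simp add: fun_apply)
  then show ?thesis
    using multilinear_permute_list[OF assms(1) multilinear_times[OF multilinear_linear_on_word[OF linear_on_ident]]]
    unfolding perm_def by (subst homogeneous_lift_word[OF _ assms(2)]) auto
qed

lemma homogeneous_permute_list:
  assumes "\<sigma> permutes {..<length vs}" "homogeneous V ps vs"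
  shows "homogeneous V (permute_list \<sigma> ps) (permute_list \<sigma> vs)"
  using assms homogeneous_length[OF assms(2)] permutes_in_image[OF assms(1)]
  by (auto simp: homogeneous_def list_all2_conv_all_nth permute_list_nth)

lemma perm_in_TP:
  assumes "\<sigma> permutes {..<n}" "t \<in> TP n"
  shows "perm n \<sigma> t \<in> TP n"
proof -
  have "perm n \<sigma> t \<in> TP n"
    if "t \<in> fun_vs.span {W vs |ps vs. homogeneous V ps vs \<and> length vs = n}"
    using linear_on_perm subspace_TP _ that
  proof (rule linear_on_span_into)
    fix w assume "w \<in> {W vs |ps vs. homogeneous V ps vs \<and> length vs = n}"
    then show "perm n \<sigma> w \<in> TP n"
      using assms(1) perm_word by (auto intro!: fun_vs.subspace_scale)
  qed
  then show ?thesis using assms(2) tensor_power_homogeneous by simp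
qed

lemma perm_compose:
  assumes \<sigma>: "\<sigma> permutes {..<n}" and \<rho>: "\<rho> permutes {..<n}" and t: "t \<in> TP n"
  shows "perm n \<rho> (perm n \<sigma> t) = perm n (\<sigma> \<circ> \<rho>) t"
proof (rule tensor_power_eqI_homogeneous[OF _ _ _ t])
  show "linear_on (TP n) (\<lambda>t. perm n \<rho> (perm n \<sigma> t))"
    by (rule linear_on_compose[OF linear_on_perm _ linear_on_perm[of UNIV]]) simp
  fix ps vs assume vs: "homogeneous V ps vs" "length vs = n"
  have "perm n \<rho> (perm n \<sigma> (W vs)) =
      fscale (koszul_sign \<sigma> ps) (perm (length (permute_list \<sigma> vs)) \<rho> (W (permute_list \<sigma> vs)))"
    using perm_word[of \<sigma> vs ps] \<sigma> vs by (simp add: linear_on_scale[OF linear_on_perm[of UNIV]])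
  also have "\<dots> = fscale (koszul_sign \<sigma> ps * koszul_sign \<rho> (permute_list \<sigma> ps))
      (W (permute_list \<rho> (permute_list \<sigma> vs)))"
    using \<sigma> \<rho> vs homogeneous_permute_list[of \<sigma> vs ps]
    by (subst perm_word[of _ _ "permute_list \<sigma> ps"]) simp_all
  also have "\<dots> = perm n (\<sigma> \<circ> \<rho>) (W vs)"
    using \<sigma> \<rho> vs homogeneous_length[OF vs(1)] perm_word[of "\<sigma> \<circ> \<rho>" vs ps]
    by (simp add: permutes_compose koszul_sign_compose permute_list_compose)
  finally show "perm n \<rho> (perm n \<sigma> (W vs)) = perm n (\<sigma> \<circ> \<rho>) (W vs)" .
qed (rule linear_on_perm)

lemma perm_id:
  assumes "t \<in> TP n"
  shows "perm n id t = t"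
  using linear_on_perm linear_on_ident _ assms
  by (rule tensor_power_eqI_homogeneous) (use perm_word permutes_id in fastforce)

lemma perm_adjacent_swap_word:
  assumes "homogeneous V ps as" "x \<in> V p" "y \<in> V q" "homogeneous V qs bs"
    and n: "n = length (as @ x # y # bs)"
  shows "perm n (adjacent_swap (length as)) (W (as @ x # y # bs)) =
     fscale (parity_sign (p * q)) (W (as @ y # x # bs))"
proof -
  have len: "length ps = length as" using assms(1) by (rule homogeneous_length)
  have "homogeneous V (ps @ p # q # qs) (as @ x # y # bs)"
    using assms by (simp add: homogeneous_append)
  from perm_word[OF _ this, of "adjacent_swap (length as)"]
  show ?thesis
    using len homogeneous_length[OF assms(4)]
    by (simp add: n permutes_swap_id permute_list_adjacent_swap nth_append koszul_sign_adjacent_swap)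
qed

lemma perm_action_eq:
  assumes "\<sigma> permutes {..<n}" "t \<in> TP n"
  shows "perm_action smul V n \<sigma> t = perm n \<sigma> t"
  unfolding perm_action_def
proof (rule linear_extension_eq[OF _ linear_on_perm _ assms(2)])
  show "TP n = fun_vs.span (fst ` {(W vs, fscale (koszul_sign \<sigma> ps) (W (permute_list \<sigma> vs))) |ps vs.
        homogeneous V ps vs \<and> length vs = n})"
    unfolding tensor_power_homogeneous
    by (rule arg_cong[where f = fun_vs.span]) (auto simp: image_def)
qed (use assms perm_word in auto)

definition sym_degree :: "nat \<Rightarrow> ('k, 'v) tensor \<Rightarrow> ('k, 'v) tensor" where
  "sym_degree n t = fscale (1 / fact n) (\<Sum>\<sigma> | \<sigma> permutes {..<n}. perm n \<sigma> t)"

lemma linear_on_sym_degree: "linear_on D (sym_degree n)"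
  unfolding sym_degree_def by (intro linear_on_fscale linear_on_sum_maps linear_on_perm)

lemma symmetrize_degree_eq: "t \<in> TP n \<Longrightarrow> symmetrize_degree smul V n t = sym_degree n t"
  by (simp add: symmetrize_degree_def sym_degree_def perm_action_eq)

lemma sym_degree_in_TP: "t \<in> TP n \<Longrightarrow> sym_degree n t \<in> TP n"
  unfolding sym_degree_def
  by (intro fun_vs.subspace_scale fun_vs.subspace_sum) (auto intro: perm_in_TP)

lemma sym_degree_perm:
  assumes "\<sigma> permutes {..<n}" "t \<in> TP n"
  shows "sym_degree n (perm n \<sigma> t) = sym_degree n t"
  unfolding sym_degree_def
  using setum_permutations_compose_left[OF assms(1), of "\<lambda>\<rho>. perm n \<rho> t"] assms
  by (simp add: perm_compose)

lemma perm_sym_degree: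
  assumes "\<sigma> permutes {..<n}" "t \<in> TP n"
  shows "perm n \<sigma> (sym_degree n t) = sym_degree n t"
proof -
  have "perm n \<sigma> (\<Sum>\<rho> | \<rho> permutes {..<n}. perm n \<rho> t) = (\<Sum>\<rho> | \<rho> permutes {..<n}. perm n (\<rho> \<circ> \<sigma>) t)"
    using assms by (subst linear_on_sum[OF linear_on_perm[of UNIV]]) (auto simp: perm_compose)
  also have "\<dots> = (\<Sum>\<rho> | \<rho> permutes {..<n}. perm n \<rho> t)"
    by (rule sum_permutations_compose_right[OF assms(1), symmetric])
  finally show ?thesis
    by (simp add: sym_degree_def linear_on_scale[OF linear_on_perm[of UNIV]])
qed

definition Sym :: "('k, 'v) tensor \<Rightarrow> ('k, 'v) tensor" where
  "Sym = lift (\<lambda>vs. sym_degree (length vs) (W vs))"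

lemma linear_on_Sym: "linear_on D Sym"
  by (simp add: Sym_def linear_on_lift)

lemmas Sym_add = linear_on_add[OF linear_on_Sym[of UNIV] UNIV_I UNIV_I]
  and Sym_scale = linear_on_scale[OF linear_on_Sym[of UNIV] UNIV_I]
  and Sym_diff = linear_on_diff[OF linear_on_Sym[of UNIV] fun_vs.subspace_UNIV UNIV_I UNIV_I]

lemma Sym_word: "Sym (W vs) = sym_degree (length vs) (W vs)"
  unfolding Sym_def
  by (rule lift_word, rule multilinearI)
    (simp_all add: word_add word_scale fun_apply linear_on_add[OF linear_on_sym_degree[of UNIV]]
      linear_on_scale[OF linear_on_sym_degree[of UNIV]])

lemma Sym_eq_sym_degree:
  assumes "t \<in> TP n"
  shows "Sym t = sym_degree n t"
  using linear_on_Sym linear_on_sym_degree _ assms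
  by (rule tensor_power_eqI_homogeneous) (simp add: Sym_word)

lemma Sym_in_TP: "t \<in> TP n \<Longrightarrow> Sym t \<in> TP n"
  by (simp add: Sym_eq_sym_degree sym_degree_in_TP)

lemma Sym_in_T [simp]: "t \<in> T \<Longrightarrow> Sym t \<in> T"
  by (rule linear_on_T_into[OF linear_on_Sym]) (auto intro: TP_in_T[OF Sym_in_TP[OF word_in_TP[OF refl]]])

lemma symmetrize_eq:
  assumes "t \<in> T"
  shows "symmetrize smul V t = Sym t"
proof -
  have "symmetrize_degree smul V n (tensor_component smul n t) = Sym (component n t)" for n
    using component_in_TP[OF assms, of n]
    by (simp add: tensor_component_eq assms symmetrize_degree_eq Sym_eq_sym_degree)
  then show ?thesis
    by (simp add: symmetrize_def Sum_any_component[OF assms linear_on_Sym])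
qed

text \<open>The graded symmetric algebra is the quotient of \<open>T\<close> by the ideal of graded commutators. \<open>Sym\<close> has
  this ideal as its kernel and so identifies the quotient with the symmetric tensors. Thus a linear map
  on \<open>T\<close> descends to symmetric tensors as soon as it vanishes on commutators.\<close>

definition commutators :: "('k, 'v) tensor set" where
  "commutators = {W (as @ x # y # bs) - fscale (parity_sign (p * q)) (W (as @ y # x # bs)) |ps as p x q y qs bs.
     homogeneous V ps as \<and> x \<in> V p \<and> y \<in> V q \<and> homogeneous V qs bs}"

definition commutator_ideal :: "('k, 'v) tensor set" where
  "commutator_ideal = fun_vs.span commutators"

lemma subspace_commutator_ideal [simp]: "fun_vs.subspace commutator_ideal"
  by (simp add: commutator_ideal_def)

lemma commutator_in_ideal:
  assumes "homogeneous V ps as" "x \<in> V p" "y \<in> V q" "homogeneous V qs bs"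
  shows "W (as @ x # y # bs) - fscale (parity_sign (p * q)) (W (as @ y # x # bs)) \<in> commutator_ideal"
  unfolding commutator_ideal_def by (rule fun_vs.span_base) (use assms in \<open>unfold commutators_def, blast\<close>)

lemma commutators_subset_T: "commutators \<subseteq> T"
  by (auto simp: commutators_def)

lemma commutator_ideal_in_T: "t \<in> commutator_ideal \<Longrightarrow> t \<in> T"
  using fun_vs.span_minimal[OF commutators_subset_T subspace_T] by (auto simp: commutator_ideal_def)

lemma commutator_ideal_mult:
  assumes "s \<in> T" "t \<in> commutator_ideal"
  shows "s \<otimes> t \<in> commutator_ideal" "t \<otimes> s \<in> commutator_ideal"
proof -
  let ?H = "{W vs |ps vs. homogeneous V ps vs}"
  have bil: "bilinear_on (fun_vs.span ?H) (fun_vs.span commutators) (\<lambda>s t. s \<otimes> t)"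
    "bilinear_on (fun_vs.span ?H) (fun_vs.span commutators) (\<lambda>s t. t \<otimes> s)"
    using bilinear_on_mult commutator_ideal_in_T
    by (auto simp: bilinear_on_def T_homogeneous[symmetric] commutator_ideal_def[symmetric]
        intro: linear_on_subset)
  have words: "s \<otimes> t \<in> commutator_ideal \<and> t \<otimes> s \<in> commutator_ideal" if st: "s \<in> ?H" "t \<in> commutators" for s t
  proof -
    obtain rs vs where s: "s = W vs" "homogeneous V rs vs" using st(1) by auto
    obtain ps as p x q y qs bs where t: "homogeneous V ps as" "x \<in> V p" "y \<in> V q" "homogeneous V qs bs"
      "t = W (as @ x # y # bs) - fscale (parity_sign (p * q)) (W (as @ y # x # bs))"
      using st(2) by (auto simp: commutators_def)
    have "s \<otimes> t = W ((vs @ as) @ x # y # bs) - fscale (parity_sign (p * q)) (W ((vs @ as) @ y # x # bs))"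
      "t \<otimes> s = W (as @ x # y # bs @ vs) - fscale (parity_sign (p * q)) (W (as @ y # x # bs @ vs))"
      by (simp_all add: s t tensor_mult_word linear_on_diff[OF mult_linear_left]
        linear_on_diff[OF mult_linear_right] linear_on_scale[OF mult_linear_left] linear_on_scale[OF mult_linear_right])
    then show ?thesis
      using commutator_in_ideal[OF homogeneous_append[OF s(2) t(1)] t(2,3,4)]
        commutator_in_ideal[OF t(1,2,3) homogeneous_append[OF t(4) s(2)]] by simp
  qed
  show "s \<otimes> t \<in> commutator_ideal" "t \<otimes> s \<in> commutator_ideal"
    using bilinear_on_span_into[OF bil(1) subspace_commutator_ideal, of s t]
      bilinear_on_span_into[OF bil(2) subspace_commutator_ideal, of s t] words assms
    by (auto simp: T_homogeneous[symmetric] commutator_ideal_def[symmetric])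
qed

text \<open>\<open>Sym\<close> does not distinguish a tensor from its permutations, in particular from its adjacent swaps.\<close>

lemma Sym_commutator_ideal:
  assumes "t \<in> commutator_ideal"
  shows "Sym t = 0"
  using linear_on_Sym _ assms unfolding commutator_ideal_def
proof (rule linear_on_span_zeroI)
  fix t assume "t \<in> commutators"
  then obtain ps as p x q y qs bs where t: "homogeneous V ps as" "x \<in> V p" "y \<in> V q" "homogeneous V qs bs"
    "t = W (as @ x # y # bs) - fscale (parity_sign (p * q)) (W (as @ y # x # bs))"
    by (auto simp: commutators_def)
  let ?n = "length (as @ x # y # bs)"
  let ?s = "adjacent_swap (length as)"
  have "Sym (W (as @ x # y # bs)) = Sym (perm ?n ?s (W (as @ x # y # bs)))"
    using perm_in_TP[of ?s ?n "W (as @ x # y # bs)"]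
    by (simp add: Sym_eq_sym_degree[of _ ?n] sym_degree_perm permutes_swap_id)
  also have "\<dots> = fscale (parity_sign (p * q)) (Sym (W (as @ y # x # bs)))"
    unfolding perm_adjacent_swap_word[OF t(1-4) refl] by (simp add: Sym_scale)
  finally show "Sym t = 0"
    by (simp add: t Sym_diff Sym_scale)
qed

text \<open>An adjacent swap changes a homogeneous word by a commutator.\<close>

lemma perm_diff_in_commutator_ideal:
  assumes "\<sigma> permutes {..<n}" "t \<in> TP n"
  shows "t - perm n \<sigma> t \<in> commutator_ideal"
  using assms(1)
proof (induction rule: permutes_adjacent_induct)
  case id
  have "t - perm n id t \<in> commutator_ideal"
    using perm_id[OF assms(2)] by (simp add: fun_vs.subspace_0)
  then show ?case by (simp only: id_def)
next
  case (swap i \<sigma>)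
  define s where "s = adjacent_swap i"
  have s: "s permutes {..<n}" using swap by (simp add: s_def permutes_swap_id)
  have "u - perm n s u \<in> commutator_ideal"
    if "u \<in> fun_vs.span {W vs |ps vs. homogeneous V ps vs \<and> length vs = n}" for u
    using _ subspace_commutator_ideal _ that
  proof (rule linear_on_span_into)
    show "linear_on D (\<lambda>u. u - perm n s u)" for D
      by (rule linear_onI) (simp_all add: linear_on_add[OF linear_on_perm[of UNIV]]
          linear_on_scale[OF linear_on_perm[of UNIV]] fun_vs.scale_right_diff_distrib)
    fix u assume "u \<in> {W vs |ps vs. homogeneous V ps vs \<and> length vs = n}"
    then obtain ps vs where u: "u = W vs" "homogeneous V ps vs" "length vs = n" by auto
    have len: "length ps = n" using homogeneous_length u by auto
    have split: "vs = take i vs @ vs ! i # vs ! Suc i # drop (Suc (Suc i)) vs"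
      using swap(1) u(3) by (simp add: Cons_nth_drop_Suc)
    have parts: "homogeneous V (take i ps) (take i vs)" "vs ! i \<in> V (ps ! i)"
      "vs ! Suc i \<in> V (ps ! Suc i)" "homogeneous V (drop (Suc (Suc i)) ps) (drop (Suc (Suc i)) vs)"
      using u swap(1) by (auto simp: homogeneous_nth homogeneous_def list_all2_takeI list_all2_dropI)
    have "length (take i vs) = i" using u(3) swap(1) by simp
    then show "u - perm n s u \<in> commutator_ideal"
      using perm_adjacent_swap_word[OF parts, of n] commutator_in_ideal[OF parts] u(3)
      unfolding s_def u(1) by (subst split) (simp flip: split)
  qed
  then have "perm n \<sigma> t - perm n s (perm n \<sigma> t) \<in> commutator_ideal"
    using perm_in_TP[OF swap(2) assms(2)] tensor_power_homogeneous by simp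
  from fun_vs.subspace_add[OF subspace_commutator_ideal swap(3) this]
  have "t - perm n (\<sigma> \<circ> s) t \<in> commutator_ideal" using perm_compose[OF swap(2) s assms(2)] by simp
  then show ?case unfolding s_def by (simp only: comp_def)
qed

text \<open>The difference is an average of tensors \<open>t - perm n \<sigma> t\<close>.\<close>

lemma Sym_congruent:
  assumes "t \<in> T"
  shows "t - Sym t \<in> commutator_ideal"
  using _ subspace_commutator_ideal _ assms
proof (rule linear_on_T_into)
  show "linear_on T (\<lambda>t. t - Sym t)"
    by (rule linear_onI) (simp_all add: Sym_add Sym_scale fun_vs.scale_right_diff_distrib)
  fix xs :: "'v list"
  let ?n = "length xs"
  have "W xs - Sym (W xs) = fscale (1 / fact ?n) (\<Sum>\<sigma> | \<sigma> permutes {..<?n}. W xs - perm ?n \<sigma> (W xs))"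
    by (simp add: Sym_word sym_degree_def sum_subtractf card_permutations fun_vs.scale_right_diff_distrib
        fun_vs.sum_constant_scale del: sum_constant)
  then show "W xs - Sym (W xs) \<in> commutator_ideal"
    by (auto intro!: fun_vs.subspace_scale fun_vs.subspace_sum perm_diff_in_commutator_ideal)
qed

lemma Sym_Sym [simp]: "t \<in> T \<Longrightarrow> Sym (Sym t) = Sym t"
  using Sym_commutator_ideal[OF Sym_congruent] by (simp add: Sym_diff)

lemma sym_algebra_eq: "sym_algebra smul V = Sym ` T"
proof (rule antisym)
  have sp: "sym_power smul V n = Sym ` TP n" for n
    by (auto simp: sym_power_def symmetrize_degree_eq Sym_eq_sym_degree)
  have sub: "fun_vs.subspace (Sym ` T)"
    unfolding fun_vs.subspace_def
    by (auto simp flip: Sym_add Sym_scale)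
      (metis (no_types) T_closed(1) image_iff linear_on_Sym linear_on_zero)
  show "sym_algebra smul V \<subseteq> Sym ` T"
    unfolding sym_algebra_def using sub
    by (rule fun_vs.span_minimal[rotated]) (auto simp: sp TP_in_T)
  have "Sym t \<in> sym_algebra smul V" if "t \<in> T" for t
    using linear_on_Sym _ _ that
  proof (rule linear_on_T_into)
    fix xs :: "'v list"
    have "Sym (W xs) \<in> sym_power smul V (length xs)" by (simp add: sp)
    then show "Sym (W xs) \<in> sym_algebra smul V"
      unfolding sym_algebra_def by (intro fun_vs.span_base) blast
  qed (simp add: sym_algebra_def)
  then show "Sym ` T \<subseteq> sym_algebra smul V" by blast
qed

lemma sym_algebra_iff: "t \<in> sym_algebra smul V \<longleftrightarrow> t \<in> T \<and> Sym t = t"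
  by (auto simp: sym_algebra_eq image_iff) (metis Sym_Sym)

text \<open>Adjacent swaps generate, so \<open>t\<close> is fixed by all permutations and hence by their average.\<close>

lemma Sym_invariant:
  assumes t: "t \<in> TP n" and inv: "\<And>i. Suc i < n \<Longrightarrow> perm n (adjacent_swap i) t = t"
  shows "Sym t = t"
proof -
  have "perm n \<sigma> t = t" if "\<sigma> permutes {..<n}" for \<sigma>
    using that
  proof (induction rule: permutes_adjacent_induct)
    case (swap i \<sigma>)
    then have "perm n (\<sigma> \<circ> adjacent_swap i) t = t"
      using perm_compose[of \<sigma> n "adjacent_swap i" t] t inv by (simp add: permutes_swap_id del: comp_apply)
    then show ?case by (simp only: comp_def)
  qed (use perm_id[OF t] in \<open>simp only: id_def\<close>)
  then have "sym_degree n t = fscale (1 / fact n) (\<Sum>\<sigma> | \<sigma> permutes {..<n}. t)"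
    by (simp add: sym_degree_def)
  also have "\<dots> = t"
    by (simp add: card_permutations fun_vs.sum_constant_scale del: sum_constant)
  finally show ?thesis using Sym_eq_sym_degree[OF t] by simp
qed

end

section \<open>Translations preserve symmetric tensors\<close>

lemma drop_at_append [simp]: "drop_at (length xs) (xs @ v # ys) = xs @ ys"
  by (simp add: drop_at_def)

lemma list_split_at: "m < length vs \<Longrightarrow> \<exists>xs v ys. vs = xs @ v # ys \<and> length xs = m"
  by (metis id_take_nth_drop length_take min_absorb2 less_imp_le)

context tensor_space
begin

lemma multilinear_contraction:
  assumes f: "linear_form f" and g: "multilinear smul g"
  shows "multilinear smul (\<lambda>vs. if m < length vs then f (vs ! m) * g (drop_at m vs) else 0)"
proof -
  let ?F = "\<lambda>vs. if m < length vs then f (vs ! m) * g (drop_at m vs) else 0"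
  have times: "linear_form (\<lambda>v. c * h v)" if "linear_form h" for c h
    using that by (simp add: Vector_Spaces.linear_iff distrib_left)
  have g': "linear_form (\<lambda>v. g (as @ v # bs))" for as bs
    using g by (simp add: multilinear_def)
  have "linear_form (\<lambda>v. ?F (xs @ v # ys))" for xs ys
  proof -
    consider "m < length xs" | "m = length xs" | k where "m = length xs + Suc k"
      by (metis add_Suc_right less_iff_Suc_add linorder_neqE_nat)
    then show ?thesis
    proof cases
      case 1
      then have "(\<lambda>v. ?F (xs @ v # ys)) = (\<lambda>v. f (xs ! m) * g (drop_at m xs @ v # ys))"
        by (simp add: fun_eq_iff nth_append drop_at_def)
      then show ?thesis using times[OF g'] by simp
    next
      case 2
      then have "(\<lambda>v. ?F (xs @ v # ys)) = (\<lambda>v. g (xs @ ys) * f v)"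
        by (simp add: fun_eq_iff mult.commute)
      then show ?thesis using times[OF f] by simp
    next
      case 3
      then have "(\<lambda>v. ?F (xs @ v # ys)) =
          (\<lambda>v. (if k < length ys then f (ys ! k) else 0) * g (xs @ v # drop_at k ys))"
        by (simp add: fun_eq_iff nth_append drop_at_def)
      then show ?thesis using times[OF g'] by simp
    qed
  qed
  then show ?thesis by (simp add: multilinear_def)
qed

definition contract :: "('v \<Rightarrow> 'k) \<Rightarrow> nat \<Rightarrow> ('k, 'v) tensor \<Rightarrow> ('k, 'v) tensor" where
  "contract \<phi> m = lift (\<lambda>vs. if m < length vs then fscale (\<phi> (vs ! m)) (W (drop_at m vs)) else 0)"

text \<open>Interpolates between the translation, at \<open>m = 0\<close>, and the identity, one letter at a time.\<close>

definition translate_from :: "('v \<Rightarrow> 'k) \<Rightarrow> nat \<Rightarrow> ('k, 'v) tensor \<Rightarrow> ('k, 'v) tensor" where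
  "translate_from \<phi> m = lift (\<lambda>vs. W (take m vs) \<otimes> translate_word \<phi> (drop m vs))"

lemma linear_on_contract: "linear_on D (contract \<phi> m)"
  and linear_on_translate_from: "linear_on D (translate_from \<phi> m)"
  by (simp_all add: contract_def translate_from_def linear_on_lift)

lemma contract_word:
  assumes "linear_form \<phi>"
  shows "contract \<phi> m (W vs) = (if m < length vs then fscale (\<phi> (vs ! m)) (W (drop_at m vs)) else 0)"
  unfolding contract_def
proof (rule lift_word)
  fix f
  have "(if m < length vs then fscale (\<phi> (vs ! m)) (W (drop_at m vs)) else 0) f =
      (if m < length vs then \<phi> (vs ! m) * W (drop_at m vs) f else 0)" for vs
    by (simp add: fun_apply)
  then show "multilinear smul (\<lambda>vs. (if m < length vs then fscale (\<phi> (vs ! m)) (W (drop_at m vs)) else 0) f)"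
    using multilinear_contraction[OF assms multilinear_linear_on_word[OF linear_on_ident]] by simp
qed

lemma contract_word_append:
  "linear_form \<phi> \<Longrightarrow> contract \<phi> (length xs) (W (xs @ v # ys)) = fscale (\<phi> v) (W (xs @ ys))"
  by (simp add: contract_word)

lemma contract_in_TP: "linear_form \<phi> \<Longrightarrow> t \<in> TP n \<Longrightarrow> contract \<phi> m t \<in> TP (n - 1)"
  by (rule linear_on_TP_into[OF linear_on_contract])
    (auto simp: contract_word fun_vs.subspace_0 drop_at_def intro!: fun_vs.subspace_scale word_in_TP)

lemma contract_eq_0: "linear_form \<phi> \<Longrightarrow> t \<in> TP n \<Longrightarrow> n \<le> m \<Longrightarrow> contract \<phi> m t = 0"
  using linear_on_TP_into[OF linear_on_contract, of "{0}" n \<phi> m t]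
  by (simp add: contract_word fun_vs.subspace_single_0)

lemma translate_from_word:
  assumes "linear_form \<phi>"
  shows "translate_from \<phi> m (W vs) = W (take m vs) \<otimes> translate_word \<phi> (drop m vs)"
  unfolding translate_from_def
proof (rule lift_word, rule multilinearI)
  let ?F = "\<lambda>vs. W (take m vs) \<otimes> translate_word \<phi> (drop m vs)"
  show "?F (xs @ (v + w) # ys) f = ?F (xs @ v # ys) f + ?F (xs @ w # ys) f" for f xs v w ys
  proof (cases "length xs < m")
    case True
    then obtain k where "m = length xs + Suc k" by (metis add_Suc_right less_iff_Suc_add)
    then show ?thesis
      by (simp add: word_add linear_on_add[OF mult_linear_left] fun_apply)
  qed (simp add: translate_word_add[OF assms] linear_on_add[OF mult_linear_right] fun_apply)
  show "?F (xs @ smul c v # ys) f = c * ?F (xs @ v # ys) f" for f xs c v ys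
  proof (cases "length xs < m")
    case True
    then obtain k where "m = length xs + Suc k" by (metis add_Suc_right less_iff_Suc_add)
    then show ?thesis
      by (simp add: word_scale linear_on_scale[OF mult_linear_left] fun_apply)
  qed (simp add: translate_word_scale[OF assms] linear_on_scale[OF mult_linear_right] fun_apply)
qed

lemma translate_from_0:
  assumes "linear_form \<phi>" "t \<in> T"
  shows "translate_from \<phi> 0 t = translate \<phi> t"
  using linear_on_translate_from linear_on_translate _ assms(2)
  by (rule T_eqI) (simp add: translate_from_word assms)

lemma translate_from_eq_self:
  assumes "linear_form \<phi>" "t \<in> TP n" "n \<le> m"
  shows "translate_from \<phi> m t = t"
proof -
  have "translate_from \<phi> m t - t \<in> {0}"
  proof (rule linear_on_TP_into[where F = "\<lambda>t. translate_from \<phi> m t - t" and n = n])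
    show "linear_on T (\<lambda>t. translate_from \<phi> m t - t)"
      by (rule linear_onI) (simp_all add: linear_on_add[OF linear_on_translate_from[of UNIV]]
          linear_on_scale[OF linear_on_translate_from[of UNIV]] fun_vs.scale_right_diff_distrib)
  qed (use assms in \<open>simp_all add: translate_from_word fun_vs.subspace_single_0\<close>)
  then show ?thesis by simp
qed

text \<open>The letter at position \<open>m\<close> is either kept or contracted with \<open>\<phi>\<close>.\<close>

lemma translate_from_step:
  assumes \<phi>: "linear_form \<phi>" and t: "t \<in> T"
  shows "translate_from \<phi> m t = translate_from \<phi> (Suc m) t + translate_from \<phi> m (contract \<phi> m t)"
proof (rule T_eqI[where t = t])
  show "linear_on T (\<lambda>t. translate_from \<phi> (Suc m) t + translate_from \<phi> m (contract \<phi> m t))"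
    by (intro linear_on_plus linear_on_translate_from
        linear_on_compose[OF linear_on_contract _ linear_on_translate_from[of UNIV]]) simp
  fix vs
  show "translate_from \<phi> m (W vs) =
      translate_from \<phi> (Suc m) (W vs) + translate_from \<phi> m (contract \<phi> m (W vs))"
  proof (cases "m < length vs")
    case True
    then obtain xs v ys where vs: "vs = xs @ v # ys" "length xs = m"
      using list_split_at by blast
    have "W (xs @ [v]) = W xs \<otimes> W [v]" by (simp add: tensor_mult_word)
    then show ?thesis
      using contract_word_append[OF \<phi>, of xs v ys] vs(2)
      by (simp add: vs(1) translate_from_word[OF \<phi>] mult_assoc linear_on_add[OF mult_linear_right]
          linear_on_scale[OF mult_linear_right] linear_on_scale[OF linear_on_translate_from[of UNIV]])
  next
    case False
    then show ?thesis
      using \<phi> linear_on_zero[OF linear_on_translate_from[of UNIV \<phi> m]]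
      by (simp add: translate_from_word contract_word)
  qed
qed (use assms linear_on_translate_from in auto)

end

context graded_space
begin

abbreviation even_form :: "('v \<Rightarrow> 'k) \<Rightarrow> bool" where
  "even_form \<phi> \<equiv> linear_form \<phi> \<and> (\<forall>v\<in>V 1. \<phi> v = 0)"

text \<open>\<open>(x + \<phi>(x)) (y + \<phi>(y))\<close> and the product in the other order have the same terms of lower degree; if
  these enter with different signs, then \<open>x\<close> and \<open>y\<close> are odd and \<open>\<phi>\<close> kills both. So a translated
  commutator is again a commutator, multiplied by translated words.\<close>

lemma translate_commutator_ideal:
  assumes \<phi>: "even_form \<phi>" and t: "t \<in> commutator_ideal"
  shows "translate \<phi> t \<in> commutator_ideal"
  using linear_on_translate subspace_commutator_ideal _ t unfolding commutator_ideal_def[of]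
proof (rule linear_on_span_into)
  fix t assume "t \<in> commutators"
  then obtain ps as p x q y qs bs where t: "homogeneous V ps as" "x \<in> V p" "y \<in> V q" "homogeneous V qs bs"
    "t = W (as @ x # y # bs) - fscale (parity_sign (p * q)) (W (as @ y # x # bs))"
    by (auto simp: commutators_def)
  let ?u = "W [x, y] - fscale (parity_sign (p * q)) (W [y, x])"
  note linear = linear_on_add[OF mult_linear_left] linear_on_add[OF mult_linear_right]
    linear_on_scale[OF mult_linear_left] linear_on_scale[OF mult_linear_right]
    linear_on_diff[OF mult_linear_left] linear_on_diff[OF mult_linear_right]
  have pair: "translate_word \<phi> [v, w] = W [v, w] + fscale (\<phi> w) (W [v]) + fscale (\<phi> v) (W [w]) +
      fscale (\<phi> v * \<phi> w) (W [])" for v w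
    by (simp add: linear tensor_mult_word fun_vs.scale_right_distrib add_ac)
  have u: "translate_word \<phi> [x, y] - fscale (parity_sign (p * q)) (translate_word \<phi> [y, x]) = ?u"
  proof (cases "p = 1 \<and> q = 1")
    case True
    then have "\<phi> x = 0" "\<phi> y = 0" using t \<phi> by auto
    then show ?thesis unfolding pair by simp
  next
    case False
    then have "parity_sign (p * q) = (1 :: 'k)" by auto
    then show ?thesis unfolding pair by (simp add: mult.commute)
  qed
  have split: "translate_word \<phi> (as @ v # w # bs) =
      translate_word \<phi> as \<otimes> (translate_word \<phi> [v, w] \<otimes> translate_word \<phi> bs)" for v w
    using translate_word_append[of \<phi> as "[v, w] @ bs"] translate_word_append[of \<phi> "[v, w]" bs] by simp
  have "translate \<phi> t = translate_word \<phi> as \<otimes> (?u \<otimes> translate_word \<phi> bs)"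
    using \<phi> unfolding t(5) u[symmetric]
    by (simp only: linear_on_diff[OF linear_on_translate[of UNIV]] fun_vs.subspace_UNIV UNIV_I
        linear_on_scale[OF linear_on_translate[of UNIV]] translate_W split linear
        translate_word_in_T T_closed mult_in_T subspace_T)
  moreover have "?u \<in> commutator_ideal"
    using commutator_in_ideal[of "[]" "[]" x p y q "[]" "[]"] t by simp
  ultimately show "translate \<phi> t \<in> fun_vs.span commutators"
    by (simp add: commutator_ideal_mult flip: commutator_ideal_def)
qed

lemma perm_contract:
  assumes \<phi>: "linear_form \<phi>" and t: "t \<in> TP (Suc n)" and i: "m \<le> i" "Suc i < n"
  shows "perm n (adjacent_swap i) (contract \<phi> m t) = contract \<phi> m (perm (Suc n) (adjacent_swap (Suc i)) t)"
  using _ _ _ t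
proof (rule tensor_power_eqI_homogeneous)
  show "linear_on (TP (Suc n)) (\<lambda>t. perm n (adjacent_swap i) (contract \<phi> m t))"
    "linear_on (TP (Suc n)) (\<lambda>t. contract \<phi> m (perm (Suc n) (adjacent_swap (Suc i)) t))"
    by (rule linear_on_compose[OF linear_on_contract _ linear_on_perm[of UNIV]]
        linear_on_compose[OF linear_on_perm _ linear_on_contract[of UNIV]]; simp)+
  fix rs vs assume vs: "homogeneous V rs vs" "length vs = Suc n"
  obtain xs v ws where 1: "vs = xs @ v # ws" "length xs = m"
    using list_split_at[of m vs] vs(2) i by auto
  have "i - m < length ws" using vs(2) i 1 by auto
  then obtain zs x us where 2: "ws = zs @ x # us" "length zs = i - m"
    using list_split_at by blast
  obtain y bs where 3: "us = y # bs"
    using vs(2) i 1 2 by (cases us) auto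
  obtain ps r ps' p q qs where hom: "homogeneous V ps xs" "v \<in> V r" "homogeneous V ps' zs"
    "x \<in> V p" "y \<in> V q" "homogeneous V qs bs"
    using vs(1) unfolding homogeneous_def 1 2 3
    by (auto simp: list_all2_append2 list_all2_Cons2)
  have len: "length (xs @ zs) = i" "length (xs @ v # zs) = Suc i"
    "length ((xs @ zs) @ x # y # bs) = n" "length ((xs @ v # zs) @ x # y # bs) = Suc n"
    using 1 2 3 vs i by auto
  have "perm (Suc n) (adjacent_swap (Suc i)) (W vs) =
      fscale (parity_sign (p * q)) (W ((xs @ v # zs) @ y # x # bs))"
    using perm_adjacent_swap_word[of "ps @ r # ps'" "xs @ v # zs" x p y q qs bs "Suc n"] hom len
    by (simp add: homogeneous_append 1 2 3)
  moreover have "perm n (adjacent_swap i) (W (xs @ zs @ x # y # bs)) =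
      fscale (parity_sign (p * q)) (W (xs @ zs @ y # x # bs))"
    using perm_adjacent_swap_word[of "ps @ ps'" "xs @ zs" x p y q qs bs n] hom len
    by (simp add: homogeneous_append)
  ultimately show "perm n (adjacent_swap i) (contract \<phi> m (W vs)) =
      contract \<phi> m (perm (Suc n) (adjacent_swap (Suc i)) (W vs))"
    using contract_word_append[OF \<phi>, of xs] 1(2)
    by (simp add: 1(1) 2(1) 3 linear_on_scale[OF linear_on_contract[of UNIV]]
        linear_on_scale[OF linear_on_perm[of UNIV]] mult.commute)
qed

text \<open>Moving \<open>x\<close> past its neighbour costs a sign only if \<open>x\<close> is odd, in which case \<open>\<phi>(x) = 0\<close>.\<close>

lemma contract_perm:
  assumes \<phi>: "even_form \<phi>" and t: "t \<in> TP n" and m: "Suc m < n"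
  shows "contract \<phi> (Suc m) (perm n (adjacent_swap m) t) = contract \<phi> m t"
  using _ _ _ t
proof (rule tensor_power_eqI_homogeneous)
  show "linear_on (TP n) (\<lambda>t. contract \<phi> (Suc m) (perm n (adjacent_swap m) t))"
    by (rule linear_on_compose[OF linear_on_perm _ linear_on_contract[of UNIV]]) simp
  fix rs vs assume vs: "homogeneous V rs vs" "length vs = n"
  obtain as x us where 1: "vs = as @ x # us" "length as = m"
    using list_split_at[of m vs] vs(2) m by auto
  obtain y bs where 2: "us = y # bs"
    using vs(2) m 1 by (cases us) auto
  obtain ps p q qs where hom: "homogeneous V ps as" "x \<in> V p" "y \<in> V q" "homogeneous V qs bs"
    using vs(1) unfolding homogeneous_def 1 2
    by (auto simp: list_all2_append2 list_all2_Cons2)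
  have "parity_sign (p * q) * \<phi> x = \<phi> x"
    using \<phi> hom by (cases p) auto
  then show "contract \<phi> (Suc m) (perm n (adjacent_swap m) (W vs)) = contract \<phi> m (W vs)"
    using perm_adjacent_swap_word[OF hom, of n] 1 2 vs(2) \<phi>
      contract_word_append[of \<phi> as x "y # bs"] contract_word_append[of \<phi> "as @ [y]" x bs]
    by (simp add: linear_on_scale[OF linear_on_contract[of UNIV]])
qed (rule linear_on_contract)

text \<open>Symmetry in the letters from position \<open>m\<close> on. The induction in \<open>translate_from_in_span\<close> raises \<open>m\<close>, as it
  treats one letter after the other.\<close>

definition symmetric_from :: "nat \<Rightarrow> nat \<Rightarrow> ('k, 'v) tensor \<Rightarrow> bool" where
  "symmetric_from m n t \<longleftrightarrow> t \<in> TP n \<and> (\<forall>i\<ge>m. Suc i < n \<longrightarrow> perm n (adjacent_swap i) t = t)"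

lemma symmetric_from_contract:
  assumes \<phi>: "linear_form \<phi>" and t: "symmetric_from m n t"
  shows "symmetric_from m (n - 1) (contract \<phi> m t)"
proof (cases n)
  case (Suc k)
  have "perm k (adjacent_swap i) (contract \<phi> m t) = contract \<phi> m t" if "m \<le> i" "Suc i < k" for i
    using perm_contract[OF \<phi> _ that, of t] t that by (simp add: symmetric_from_def Suc)
  then show ?thesis
    using t contract_in_TP[OF \<phi>, of t n m] by (simp add: symmetric_from_def Suc)
qed (use t contract_in_TP[OF \<phi>, of t n m] in \<open>simp add: symmetric_from_def\<close>)

text \<open>For such tensors it does not matter whether position \<open>m\<close> or \<open>m + 1\<close> is contracted, unless the latter
  does not exist.\<close>

lemma contract_power_Suc:
  assumes \<phi>: "even_form \<phi>" and t: "symmetric_from m n t"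
  shows "(contract \<phi> (Suc m) ^^ k) t = (contract \<phi> m ^^ k) t \<or> (contract \<phi> (Suc m) ^^ k) t = 0"
  using t
proof (induction k arbitrary: n t)
  case (Suc k)
  show ?case
  proof (cases "Suc m < n")
    case True
    then have "contract \<phi> (Suc m) t = contract \<phi> m t"
      using contract_perm[OF \<phi> _ True, of t] Suc.prems by (simp add: symmetric_from_def)
    then show ?thesis
      using Suc.IH[OF symmetric_from_contract[OF _ Suc.prems]] \<phi>
      by (simp only: funpow_Suc_right comp_apply)
  next
    case False
    have "(contract \<phi> (Suc m) ^^ k) 0 = 0"
      by (induction k) (simp_all add: linear_on_zero[OF linear_on_contract[of UNIV]])
    then show ?thesis
      using contract_eq_0[of \<phi> t n "Suc m"] \<phi> Suc.prems False
      by (simp add: symmetric_from_def funpow_Suc_right del: funpow.simps)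
  qed
qed simp

text \<open>Applying \<open>translate_from_step\<close> repeatedly expresses the translation by contractions at positions \<open>\<ge> m\<close>; by
  symmetry each of them can be moved to position \<open>m\<close>, where contraction preserves the symmetry in the
  letters that follow.\<close>

lemma translate_from_in_span:
  assumes \<phi>: "even_form \<phi>" and "symmetric_from m n t" and "n \<le> m + r"
  shows "translate_from \<phi> m t \<in> fun_vs.span {(contract \<phi> m ^^ k) t |k. True}"
  using assms(2,3)
proof (induction r arbitrary: m n t)
  case 0
  have "(contract \<phi> m ^^ 0) t \<in> fun_vs.span {(contract \<phi> m ^^ k) t |k. True}"
    by (rule fun_vs.span_base) blast
  then show ?case
    using translate_from_eq_self[of \<phi> t n m] 0 \<phi> by (simp add: symmetric_from_def)
next
  case (Suc r)
  let ?U = "fun_vs.span {(contract \<phi> m ^^ k) t |k. True}"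
  have "symmetric_from (Suc m) n t"
    using Suc.prems by (simp add: symmetric_from_def)
  then have "translate_from \<phi> (Suc m) t \<in> fun_vs.span {(contract \<phi> (Suc m) ^^ k) t |k. True}"
    using Suc by simp
  also have "\<dots> \<subseteq> ?U"
    using contract_power_Suc[OF \<phi> Suc.prems(1)]
    by (intro fun_vs.span_minimal) (force intro: fun_vs.span_base fun_vs.span_zero)+
  finally have 1: "translate_from \<phi> (Suc m) t \<in> ?U" .
  have "translate_from \<phi> m (contract \<phi> m t) \<in> fun_vs.span {(contract \<phi> m ^^ k) (contract \<phi> m t) |k. True}"
    using Suc.IH[OF symmetric_from_contract[OF _ Suc.prems(1)]] Suc.prems(2) \<phi> by simp
  also have "\<dots> \<subseteq> ?U"
  proof (rule fun_vs.span_mono, clarify)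
    fix k show "\<exists>l. (contract \<phi> m ^^ k) (contract \<phi> m t) = (contract \<phi> m ^^ l) t \<and> True"
      by (rule exI[of _ "Suc k"]) (simp only: funpow_Suc_right comp_apply simp_thms)
  qed
  finally have 2: "translate_from \<phi> m (contract \<phi> m t) \<in> ?U" .
  have "t \<in> T" using Suc.prems(1) TP_in_T by (auto simp: symmetric_from_def)
  from translate_from_step[OF _ this, of \<phi> m] show ?case
    using fun_vs.span_add[OF 1 2] \<phi> by simp
qed

lemma Sym_translate_Sym:
  assumes \<phi>: "even_form \<phi>" and t: "t \<in> T"
  shows "Sym (translate \<phi> (Sym t)) = translate \<phi> (Sym t)"
  using _ _ _ t
proof (rule T_eqI)
  show lin: "linear_on T (\<lambda>t. translate \<phi> (Sym t))"
    by (rule linear_on_compose[OF linear_on_Sym _ linear_on_translate[of UNIV]]) simp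
  show "linear_on T (\<lambda>t. Sym (translate \<phi> (Sym t)))"
    by (rule linear_on_compose[OF lin _ linear_on_Sym[of UNIV]]) simp
  fix vs
  let ?t = "Sym (W vs)" and ?n = "length vs"
  have TP: "?t \<in> TP ?n" by (simp add: Sym_in_TP)
  have sym: "symmetric_from 0 ?n ?t"
    unfolding symmetric_from_def
    using TP by (auto simp: Sym_word perm_sym_degree permutes_swap_id)
  have "\<exists>n. symmetric_from 0 n ((contract \<phi> 0 ^^ k) ?t)" for k
  proof (induction k)
    case (Suc k)
    then obtain n where "symmetric_from 0 n ((contract \<phi> 0 ^^ k) ?t)" by blast
    from symmetric_from_contract[OF _ this] show ?case using \<phi> by auto
  qed (use sym in auto)
  then have "Sym ((contract \<phi> 0 ^^ k) ?t) = (contract \<phi> 0 ^^ k) ?t" for k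
    unfolding symmetric_from_def by (metis Sym_invariant le0)
  then have "u \<in> {u. Sym u = u}" if "u \<in> fun_vs.span {(contract \<phi> 0 ^^ k) ?t |k. True}" for u
    using that
    by (rule_tac set_mp[OF fun_vs.span_minimal])
      (auto simp: fun_vs.subspace_def Sym_add Sym_scale linear_on_zero[OF linear_on_Sym[of UNIV]])
  then show "Sym (translate \<phi> ?t) = translate \<phi> ?t"
    using translate_from_in_span[OF \<phi> sym, of ?n] translate_from_0[of \<phi> ?t] \<phi> by simp
qed

text \<open>\<open>translate \<phi>\<close> preserves both the kernel and the image of the projection \<open>Sym\<close>.\<close>

lemma Sym_translate:
  assumes \<phi>: "even_form \<phi>" and t: "t \<in> T"
  shows "Sym (translate \<phi> t) = translate \<phi> (Sym t)"
proof -
  have "Sym (translate \<phi> (t - Sym t)) = 0"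
    by (intro Sym_commutator_ideal translate_commutator_ideal Sym_congruent assms)
  then show ?thesis
    using Sym_translate_Sym[OF assms]
    by (simp add: linear_on_diff[OF linear_on_translate[of UNIV]] Sym_diff)
qed

lemma translate_bij_sym_algebra:
  assumes \<phi>: "even_form \<phi>"
  shows "bij_betw (translate \<phi>) (sym_algebra smul V) (sym_algebra smul V)"
proof (rule bij_betw_byWitness[where f' = "translate (\<lambda>v. - \<phi> v)"])
  have \<psi>: "even_form (\<lambda>v. - \<phi> v)" using \<phi> by (simp add: linear_form_uminus)
  show "\<forall>t\<in>sym_algebra smul V. translate (\<lambda>v. - \<phi> v) (translate \<phi> t) = t"
    "\<forall>t\<in>sym_algebra smul V. translate \<phi> (translate (\<lambda>v. - \<phi> v) t) = t"
    using \<phi> \<psi> translate_uminus[of \<phi>] translate_uminus[of "\<lambda>v. - \<phi> v"] by (auto simp: sym_algebra_iff)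
  show "translate \<phi> ` sym_algebra smul V \<subseteq> sym_algebra smul V"
    "translate (\<lambda>v. - \<phi> v) ` sym_algebra smul V \<subseteq> sym_algebra smul V"
    using \<phi> \<psi> Sym_translate[OF \<phi>] Sym_translate[OF \<psi>] by (auto simp: sym_algebra_iff)
qed

end

section \<open>Signed contractions\<close>

lemma drop_at_Cons [simp]: "drop_at 0 (v # vs) = vs" "drop_at (Suc k) (v # vs) = v # drop_at k vs"
  by (simp_all add: drop_at_def)

lemma sum_nth_shift:
  fixes ps :: "'a::comm_monoid_add list"
  shows "(\<Sum>i\<in>{0<..<Suc (length ps)}. ps ! (i - Suc 0)) = sum_list ps"
    and "(\<Sum>i\<in>{Suc k<..<Suc n}. ps ! (i - Suc 0)) = (\<Sum>i\<in>{k<..<n}. ps ! i)"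
proof -
  have "(\<Sum>i\<in>{0<..<Suc (length ps)}. ps ! (i - Suc 0)) = (\<Sum>i\<in>{0..<length ps}. ps ! i)"
    by (rule sum.reindex_bij_witness[of _ Suc "\<lambda>i. i - 1"]) auto
  then show "(\<Sum>i\<in>{0<..<Suc (length ps)}. ps ! (i - Suc 0)) = sum_list ps"
    by (simp add: sum_list_sum_nth)
  show "(\<Sum>i\<in>{Suc k<..<Suc n}. ps ! (i - Suc 0)) = (\<Sum>i\<in>{k<..<n}. ps ! i)"
    by (rule sum.reindex_bij_witness[of _ Suc "\<lambda>i. i - 1"]) auto
qed

context tensor_space
begin

lemma multilinear_by_length:
  assumes "\<And>n. multilinear smul (G n)" "\<And>vs. F vs = G (length vs) vs"
  shows "multilinear smul F"
  by (rule multilinearI) (simp_all add: assms(2) multilinear_add[OF assms(1)] multilinear_scale[OF assms(1)])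

lemma multilinear_sum_contractions:
  assumes "linear_form f" "multilinear smul g"
  shows "multilinear smul (\<lambda>vs. \<Sum>k<length vs. c (length vs) k * (f (vs ! k) * g (drop_at k vs)))"
proof (rule multilinear_by_length[where G = "\<lambda>n vs. \<Sum>k<n. c n k *
    (if k < length vs then f (vs ! k) * g (drop_at k vs) else 0)"])
  show "multilinear smul (\<lambda>vs. \<Sum>k<n. c n k * (if k < length vs then f (vs ! k) * g (drop_at k vs) else 0))" for n
    by (intro multilinear_sum multilinear_times multilinear_contraction assms)
qed simp

end

context graded_space
begin

text \<open>The sum of all contractions of one letter with \<open>f\<close>. The sign treats \<open>f\<close> as an object that moves to its
  letter from the right with parity \<open>q\<close> and from the left with parity \<open>r\<close>. The operator \<open>P\<^sub>\<Lambda>\<close> uses \<open>r = 0\<close> in its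
  first factor and \<open>q = 0\<close> in its second one.\<close>

definition contraction :: "('v \<Rightarrow> 'k) \<Rightarrow> bit \<Rightarrow> bit \<Rightarrow> ('k, 'v) tensor \<Rightarrow> ('k, 'v) tensor" where
  "contraction f q r = homogeneous_lift (\<lambda>ps vs. \<Sum>k<length vs.
     fscale (parity_sign (q * (\<Sum>i\<in>{k<..<length vs}. ps ! i) + r * (\<Sum>j<k. ps ! j)) * f (vs ! k))
       (W (drop_at k vs)))"

lemma linear_on_contraction: "linear_on D (contraction f q r)"
  by (simp add: contraction_def linear_on_homogeneous_lift)

lemmas contraction_add = linear_on_add[OF linear_on_contraction[of UNIV] UNIV_I UNIV_I]
  and contraction_scale = linear_on_scale[OF linear_on_contraction[of UNIV] UNIV_I]
  and contraction_diff = linear_on_diff[OF linear_on_contraction[of UNIV] fun_vs.subspace_UNIV UNIV_I UNIV_I]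

lemma contraction_word:
  assumes "linear_form f" "homogeneous V ps vs"
  shows "contraction f q r (W vs) = (\<Sum>k<length vs.
     fscale (parity_sign (q * (\<Sum>i\<in>{k<..<length vs}. ps ! i) + r * (\<Sum>j<k. ps ! j)) * f (vs ! k))
       (W (drop_at k vs)))"
  unfolding contraction_def
proof (rule homogeneous_lift_word[OF _ assms(2)])
  fix ps :: "bit list" and y
  show "multilinear smul (\<lambda>vs. (\<Sum>k<length vs.
     fscale (parity_sign (q * (\<Sum>i\<in>{k<..<length vs}. ps ! i) + r * (\<Sum>j<k. ps ! j)) * f (vs ! k))
       (W (drop_at k vs))) y)"
    using multilinear_sum_contractions[OF assms(1) multilinear_linear_on_word[OF linear_on_ident],
        of "\<lambda>n k. parity_sign (q * (\<Sum>i\<in>{k<..<n}. ps ! i) + r * (\<Sum>j<k. ps ! j))" y]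
    by (simp add: sum_fun_apply fun_apply mult.assoc)
qed

lemma contraction_word_Nil: "linear_form f \<Longrightarrow> contraction f q r (W []) = 0"
  by (simp add: contraction_word[of f "[]"])

lemma contraction_word_Cons:
  assumes f: "linear_form f" and v: "v \<in> V p" and vs: "homogeneous V ps vs"
  shows "contraction f q r (W (v # vs)) = fscale (parity_sign (q * sum_list ps) * f v) (W vs) +
    fscale (parity_sign (r * p)) (W [v] \<otimes> contraction f q r (W vs))"
proof -
  define c where "c k = parity_sign (q * (\<Sum>i\<in>{k<..<length vs}. ps ! i) + r * (\<Sum>j<k. ps ! j)) * f (vs ! k)" for k
  have hom: "homogeneous V (p # ps) (v # vs)" using v vs by simp
  have len: "length ps = length vs" using vs by (rule homogeneous_length)
  have "contraction f q r (W (v # vs)) = fscale (parity_sign (q * sum_list ps) * f v) (W vs) +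
      (\<Sum>k<length vs. fscale (parity_sign (r * p) * c k) (W [v] \<otimes> W (drop_at k vs)))"
    unfolding contraction_word[OF f hom] c_def
    using sum_nth_shift(1)[of ps]
    by (simp add: sum.lessThan_Suc_shift len sum_nth_shift(2) distrib_left tensor_mult_word mult_ac
        del: sum.lessThan_Suc)
  also have "(\<Sum>k<length vs. fscale (parity_sign (r * p) * c k) (W [v] \<otimes> W (drop_at k vs))) =
      fscale (parity_sign (r * p)) (W [v] \<otimes> contraction f q r (W vs))"
    unfolding contraction_word[OF f vs] c_def[symmetric]
    by (subst linear_on_sum[OF mult_linear_right])
      (simp_all add: linear_on_scale[OF mult_linear_right] fun_vs.scale_sum_right)
  finally show ?thesis .
qed

lemma contraction_in_T [simp]: "linear_form f \<Longrightarrow> t \<in> T \<Longrightarrow> contraction f q r t \<in> T"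
  by (rule linear_on_T_into_homogeneous[OF linear_on_contraction]) (auto simp: contraction_word intro!: T_sum)

definition parity_space :: "bit \<Rightarrow> ('k, 'v) tensor set" where
  "parity_space P = fun_vs.span {W vs |ps vs. homogeneous V ps vs \<and> sum_list ps = P}"

lemma subspace_parity_space [simp]: "fun_vs.subspace (parity_space P)"
  by (simp add: parity_space_def)

lemma word_in_parity_space: "homogeneous V ps vs \<Longrightarrow> W vs \<in> parity_space (sum_list ps)"
  unfolding parity_space_def by (rule fun_vs.span_base) blast

lemma parity_space_in_T: "t \<in> parity_space P \<Longrightarrow> t \<in> T"
  using fun_vs.span_mono[of "{W vs |ps vs. homogeneous V ps vs \<and> sum_list ps = P}" "range W"]
  by (auto simp: parity_space_def tensor_algebra_def)

lemma letter_mult_parity_space: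
  assumes "v \<in> V p" "t \<in> parity_space P"
  shows "W [v] \<otimes> t \<in> parity_space (p + P)"
  using _ subspace_parity_space _ assms(2) unfolding parity_space_def
proof (rule linear_on_span_into)
  show "linear_on (fun_vs.span {W vs |ps vs. homogeneous V ps vs \<and> sum_list ps = P}) (\<lambda>t. W [v] \<otimes> t)"
    using linear_on_subset[OF mult_linear_right[of "W [v]"], of "parity_space P"] parity_space_in_T
    by (auto simp: parity_space_def)
  fix w assume "w \<in> {W vs |ps vs. homogeneous V ps vs \<and> sum_list ps = P}"
  then obtain ps vs where "w = W vs" "homogeneous V ps vs" "sum_list ps = P" by auto
  then show "W [v] \<otimes> w \<in> fun_vs.span {W vs |ps vs. homogeneous V ps vs \<and> sum_list ps = p + P}"
    using word_in_parity_space[of "p # ps" "v # vs"] assms(1)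
    by (simp add: tensor_mult_word parity_space_def)
qed

text \<open>The derivation rule; the first summand carries the sign of all of \<open>t\<close>, which is why the parity of \<open>t\<close> enters.\<close>

lemma contraction_letter_mult:
  assumes f: "linear_form f" and v: "v \<in> V p" and t: "t \<in> parity_space P"
  shows "contraction f q r (W [v] \<otimes> t) =
    fscale (parity_sign (q * P) * f v) t + fscale (parity_sign (r * p)) (W [v] \<otimes> contraction f q r t)"
  using _ _ _ t unfolding parity_space_def
proof (rule linear_on_span_eqI)
  let ?S = "fun_vs.span {W vs |ps vs. homogeneous V ps vs \<and> sum_list ps = P}"
  have S: "?S \<subseteq> T" using parity_space_in_T by (auto simp: parity_space_def)
  show "linear_on ?S (\<lambda>t. contraction f q r (W [v] \<otimes> t))"
    by (rule linear_on_subset[OF linear_on_compose[OF mult_linear_right _ linear_on_contraction[of UNIV]] S]) simp_all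
  show "linear_on ?S (\<lambda>t. fscale (parity_sign (q * P) * f v) t +
      fscale (parity_sign (r * p)) (W [v] \<otimes> contraction f q r t))"
    by (intro linear_on_plus linear_on_fscale linear_on_ident
        linear_on_subset[OF linear_on_compose[OF linear_on_contraction _ mult_linear_right] S])
      (simp_all add: f)
qed (use contraction_word_Cons[OF f v] in \<open>auto simp: tensor_mult_word\<close>)

lemma translate_word_parity:
  assumes \<phi>: "even_form \<phi>" and "homogeneous V ps vs"
  shows "translate_word \<phi> vs \<in> parity_space (sum_list ps)"
  using assms(2)
proof (induction vs arbitrary: ps)
  case Nil
  then show ?case using word_in_parity_space[of "[]" "[]"] by simp
next
  case (Cons v vs)
  from Cons.prems obtain p qs where p: "ps = p # qs" "v \<in> V p" "homogeneous V qs vs"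
    by (rule homogeneous_ConsE)
  have "fscale (\<phi> v) (translate_word \<phi> vs) \<in> parity_space (p + sum_list qs)"
    using Cons.IH[OF p(3)] \<phi> p(2)
    by (cases p) (auto simp: fun_vs.subspace_0 intro!: fun_vs.subspace_scale)
  then show ?case
    using letter_mult_parity_space[OF p(2) Cons.IH[OF p(3)]] p(1)
    by (simp add: fun_vs.subspace_add)
qed

text \<open>Translation deletes even letters only, so it changes none of the signs in a contraction.\<close>

lemma contraction_translate:
  assumes \<phi>: "even_form \<phi>" and f: "linear_form f" and t: "t \<in> T"
  shows "contraction f q r (translate \<phi> t) = translate \<phi> (contraction f q r t)"
  using _ _ _ t
proof (rule T_eqI_homogeneous)
  fix ps vs assume "homogeneous V ps vs"
  then show "contraction f q r (translate \<phi> (W vs)) = translate \<phi> (contraction f q r (W vs))"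
  proof (induction vs arbitrary: ps)
    case Nil
    then show ?case
      using \<phi> f by (simp add: contraction_word_Nil linear_on_zero[OF linear_on_translate[of UNIV]])
  next
    case (Cons v vs)
    from Cons.prems obtain p qs where p: "ps = p # qs" "v \<in> V p" "homogeneous V qs vs"
      by (rule homogeneous_ConsE)
    define s :: 'k where "s = parity_sign (r * p)"
    define t where "t = translate_word \<phi> vs"
    define u where "u = contraction f q r t"
    have T: "t \<in> T" "u \<in> T" using f by (simp_all add: t_def u_def)
    have s: "s * \<phi> v = \<phi> v"
      using \<phi> p(2) by (cases p) (auto simp: s_def)
    have IH: "translate \<phi> (contraction f q r (W vs)) = u"
      using Cons.IH[OF p(3)] \<phi> by (simp add: u_def t_def)
    have "contraction f q r (translate \<phi> (W (v # vs))) =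
        fscale (parity_sign (q * sum_list qs) * f v) t + fscale s (W [v] \<otimes> u) + fscale (\<phi> v) u"
      using \<phi> contraction_letter_mult[OF f p(2) translate_word_parity[OF \<phi> p(3)]]
      by (simp add: contraction_add contraction_scale s_def t_def u_def)
    also have "\<dots> = fscale (parity_sign (q * sum_list qs) * f v) t +
        fscale s ((W [v] + fscale (\<phi> v) (W [])) \<otimes> u)"
      using T s by (simp add: linear_on_add[OF mult_linear_left] linear_on_scale[OF mult_linear_left]
          fun_vs.scale_right_distrib add_ac)
    also have "\<dots> = translate \<phi> (contraction f q r (W (v # vs)))"
      using \<phi> f T contraction_word_Cons[OF f p(2,3), of q r]
      by (simp add: linear_on_add[OF linear_on_translate[of UNIV]] linear_on_scale[OF linear_on_translate[of UNIV]]
          translate_mult IH s_def t_def)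
    finally show ?case .
  qed
qed (auto intro!: linear_on_compose[OF linear_on_translate _ linear_on_contraction[of UNIV]]
    linear_on_compose[OF linear_on_contraction _ linear_on_translate[of UNIV]])

text \<open>By the derivation rule only the terms in which \<open>f\<close> meets a commutator itself matter, and these cancel:
  if \<open>f\<close> is non-zero on \<open>x\<close>, then \<open>x\<close> has parity \<open>q + r\<close>, and the sign for swapping \<open>x\<close> and \<open>y\<close> is the product of the
  signs for moving \<open>f\<close> past \<open>y\<close> from either side.\<close>

lemma contraction_commutator_ideal:
  assumes f: "linear_form f" "\<And>v. v \<in> V (q + r + 1) \<Longrightarrow> f v = 0" and t: "t \<in> commutator_ideal"
  shows "contraction f q r t \<in> commutator_ideal"
  using linear_on_contraction subspace_commutator_ideal _ t unfolding commutator_ideal_def[of]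
proof (rule linear_on_span_into)
  fix t assume "t \<in> commutators"
  then obtain ps as p x p' y qs bs where t: "homogeneous V ps as" "x \<in> V p" "y \<in> V p'" "homogeneous V qs bs"
    "t = W (as @ x # y # bs) - fscale (parity_sign (p * p')) (W (as @ y # x # bs))"
    by (auto simp: commutators_def)
  let ?\<epsilon> = "parity_sign (p * p') :: 'k"
  let ?t = "\<lambda>as. W (as @ x # y # bs) - fscale ?\<epsilon> (W (as @ y # x # bs))"
  have "contraction f q r (?t as) \<in> commutator_ideal"
    using t(1)
  proof (induction as arbitrary: ps)
    case Nil
    define u where "u = contraction f q r (W bs)"
    have u: "u \<in> T" using f by (simp add: u_def)
    let ?s = "\<lambda>q p. parity_sign (q * p) :: 'k" and ?B = "sum_list qs"
    have word: "contraction f q r (W (v # w # bs)) =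
        fscale (?s q i' * ?s q ?B * f v) (W (w # bs)) + fscale (?s r i * ?s q ?B * f w) (W (v # bs)) +
        fscale (?s r i * ?s r i') (W [v, w] \<otimes> u)"
      if "v \<in> V i" "w \<in> V i'" for v w i i'
    proof -
      have "homogeneous V (i' # qs) (w # bs)" using that t(4) by simp
      from contraction_word_Cons[OF f(1) that(1) this, of q r]
      have "contraction f q r (W (v # w # bs)) = fscale (?s q i' * ?s q ?B * f v) (W (w # bs)) +
          fscale (?s r i) (W [v] \<otimes> (fscale (?s q ?B * f w) (W bs) + fscale (?s r i') (W [w] \<otimes> u)))"
        by (simp add: contraction_word_Cons[OF f(1) that(2) t(4)] u_def distrib_left)
      moreover have "W [v, w] \<otimes> u = W [v] \<otimes> (W [w] \<otimes> u)"
        using mult_assoc[of "W [v]" "W [w]" u] u by (simp add: tensor_mult_word)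
      ultimately show ?thesis
        using u by (simp add: linear_on_add[OF mult_linear_right] linear_on_scale[OF mult_linear_right]
            tensor_mult_word fun_vs.scale_right_distrib mult.assoc add.assoc)
    qed
    \<comment> \<open>The terms in which \<open>f\<close> meets \<open>x\<close> or \<open>y\<close> cancel, since \<open>f\<close> sees only letters of parity \<open>q + r\<close>.\<close>
    have x: "?s q p' * ?s q ?B * f x = ?\<epsilon> * (?s r p' * ?s q ?B * f x)"
    proof (cases "f x = 0")
      case False
      then have "p = q + r" using even_form_parity[of f "q + r" x p] f t(2) by blast
      then show ?thesis by (simp add: distrib_left distrib_right mult_ac)
    qed simp
    have y: "?s r p * ?s q ?B * f y = ?\<epsilon> * (?s q p * ?s q ?B * f y)"
    proof (cases "f y = 0")
      case False
      then have "p' = q + r" using even_form_parity[of f "q + r" y p'] f t(3) by blast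
      then show ?thesis by (simp add: distrib_left distrib_right mult_ac)
    qed simp
    define c d e where "c = ?s r p' * ?s q ?B * f x" and "d = ?s q p * ?s q ?B * f y"
      and "e = ?s r p * ?s r p'"
    have "contraction f q r (W (x # y # bs)) =
        fscale (?\<epsilon> * c) (W (y # bs)) + fscale (?\<epsilon> * d) (W (x # bs)) + fscale e (W [x, y] \<otimes> u)"
      unfolding word[OF t(2,3)] x y c_def d_def e_def ..
    moreover have "contraction f q r (W (y # x # bs)) =
        fscale d (W (x # bs)) + fscale c (W (y # bs)) + fscale e (W [y, x] \<otimes> u)"
      unfolding word[OF t(3,2)] c_def d_def e_def by (simp only: mult.commute)
    ultimately have "contraction f q r (?t []) = fscale e ((W [x, y] - fscale ?\<epsilon> (W [y, x])) \<otimes> u)"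
      using u
      by (simp add: contraction_diff contraction_scale
          linear_on_diff[OF mult_linear_left] linear_on_scale[OF mult_linear_left]
          fun_vs.scale_right_distrib fun_vs.scale_right_diff_distrib mult.commute)
    moreover have "W [x, y] - fscale ?\<epsilon> (W [y, x]) \<in> commutator_ideal"
      using commutator_in_ideal[of "[]" "[]" x p y p' "[]" "[]"] t by simp
    ultimately show ?case
      using u by (simp add: commutator_ideal_mult fun_vs.subspace_scale)
  next
    case (Cons a as)
    from Cons.prems obtain i rs where a: "ps = i # rs" "a \<in> V i" "homogeneous V rs as"
      by (rule homogeneous_ConsE)
    let ?P = "sum_list rs + (p + (p' + sum_list qs))"
    have "W (as @ x # y # bs) \<in> parity_space ?P" "W (as @ y # x # bs) \<in> parity_space ?P"
      using word_in_parity_space[OF homogeneous_append[OF a(3)], of "p # p' # qs" "x # y # bs"]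
        word_in_parity_space[OF homogeneous_append[OF a(3)], of "p' # p # qs" "y # x # bs"] t
      by (simp_all add: add_ac)
    then have "?t as \<in> parity_space ?P"
      by (intro fun_vs.subspace_diff fun_vs.subspace_scale subspace_parity_space)
    from contraction_letter_mult[OF f(1) a(2) this, of q r]
    have "contraction f q r (W [a] \<otimes> ?t as) \<in> commutator_ideal"
      using Cons.IH[OF a(3)] commutator_in_ideal[OF a(3) t(2-4)]
      by (simp add: fun_vs.subspace_add fun_vs.subspace_scale commutator_ideal_mult)
    moreover have "W [a] \<otimes> ?t as = ?t (a # as)"
      by (simp add: linear_on_diff[OF mult_linear_right] linear_on_scale[OF mult_linear_right] tensor_mult_word)
    ultimately show ?case by simp
  qed
  then show "contraction f q r t \<in> fun_vs.span commutators"
    by (simp add: t(5) flip: commutator_ideal_def)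
qed

end

section \<open>The star product\<close>

context graded_space
begin

abbreviation even_pairing :: "('v \<Rightarrow> 'v \<Rightarrow> 'k) \<Rightarrow> bool" where
  "even_pairing \<Lambda> \<equiv> (\<forall>v. linear_form (\<Lambda> v)) \<and> (\<forall>w. linear_form (\<lambda>v. \<Lambda> v w)) \<and>
     (\<forall>i j. i \<noteq> j \<longrightarrow> (\<forall>v\<in>V i. \<forall>w\<in>V j. \<Lambda> v w = 0))"

abbreviation P_sign :: "bit list \<Rightarrow> bit list \<Rightarrow> nat \<Rightarrow> nat \<Rightarrow> nat \<Rightarrow> 'k" where
  "P_sign ps qs n k l \<equiv> parity_sign (ps ! k * (\<Sum>i\<in>{k<..<n}. ps ! i) + qs ! l * (\<Sum>j<l. qs ! j))"

text \<open>The operator \<open>P\<^sub>\<Lambda>\<close> before symmetrization, on the whole tensor square.\<close>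

definition P_tensor :: "('v \<Rightarrow> 'v \<Rightarrow> 'k) \<Rightarrow> ('k, 'v) tensor2 \<Rightarrow> ('k, 'v) tensor2" where
  "P_tensor \<Lambda> = lift2 (\<lambda>vs ws g. homogeneous_ext vs (\<lambda>ps vs. homogeneous_ext ws (\<lambda>qs ws.
     (\<Sum>k<length vs. \<Sum>l<length ws.
        fscale (P_sign ps qs (length vs) k l * \<Lambda> (vs ! k) (ws ! l))
          (W (drop_at k vs) \<boxtimes> W (drop_at l ws))) g)))"

lemma linear_on_P_tensor: "linear_on D (P_tensor \<Lambda>)"
  by (simp add: P_tensor_def linear_on_lift2)

lemma P_tensor_word:
  assumes \<Lambda>: "even_pairing \<Lambda>" and hom: "homogeneous V ps vs" "homogeneous V qs ws"
  shows "P_tensor \<Lambda> (W vs \<boxtimes> W ws) = (\<Sum>k<length vs. \<Sum>l<length ws.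
    fscale (P_sign ps qs (length vs) k l * \<Lambda> (vs ! k) (ws ! l)) (W (drop_at k vs) \<boxtimes> W (drop_at l ws)))"
proof
  fix g
  let ?h = "\<lambda>ps vs qs ws. (\<Sum>k<length vs. \<Sum>l<length ws.
        fscale (P_sign ps qs (length vs) k l * \<Lambda> (vs ! k) (ws ! l))
          (W (drop_at k vs) \<boxtimes> W (drop_at l ws)))"
  have left: "multilinear smul (\<lambda>vs. ?h ps vs qs ws g)" for ps qs ws g
  proof -
    have "multilinear smul (\<lambda>vs. \<Sum>l<length ws. \<Sum>k<length vs.
        P_sign ps qs (length vs) k l * (\<Lambda> (vs ! k) (ws ! l) * (W (drop_at k vs) \<boxtimes> W (drop_at l ws)) g))"
      using \<Lambda>
      by (intro multilinear_sum multilinear_sum_contractions[where c = "\<lambda>n k. P_sign ps qs n k _"]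
          multilinear_linear_on_word[where F = "\<lambda>a. a \<boxtimes> W _"]) (auto intro: outer_linear_left)
    then show ?thesis
      by (subst sum.swap) (simp add: sum_fun_apply fun_apply mult.assoc)
  qed
  have right: "multilinear smul (\<lambda>ws. ?h ps vs qs ws g)" for ps vs qs g
  proof -
    have "multilinear smul (\<lambda>ws. \<Sum>k<length vs. \<Sum>l<length ws.
        P_sign ps qs (length vs) k l * (\<Lambda> (vs ! k) (ws ! l) * (W (drop_at k vs) \<boxtimes> W (drop_at l ws)) g))"
      using \<Lambda>
      by (intro multilinear_sum multilinear_sum_contractions[where c = "\<lambda>_ l. P_sign ps qs _ _ l"]
          multilinear_linear_on_word[where F = "\<lambda>b. W _ \<boxtimes> b"]) (auto intro: outer_linear_right)
    then show ?thesis
      by (simp add: sum_fun_apply fun_apply mult.assoc)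
  qed
  have "P_tensor \<Lambda> (W vs \<boxtimes> W ws) g = homogeneous_ext vs (\<lambda>ps vs. homogeneous_ext ws (\<lambda>qs ws. ?h ps vs qs ws g))"
    unfolding P_tensor_def
    by (subst lift2_word)
      (auto simp only: bimultilinear_def left right
        intro!: multilinear_homogeneous_ext multilinear_homogeneous_ext_parameter)
  also have "\<dots> = homogeneous_ext ws (\<lambda>qs ws. ?h ps vs qs ws g)"
    by (rule homogeneous_ext_eq[OF multilinear_homogeneous_ext_parameter[OF left] hom(1)])
  also have "\<dots> = ?h ps vs qs ws g"
    by (rule homogeneous_ext_eq[OF right hom(2)])
  finally show "P_tensor \<Lambda> (W vs \<boxtimes> W ws) g = ?h ps vs qs ws g" .
qed

lemma even_pairing_parity:
  "even_pairing \<Lambda> \<Longrightarrow> v \<in> V p \<Longrightarrow> w \<in> V q \<Longrightarrow> \<Lambda> v w \<noteq> 0 \<Longrightarrow> p = q"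
  by blast

text \<open>For a fixed word in one factor, \<open>P\<^sub>\<Lambda>\<close> acts on the other factor by signed contractions.\<close>

lemma P_tensor_left:
  assumes \<Lambda>: "even_pairing \<Lambda>" and ws: "homogeneous V qs ws" and a: "a \<in> T"
  shows "P_tensor \<Lambda> (a \<boxtimes> W ws) = (\<Sum>l<length ws. fscale (parity_sign (qs ! l * (\<Sum>j<l. qs ! j)))
    (contraction (\<lambda>v. \<Lambda> v (ws ! l)) (qs ! l) 0 a \<boxtimes> W (drop_at l ws)))"
  using _ _ _ a
proof (rule T_eqI_homogeneous)
  show "linear_on T (\<lambda>a. P_tensor \<Lambda> (a \<boxtimes> W ws))"
    by (rule linear_on_compose[OF outer_linear_left _ linear_on_P_tensor[of UNIV]]) simp_all
  show "linear_on T (\<lambda>a. \<Sum>l<length ws. fscale (parity_sign (qs ! l * (\<Sum>j<l. qs ! j)))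
      (contraction (\<lambda>v. \<Lambda> v (ws ! l)) (qs ! l) 0 a \<boxtimes> W (drop_at l ws)))"
    by (intro linear_on_sum_maps linear_on_fscale linear_on_compose[OF linear_on_contraction _ outer_linear_left])
      (use \<Lambda> in simp_all)
  fix ps vs assume vs: "homogeneous V ps vs"
  have coeff: "P_sign ps qs (length vs) k l * \<Lambda> (vs ! k) (ws ! l) =
      parity_sign (qs ! l * (\<Sum>j<l. qs ! j)) *
      (parity_sign (qs ! l * (\<Sum>i\<in>{k<..<length vs}. ps ! i) + 0 * (\<Sum>j<k. ps ! j)) * \<Lambda> (vs ! k) (ws ! l))"
    if "k < length vs" "l < length ws" for k l
  proof (cases "\<Lambda> (vs ! k) (ws ! l) = 0")
    case False
    then have "ps ! k = qs ! l"
      using even_pairing_parity[OF \<Lambda>] homogeneous_nth[OF vs that(1)] homogeneous_nth[OF ws that(2)] by blast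
    then show ?thesis by (simp add: mult_ac)
  qed simp
  have "P_tensor \<Lambda> (W vs \<boxtimes> W ws) = (\<Sum>l<length ws. \<Sum>k<length vs.
      fscale (P_sign ps qs (length vs) k l * \<Lambda> (vs ! k) (ws ! l)) (W (drop_at k vs) \<boxtimes> W (drop_at l ws)))"
    unfolding P_tensor_word[OF \<Lambda> vs ws] by (rule sum.swap)
  also have "\<dots> = (\<Sum>l<length ws. fscale (parity_sign (qs ! l * (\<Sum>j<l. qs ! j)))
      (contraction (\<lambda>v. \<Lambda> v (ws ! l)) (qs ! l) 0 (W vs) \<boxtimes> W (drop_at l ws)))"
  proof (rule sum.cong[OF refl])
    fix l assume l: "l \<in> {..<length ws}"
    have \<Lambda>l: "linear_form (\<lambda>v. \<Lambda> v (ws ! l))" using \<Lambda> by blast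
    show "(\<Sum>k<length vs. fscale (P_sign ps qs (length vs) k l * \<Lambda> (vs ! k) (ws ! l))
        (W (drop_at k vs) \<boxtimes> W (drop_at l ws))) = fscale (parity_sign (qs ! l * (\<Sum>j<l. qs ! j)))
      (contraction (\<lambda>v. \<Lambda> v (ws ! l)) (qs ! l) 0 (W vs) \<boxtimes> W (drop_at l ws))"
      unfolding contraction_word[OF \<Lambda>l vs]
      by (subst linear_on_sum[OF outer_linear_left[OF word_in_T]], simp, simp,
          unfold fun_vs.scale_sum_right, rule sum.cong[OF refl],
          subst linear_on_scale[OF outer_linear_left[OF word_in_T]], simp)
        (use coeff l in simp)
  qed
  finally show "P_tensor \<Lambda> (W vs \<boxtimes> W ws) = (\<Sum>l<length ws. fscale (parity_sign (qs ! l * (\<Sum>j<l. qs ! j)))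
      (contraction (\<lambda>v. \<Lambda> v (ws ! l)) (qs ! l) 0 (W vs) \<boxtimes> W (drop_at l ws)))" .
qed

lemma P_tensor_right:
  assumes \<Lambda>: "even_pairing \<Lambda>" and vs: "homogeneous V ps vs" and b: "b \<in> T"
  shows "P_tensor \<Lambda> (W vs \<boxtimes> b) = (\<Sum>k<length vs. fscale (parity_sign (ps ! k * (\<Sum>i\<in>{k<..<length vs}. ps ! i)))
    (W (drop_at k vs) \<boxtimes> contraction (\<Lambda> (vs ! k)) 0 (ps ! k) b))"
  using _ _ _ b
proof (rule T_eqI_homogeneous)
  show "linear_on T (\<lambda>b. P_tensor \<Lambda> (W vs \<boxtimes> b))"
    by (rule linear_on_compose[OF outer_linear_right _ linear_on_P_tensor[of UNIV]]) simp_all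
  show "linear_on T (\<lambda>b. \<Sum>k<length vs. fscale (parity_sign (ps ! k * (\<Sum>i\<in>{k<..<length vs}. ps ! i)))
      (W (drop_at k vs) \<boxtimes> contraction (\<Lambda> (vs ! k)) 0 (ps ! k) b))"
    by (intro linear_on_sum_maps linear_on_fscale linear_on_compose[OF linear_on_contraction _ outer_linear_right])
      (use \<Lambda> in simp_all)
  fix qs ws assume ws: "homogeneous V qs ws"
  have coeff: "P_sign ps qs (length vs) k l * \<Lambda> (vs ! k) (ws ! l) =
      parity_sign (ps ! k * (\<Sum>i\<in>{k<..<length vs}. ps ! i)) *
      (parity_sign (0 * (\<Sum>i\<in>{l<..<length ws}. qs ! i) + ps ! k * (\<Sum>j<l. qs ! j)) * \<Lambda> (vs ! k) (ws ! l))"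
    if "k < length vs" "l < length ws" for k l
  proof (cases "\<Lambda> (vs ! k) (ws ! l) = 0")
    case False
    then have "ps ! k = qs ! l"
      using even_pairing_parity[OF \<Lambda>] homogeneous_nth[OF vs that(1)] homogeneous_nth[OF ws that(2)] by blast
    then show ?thesis by (simp add: mult_ac)
  qed simp
  show "P_tensor \<Lambda> (W vs \<boxtimes> W ws) = (\<Sum>k<length vs. fscale (parity_sign (ps ! k * (\<Sum>i\<in>{k<..<length vs}. ps ! i)))
      (W (drop_at k vs) \<boxtimes> contraction (\<Lambda> (vs ! k)) 0 (ps ! k) (W ws)))"
    unfolding P_tensor_word[OF \<Lambda> vs ws]
  proof (rule sum.cong[OF refl])
    fix k assume k: "k \<in> {..<length vs}"
    have \<Lambda>k: "linear_form (\<Lambda> (vs ! k))" using \<Lambda> by blast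
    show "(\<Sum>l<length ws. fscale (P_sign ps qs (length vs) k l * \<Lambda> (vs ! k) (ws ! l))
        (W (drop_at k vs) \<boxtimes> W (drop_at l ws))) = fscale (parity_sign (ps ! k * (\<Sum>i\<in>{k<..<length vs}. ps ! i)))
      (W (drop_at k vs) \<boxtimes> contraction (\<Lambda> (vs ! k)) 0 (ps ! k) (W ws))"
      unfolding contraction_word[OF \<Lambda>k ws]
      by (subst linear_on_sum[OF outer_linear_right[OF word_in_T]], simp, simp,
          unfold fun_vs.scale_sum_right, rule sum.cong[OF refl],
          subst linear_on_scale[OF outer_linear_right[OF word_in_T]], simp)
        (use coeff k in simp)
  qed
qed

lemma T2_sum: "(\<And>i. i \<in> A \<Longrightarrow> f i \<in> T2) \<Longrightarrow> sum f A \<in> T2"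
  by (rule fun_vs.subspace_sum) simp_all

lemma T2_homogeneous: "T2 = fun_vs.span {W vs \<boxtimes> W ws |ps vs qs ws. homogeneous V ps vs \<and> homogeneous V qs ws}"
  (is "_ = fun_vs.span ?H")
proof (rule antisym)
  have "W xs \<boxtimes> W ys \<in> fun_vs.span ?H" for xs ys
  proof (rule bilinear_on_span_into[where F = "outer smul"])
    show "bilinear_on (fun_vs.span {W vs |ps vs. homogeneous V ps vs})
        (fun_vs.span {W vs |ps vs. homogeneous V ps vs}) (outer smul)"
      using bilinear_on_outer by (simp add: T_homogeneous)
    show "W xs \<in> fun_vs.span {W vs |ps vs. homogeneous V ps vs}" "W ys \<in> fun_vs.span {W vs |ps vs. homogeneous V ps vs}"
      using word_in_T by (simp_all add: T_homogeneous)
  qed (auto intro!: fun_vs.span_base)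
  then show "T2 \<subseteq> fun_vs.span ?H"
    unfolding T2_def by (intro fun_vs.span_minimal) auto
  show "fun_vs.span ?H \<subseteq> T2"
    by (rule fun_vs.span_minimal) auto
qed

lemma P_tensor_in_T2:
  assumes "even_pairing \<Lambda>" "u \<in> T2"
  shows "P_tensor \<Lambda> u \<in> T2"
  using linear_on_P_tensor subspace_T2 _ assms(2)[unfolded T2_homogeneous]
  by (rule linear_on_span_into) (auto simp: P_tensor_word[OF assms(1)] intro!: T2_sum fun_vs.subspace_scale)

lemma bilinear_on_P_tensor: "bilinear_on T T (\<lambda>a b. P_tensor \<Lambda> (a \<boxtimes> b))"
  by (rule linear_on_compose_bilinear[OF bilinear_on_outer linear_on_P_tensor[of UNIV]]) simp

subsection \<open>Compatibility with symmetrization\<close>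

definition Sym2 :: "('k, 'v) tensor2 \<Rightarrow> ('k, 'v) tensor2" where
  "Sym2 = tensor_maps Sym Sym"

lemma linear_on_Sym2: "linear_on D Sym2"
  by (simp add: Sym2_def linear_on_tensor_maps)

lemma Sym2_outer: "s \<in> T \<Longrightarrow> t \<in> T \<Longrightarrow> Sym2 (s \<boxtimes> t) = Sym s \<boxtimes> Sym t"
  unfolding Sym2_def by (rule tensor_maps_outer) (simp_all add: linear_on_Sym)

lemma outer_zero: "t \<in> T \<Longrightarrow> 0 \<boxtimes> t = 0" "s \<in> T \<Longrightarrow> s \<boxtimes> 0 = 0"
  using linear_on_zero[OF outer_linear_left] linear_on_zero[OF outer_linear_right] by auto

lemma bilinear_on_Sym2_P_tensor: "bilinear_on T T (\<lambda>a b. Sym2 (P_tensor \<Lambda> (a \<boxtimes> b)))"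
  by (rule linear_on_compose_bilinear[OF bilinear_on_P_tensor linear_on_Sym2[of UNIV]]) simp

lemma Sym2_P_tensor_ideal_left:
  assumes \<Lambda>: "even_pairing \<Lambda>" and a: "a \<in> commutator_ideal" and b: "b \<in> T"
  shows "Sym2 (P_tensor \<Lambda> (a \<boxtimes> b)) = 0"
  using _ linear_on_const_zero _ b
proof (rule T_eqI_homogeneous)
  have aT: "a \<in> T" using a by (rule commutator_ideal_in_T)
  show "linear_on T (\<lambda>b. Sym2 (P_tensor \<Lambda> (a \<boxtimes> b)))"
    by (rule bilinear_on_right[OF bilinear_on_Sym2_P_tensor aT])
  fix qs ws assume ws: "homogeneous V qs ws"
  have zero: "Sym (contraction (\<lambda>v. \<Lambda> v (ws ! l)) (qs ! l) 0 a) = 0" if "l < length ws" for l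
  proof (intro Sym_commutator_ideal contraction_commutator_ideal a)
    show "\<Lambda> v (ws ! l) = 0" if "v \<in> V (qs ! l + 0 + 1)" for v
      using even_pairing_parity[OF \<Lambda> that homogeneous_nth[OF ws \<open>l < length ws\<close>]]
      by (cases "qs ! l") auto
  qed (use \<Lambda> in blast)
  show "Sym2 (P_tensor \<Lambda> (a \<boxtimes> W ws)) = 0"
    unfolding P_tensor_left[OF \<Lambda> ws aT]
    by (subst linear_on_sum[OF linear_on_Sym2[of UNIV]])
      (use \<Lambda> aT in \<open>simp_all add: linear_on_scale[OF linear_on_Sym2[of UNIV]] Sym2_outer zero outer_zero\<close>)
qed

lemma Sym2_P_tensor_ideal_right:
  assumes \<Lambda>: "even_pairing \<Lambda>" and a: "a \<in> T" and b: "b \<in> commutator_ideal"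
  shows "Sym2 (P_tensor \<Lambda> (a \<boxtimes> b)) = 0"
  using _ linear_on_const_zero _ a
proof (rule T_eqI_homogeneous)
  have bT: "b \<in> T" using b by (rule commutator_ideal_in_T)
  show "linear_on T (\<lambda>a. Sym2 (P_tensor \<Lambda> (a \<boxtimes> b)))"
    by (rule bilinear_on_left[OF bilinear_on_Sym2_P_tensor bT])
  fix ps vs assume vs: "homogeneous V ps vs"
  have zero: "Sym (contraction (\<Lambda> (vs ! k)) 0 (ps ! k) b) = 0" if "k < length vs" for k
  proof (intro Sym_commutator_ideal contraction_commutator_ideal b)
    show "\<Lambda> (vs ! k) w = 0" if "w \<in> V (0 + ps ! k + 1)" for w
      using even_pairing_parity[OF \<Lambda> homogeneous_nth[OF vs \<open>k < length vs\<close>] that]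
      by (cases "ps ! k") auto
  qed (use \<Lambda> in blast)
  show "Sym2 (P_tensor \<Lambda> (W vs \<boxtimes> b)) = 0"
    unfolding P_tensor_right[OF \<Lambda> vs bT]
    by (subst linear_on_sum[OF linear_on_Sym2[of UNIV]])
      (use \<Lambda> bT in \<open>simp_all add: linear_on_scale[OF linear_on_Sym2[of UNIV]] Sym2_outer zero outer_zero\<close>)
qed

text \<open>So \<open>P_tensor\<close> followed by symmetrization takes on a product \<open>v\<^sub>1\<cdots>v\<^sub>n \<otimes> w\<^sub>1\<cdots>w\<^sub>m\<close> of symmetric words the value that it
  takes on the underlying words, as the definition of \<^const>\<open>P_form\<close> prescribes.\<close>

lemma Sym2_P_tensor_Sym:
  assumes \<Lambda>: "even_pairing \<Lambda>" and a: "a \<in> T" and b: "b \<in> T"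
  shows "Sym2 (P_tensor \<Lambda> (Sym a \<boxtimes> Sym b)) = Sym2 (P_tensor \<Lambda> (a \<boxtimes> b))"
proof -
  have "Sym2 (P_tensor \<Lambda> ((a - Sym a) \<boxtimes> Sym b)) = 0"
    using a b by (intro Sym2_P_tensor_ideal_left \<Lambda> Sym_congruent) simp_all
  moreover have "Sym2 (P_tensor \<Lambda> (a \<boxtimes> (b - Sym b))) = 0"
    using a b by (intro Sym2_P_tensor_ideal_right \<Lambda> Sym_congruent) simp_all
  ultimately show ?thesis
    using a b linear_on_diff[OF bilinear_on_left[OF bilinear_on_Sym2_P_tensor]]
      linear_on_diff[OF bilinear_on_right[OF bilinear_on_Sym2_P_tensor]]
    by simp
qed

lemma Sym_in_sym_algebra: "t \<in> T \<Longrightarrow> Sym t \<in> sym_algebra smul V"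
  by (simp add: sym_algebra_iff)

lemma sym_algebra_in_T: "t \<in> sym_algebra smul V \<Longrightarrow> t \<in> T"
  by (simp add: sym_algebra_iff)

lemma outer_in_sym_square:
  "a \<in> sym_algebra smul V \<Longrightarrow> b \<in> sym_algebra smul V \<Longrightarrow> a \<boxtimes> b \<in> sym_square smul V"
  unfolding sym_square_def by (rule fun_vs.span_base) blast

lemma subspace_sym_square [simp]: "fun_vs.subspace (sym_square smul V)"
  by (simp add: sym_square_def)

lemma Sym2_in_sym_square:
  assumes "u \<in> T2"
  shows "Sym2 u \<in> sym_square smul V"
  using linear_on_Sym2 subspace_sym_square _ assms unfolding T2_def
  by (rule linear_on_span_into) (auto simp: Sym2_outer outer_in_sym_square Sym_in_sym_algebra)

lemma sym_square_subset_T2: "u \<in> sym_square smul V \<Longrightarrow> u \<in> T2"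
  unfolding sym_square_def
  by (rule set_mp[OF fun_vs.span_minimal[OF _ subspace_T2]]) (auto simp: sym_algebra_in_T)

text \<open>The arguments at which \<^const>\<open>P_form\<close> is prescribed span its domain.\<close>

lemma sym_square_eq:
  "sym_square smul V = fun_vs.span {Sym (W vs) \<boxtimes> Sym (W ws) |ps vs qs ws. homogeneous V ps vs \<and> homogeneous V qs ws}"
  (is "_ = fun_vs.span ?H")
proof (rule antisym)
  have "a \<boxtimes> b \<in> fun_vs.span ?H" if ab: "a \<in> sym_algebra smul V" "b \<in> sym_algebra smul V" for a b
  proof -
    have u: "a \<boxtimes> b \<in> fun_vs.span {W vs \<boxtimes> W ws |ps vs qs ws. homogeneous V ps vs \<and> homogeneous V qs ws}"
      using ab by (simp flip: T2_homogeneous add: sym_algebra_in_T)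
    have "Sym2 (a \<boxtimes> b) \<in> fun_vs.span ?H"
      using linear_on_Sym2 fun_vs.subspace_span _ u
    proof (rule linear_on_span_into)
      fix x assume "x \<in> {W vs \<boxtimes> W ws |ps vs qs ws. homogeneous V ps vs \<and> homogeneous V qs ws}"
      then obtain ps vs qs ws where "x = W vs \<boxtimes> W ws" "homogeneous V ps vs" "homogeneous V qs ws" by blast
      then have "Sym2 x \<in> ?H" by (simp add: Sym2_outer) blast
      then show "Sym2 x \<in> fun_vs.span ?H" by (rule fun_vs.span_base)
    qed
    then show ?thesis using ab by (simp add: Sym2_outer sym_algebra_iff)
  qed
  then show "sym_square smul V \<subseteq> fun_vs.span ?H"
    unfolding sym_square_def by (intro fun_vs.span_minimal) auto
  show "fun_vs.span ?H \<subseteq> sym_square smul V"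
    by (rule fun_vs.span_minimal[OF _ subspace_sym_square])
      (auto intro!: outer_in_sym_square Sym_in_sym_algebra)
qed

lemma sym_word_eq: "sym_word smul V vs = Sym (W vs)"
  by (simp add: sym_word_def symmetrize_eq)

lemma P_form_eq:
  assumes \<Lambda>: "even_pairing \<Lambda>" and u: "u \<in> sym_square smul V"
  shows "P_form smul V \<Lambda> u = Sym2 (P_tensor \<Lambda> u)"
  unfolding P_form_def sym_word_eq
proof (rule linear_extension_eq[OF _ _ _ u])
  show "linear_on (sym_square smul V) (\<lambda>u. Sym2 (P_tensor \<Lambda> u))"
    by (rule linear_on_compose[OF linear_on_P_tensor _ linear_on_Sym2[of UNIV]]) simp
  let ?G = "{(Sym (W vs) \<boxtimes> Sym (W ws), \<Sum>k<length vs. \<Sum>l<length ws.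
      fscale (P_sign ps qs (length vs) k l * \<Lambda> (vs ! k) (ws ! l))
        (Sym (W (drop_at k vs)) \<boxtimes> Sym (W (drop_at l ws)))) |ps vs qs ws.
      homogeneous V ps vs \<and> homogeneous V qs ws}"
  show "sym_square smul V = fun_vs.span (fst ` ?G)"
    unfolding sym_square_eq by (rule arg_cong[where f = fun_vs.span]) (auto simp: image_def)
  fix a b assume "(a, b) \<in> ?G"
  then obtain ps vs qs ws where hom: "homogeneous V ps vs" "homogeneous V qs ws"
    and a: "a = Sym (W vs) \<boxtimes> Sym (W ws)"
    and b: "b = (\<Sum>k<length vs. \<Sum>l<length ws.
      fscale (P_sign ps qs (length vs) k l * \<Lambda> (vs ! k) (ws ! l))
        (Sym (W (drop_at k vs)) \<boxtimes> Sym (W (drop_at l ws))))"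
    by blast
  have "Sym2 (P_tensor \<Lambda> a) = Sym2 (P_tensor \<Lambda> (W vs \<boxtimes> W ws))"
    unfolding a by (rule Sym2_P_tensor_Sym[OF \<Lambda>]) simp_all
  also have "\<dots> = b"
    unfolding P_tensor_word[OF \<Lambda> hom] b
    by (simp add: linear_on_sum[OF linear_on_Sym2[of UNIV]] linear_on_scale[OF linear_on_Sym2[of UNIV]] Sym2_outer)
  finally show "Sym2 (P_tensor \<Lambda> a) = b" .
qed

definition mult_map :: "('k, 'v) tensor2 \<Rightarrow> ('k, 'v) tensor" where
  "mult_map = lift2 (\<lambda>xs ys. W xs \<otimes> W ys)"

lemma linear_on_mult_map: "linear_on D mult_map"
  by (simp add: mult_map_def linear_on_lift2)

lemma mult_map_outer: "s \<in> T \<Longrightarrow> t \<in> T \<Longrightarrow> mult_map (s \<boxtimes> t) = s \<otimes> t"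
  unfolding mult_map_def by (rule lift2_outer[OF bilinear_on_mult])

lemma mult_map_in_T: "u \<in> T2 \<Longrightarrow> mult_map u \<in> T"
  using linear_on_mult_map subspace_T _ unfolding T2_def
  by (rule linear_on_span_into) (auto simp: mult_map_outer)

lemma sym_mult_eq:
  assumes u: "u \<in> sym_square smul V"
  shows "sym_mult smul V u = Sym (mult_map u)"
  unfolding sym_mult_def
proof (rule linear_extension_eq[OF _ _ _ u])
  show "linear_on (sym_square smul V) (\<lambda>u. Sym (mult_map u))"
    by (rule linear_on_compose[OF linear_on_mult_map _ linear_on_Sym[of UNIV]]) simp
  show "sym_square smul V = fun_vs.span (fst ` {(a \<boxtimes> b, symmetrize smul V (a \<otimes> b)) |a b.
      a \<in> sym_algebra smul V \<and> b \<in> sym_algebra smul V})"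
    unfolding sym_square_def by (rule arg_cong[where f = fun_vs.span]) (auto simp: image_def)
qed (auto simp: mult_map_outer sym_algebra_in_T symmetrize_eq)

subsection \<open>Compatibility with translations\<close>

definition translate2 :: "('v \<Rightarrow> 'k) \<Rightarrow> ('k, 'v) tensor2 \<Rightarrow> ('k, 'v) tensor2" where
  "translate2 \<phi> = tensor_maps (translate \<phi>) (translate \<phi>)"

lemma linear_on_translate2: "linear_on D (translate2 \<phi>)"
  by (simp add: translate2_def linear_on_tensor_maps)

lemma translate2_outer:
  "linear_form \<phi> \<Longrightarrow> s \<in> T \<Longrightarrow> t \<in> T \<Longrightarrow> translate2 \<phi> (s \<boxtimes> t) = translate \<phi> s \<boxtimes> translate \<phi> t"
  unfolding translate2_def by (rule tensor_maps_outer) (simp_all add: linear_on_translate)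

text \<open>Translating only the left factor, one may keep a homogeneous word fixed in the right factor, so that
  \<open>P_tensor_left\<close> reduces the claim to contractions.\<close>

lemma P_tensor_translate_left:
  assumes \<phi>: "even_form \<phi>" and \<Lambda>: "even_pairing \<Lambda>" and a: "a \<in> T" and b: "b \<in> T"
  shows "P_tensor \<Lambda> (translate \<phi> a \<boxtimes> b) = tensor_maps (translate \<phi>) id (P_tensor \<Lambda> (a \<boxtimes> b))"
  using _ _ _ b
proof (rule T_eqI_homogeneous)
  show "linear_on T (\<lambda>b. P_tensor \<Lambda> (translate \<phi> a \<boxtimes> b))"
    using \<phi> a by (intro bilinear_on_right[OF bilinear_on_P_tensor]) simp
  show "linear_on T (\<lambda>b. tensor_maps (translate \<phi>) id (P_tensor \<Lambda> (a \<boxtimes> b)))"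
    by (rule linear_on_compose[OF bilinear_on_right[OF bilinear_on_P_tensor a] _ linear_on_tensor_maps[of UNIV]]) simp
  fix qs ws assume ws: "homogeneous V qs ws"
  have outer: "tensor_maps (translate \<phi>) id (s \<boxtimes> W xs) = translate \<phi> s \<boxtimes> W xs" if "s \<in> T" for s xs
    using tensor_maps_outer[of "translate \<phi>" id s "W xs"] \<phi> that
    by (simp add: linear_on_translate linear_on_ident id_def)
  have \<tau>a: "translate \<phi> a \<in> T" using \<phi> a by simp
  show "P_tensor \<Lambda> (translate \<phi> a \<boxtimes> W ws) = tensor_maps (translate \<phi>) id (P_tensor \<Lambda> (a \<boxtimes> W ws))"
    unfolding P_tensor_left[OF \<Lambda> ws a] P_tensor_left[OF \<Lambda> ws \<tau>a]
    using \<Lambda> a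
    by (simp add: linear_on_sum[OF linear_on_tensor_maps[of UNIV]] linear_on_scale[OF linear_on_tensor_maps[of UNIV]]
        outer contraction_translate[OF \<phi>])
qed

lemma P_tensor_translate_right:
  assumes \<phi>: "even_form \<phi>" and \<Lambda>: "even_pairing \<Lambda>" and a: "a \<in> T" and b: "b \<in> T"
  shows "P_tensor \<Lambda> (a \<boxtimes> translate \<phi> b) = tensor_maps id (translate \<phi>) (P_tensor \<Lambda> (a \<boxtimes> b))"
  using _ _ _ a
proof (rule T_eqI_homogeneous)
  show "linear_on T (\<lambda>a. P_tensor \<Lambda> (a \<boxtimes> translate \<phi> b))"
    using \<phi> b by (intro bilinear_on_left[OF bilinear_on_P_tensor]) simp
  show "linear_on T (\<lambda>a. tensor_maps id (translate \<phi>) (P_tensor \<Lambda> (a \<boxtimes> b)))"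
    by (rule linear_on_compose[OF bilinear_on_left[OF bilinear_on_P_tensor b] _ linear_on_tensor_maps[of UNIV]]) simp
  fix ps vs assume vs: "homogeneous V ps vs"
  have outer: "tensor_maps id (translate \<phi>) (W xs \<boxtimes> t) = W xs \<boxtimes> translate \<phi> t" if "t \<in> T" for t xs
    using tensor_maps_outer[of id "translate \<phi>" "W xs" t] \<phi> that
    by (simp add: linear_on_translate linear_on_ident id_def)
  have \<tau>b: "translate \<phi> b \<in> T" using \<phi> b by simp
  show "P_tensor \<Lambda> (W vs \<boxtimes> translate \<phi> b) = tensor_maps id (translate \<phi>) (P_tensor \<Lambda> (W vs \<boxtimes> b))"
    unfolding P_tensor_right[OF \<Lambda> vs b] P_tensor_right[OF \<Lambda> vs \<tau>b]
    using \<Lambda> b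
    by (simp add: linear_on_sum[OF linear_on_tensor_maps[of UNIV]] linear_on_scale[OF linear_on_tensor_maps[of UNIV]]
        outer contraction_translate[OF \<phi>])
qed

lemma P_tensor_translate:
  assumes \<phi>: "even_form \<phi>" and \<Lambda>: "even_pairing \<Lambda>" and u: "u \<in> T2"
  shows "P_tensor \<Lambda> (translate2 \<phi> u) = translate2 \<phi> (P_tensor \<Lambda> u)"
  using _ _ _ u
proof (rule T2_eqI)
  show "linear_on T2 (\<lambda>u. P_tensor \<Lambda> (translate2 \<phi> u))"
    by (rule linear_on_compose[OF linear_on_translate2 _ linear_on_P_tensor[of UNIV]]) simp
  show "linear_on T2 (\<lambda>u. translate2 \<phi> (P_tensor \<Lambda> u))"
    by (rule linear_on_compose[OF linear_on_P_tensor _ linear_on_translate2[of UNIV]]) simp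
  fix xs ys
  have compose: "tensor_maps (translate \<phi>) id (tensor_maps id (translate \<phi>) w) = translate2 \<phi> w" if "w \<in> T2" for w
    using _ _ _ that
  proof (rule T2_eqI)
    show "linear_on T2 (\<lambda>w. tensor_maps (translate \<phi>) id (tensor_maps id (translate \<phi>) w))"
      by (rule linear_on_compose[OF linear_on_tensor_maps _ linear_on_tensor_maps[of UNIV]]) simp
    show "tensor_maps (translate \<phi>) id (tensor_maps id (translate \<phi>) (W xs \<boxtimes> W ys)) = translate2 \<phi> (W xs \<boxtimes> W ys)" for xs ys
      using \<phi> tensor_maps_outer[of "translate \<phi>" id] tensor_maps_outer[of id "translate \<phi>"]
      by (simp add: translate2_outer linear_on_translate linear_on_ident id_def)
  qed (rule linear_on_translate2)
  have "P_tensor \<Lambda> (translate2 \<phi> (W xs \<boxtimes> W ys)) =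
      tensor_maps (translate \<phi>) id (tensor_maps id (translate \<phi>) (P_tensor \<Lambda> (W xs \<boxtimes> W ys)))"
    using P_tensor_translate_left[OF \<phi> \<Lambda>, of "W xs" "translate \<phi> (W ys)"]
      P_tensor_translate_right[OF \<phi> \<Lambda>, of "W xs" "W ys"] \<phi> by (simp add: translate2_outer)
  then show "P_tensor \<Lambda> (translate2 \<phi> (W xs \<boxtimes> W ys)) = translate2 \<phi> (P_tensor \<Lambda> (W xs \<boxtimes> W ys))"
    using compose P_tensor_in_T2[OF \<Lambda>] by simp
qed

lemma Sym2_translate2:
  assumes \<phi>: "even_form \<phi>" and u: "u \<in> T2"
  shows "Sym2 (translate2 \<phi> u) = translate2 \<phi> (Sym2 u)"
  using _ _ _ u
proof (rule T2_eqI)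
  show "linear_on T2 (\<lambda>u. Sym2 (translate2 \<phi> u))"
    by (rule linear_on_compose[OF linear_on_translate2 _ linear_on_Sym2[of UNIV]]) simp
  show "linear_on T2 (\<lambda>u. translate2 \<phi> (Sym2 u))"
    by (rule linear_on_compose[OF linear_on_Sym2 _ linear_on_translate2[of UNIV]]) simp
  fix xs ys
  have "Sym (translate_word \<phi> xs) = translate \<phi> (Sym (W xs))" for xs
    using Sym_translate[OF \<phi>, of "W xs"] \<phi> by simp
  then show "Sym2 (translate2 \<phi> (W xs \<boxtimes> W ys)) = translate2 \<phi> (Sym2 (W xs \<boxtimes> W ys))"
    using \<phi> by (simp add: translate2_outer Sym2_outer)
qed

lemma mult_map_translate2:
  assumes \<phi>: "linear_form \<phi>" and u: "u \<in> T2"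
  shows "mult_map (translate2 \<phi> u) = translate \<phi> (mult_map u)"
  using _ _ _ u
proof (rule T2_eqI)
  show "linear_on T2 (\<lambda>u. mult_map (translate2 \<phi> u))"
    by (rule linear_on_compose[OF linear_on_translate2 _ linear_on_mult_map[of UNIV]]) simp
  show "linear_on T2 (\<lambda>u. translate \<phi> (mult_map u))"
    by (rule linear_on_compose[OF linear_on_mult_map _ linear_on_translate[of UNIV]]) simp
  show "mult_map (translate2 \<phi> (W xs \<boxtimes> W ys)) = translate \<phi> (mult_map (W xs \<boxtimes> W ys))" for xs ys
    using translate_mult[OF \<phi>, of "W xs" "W ys"] \<phi> by (simp add: translate2_outer mult_map_outer)
qed

lemma P_form_in_sym_square:
  "even_pairing \<Lambda> \<Longrightarrow> u \<in> sym_square smul V \<Longrightarrow> P_form smul V \<Lambda> u \<in> sym_square smul V"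
  by (simp add: P_form_eq Sym2_in_sym_square P_tensor_in_T2 sym_square_subset_T2)

lemma translate_in_sym_algebra:
  "even_form \<phi> \<Longrightarrow> a \<in> sym_algebra smul V \<Longrightarrow> translate \<phi> a \<in> sym_algebra smul V"
  using bij_betwE[OF translate_bij_sym_algebra] by blast

lemma translate2_in_sym_square:
  assumes \<phi>: "even_form \<phi>" and u: "u \<in> sym_square smul V"
  shows "translate2 \<phi> u \<in> sym_square smul V"
  using linear_on_translate2 subspace_sym_square _ u[unfolded sym_square_def]
  by (rule linear_on_span_into)
    (use \<phi> in \<open>auto simp: translate2_outer sym_algebra_in_T translate_in_sym_algebra outer_in_sym_square\<close>)

lemma P_form_translate:
  assumes \<phi>: "even_form \<phi>" and \<Lambda>: "even_pairing \<Lambda>" and u: "u \<in> sym_square smul V"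
  shows "P_form smul V \<Lambda> (translate2 \<phi> u) = translate2 \<phi> (P_form smul V \<Lambda> u)"
  using assms translate2_in_sym_square[OF \<phi> u] sym_square_subset_T2[OF u]
  by (simp add: P_form_eq P_tensor_translate Sym2_translate2 P_tensor_in_T2)

lemma sym_mult_translate:
  assumes \<phi>: "even_form \<phi>" and u: "u \<in> sym_square smul V"
  shows "sym_mult smul V (translate2 \<phi> u) = translate \<phi> (sym_mult smul V u)"
  using assms translate2_in_sym_square[OF \<phi> u] sym_square_subset_T2[OF u]
  by (simp add: sym_mult_eq mult_map_translate2 Sym_translate mult_map_in_T)

text \<open>Injectivity makes the supports of the two sums agree. If they are infinite, both sums are 0 by convention.\<close>

lemma translate_Sum_any:
  assumes \<phi>: "linear_form \<phi>" and g: "\<And>k. g k \<in> T"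
  shows "translate \<phi> (Sum_any g) = Sum_any (\<lambda>k. translate \<phi> (g k))"
proof -
  have zero: "translate \<psi> 0 = 0" for \<psi>
    by (rule linear_on_zero[OF linear_on_translate[of UNIV]]) simp
  have "translate \<phi> (g k) = 0 \<longleftrightarrow> g k = 0" for k
    using translate_uminus[OF \<phi> g[of k]] zero by metis
  then have supp: "{k. translate \<phi> (g k) \<noteq> 0} = {k. g k \<noteq> 0}" by simp
  show ?thesis
    unfolding Sum_any.expand_set supp by (rule linear_on_sum[OF linear_on_translate[of UNIV]]) simp_all
qed

lemma P_form_power_in_sym_square:
  assumes "even_pairing \<Lambda>" "u \<in> sym_square smul V"
  shows "(P_form smul V \<Lambda> ^^ k) u \<in> sym_square smul V"
  using assms by (induction k) (simp_all add: P_form_in_sym_square)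

lemma sym_mult_in_T: "u \<in> sym_square smul V \<Longrightarrow> sym_mult smul V u \<in> T"
  by (simp add: sym_mult_eq mult_map_in_T sym_square_subset_T2)

lemma star_in_T:
  assumes "even_pairing \<Lambda>" "a \<in> sym_algebra smul V" "b \<in> sym_algebra smul V"
  shows "star smul V \<Lambda> z a b \<in> T"
  unfolding star_def Sum_any.expand_set
  by (intro T_sum T_closed sym_mult_in_T P_form_power_in_sym_square outer_in_sym_square assms)

lemma translate_star:
  assumes \<phi>: "even_form \<phi>" and \<Lambda>: "even_pairing \<Lambda>"
    and a: "a \<in> sym_algebra smul V" and b: "b \<in> sym_algebra smul V"
  shows "translate \<phi> (star smul V \<Lambda> z a b) = star smul V \<Lambda> z (translate \<phi> a) (translate \<phi> b)"
proof -
  define u where "u k = (P_form smul V \<Lambda> ^^ k) (a \<boxtimes> b)" for k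
  have u: "u k \<in> sym_square smul V" for k
    unfolding u_def by (intro P_form_power_in_sym_square outer_in_sym_square \<Lambda> a b)
  have "(P_form smul V \<Lambda> ^^ k) (translate \<phi> a \<boxtimes> translate \<phi> b) = translate2 \<phi> (u k)" for k
  proof (induction k)
    case 0
    show ?case using \<phi> a b by (simp add: u_def translate2_outer sym_algebra_in_T)
  next
    case (Suc k)
    then show ?case using P_form_translate[OF \<phi> \<Lambda> u[of k]] by (simp add: u_def)
  qed
  then show ?thesis
    using \<phi> by (simp add: star_def translate_Sum_any sym_mult_translate u sym_mult_in_T
        linear_on_scale[OF linear_on_translate[of UNIV]] flip: u_def)
qed

lemma translation_star_automorphism:
  assumes \<phi>: "even_form \<phi>" and \<Lambda>: "even_pairing \<Lambda>"
  shows "algebra_automorphism (sym_algebra smul V) (star smul V \<Lambda> z) (W []) (translation smul \<phi>)"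
proof -
  let ?A = "sym_algebra smul V"
  have eq: "translation smul \<phi> t = translate \<phi> t" if "t \<in> T" for t
    using \<phi> that by (simp add: translation_eq)
  have A: "t \<in> ?A \<Longrightarrow> t \<in> T" for t by (rule sym_algebra_in_T)
  have "linear_on ?A (translation smul \<phi>)"
    by (rule linear_onI) (simp_all add: eq A linear_on_add[OF linear_on_translate[of UNIV]]
        linear_on_scale[OF linear_on_translate[of UNIV]])
  moreover have "bij_betw (translation smul \<phi>) ?A ?A"
    using translate_bij_sym_algebra[OF \<phi>] eq A by (simp cong: bij_betw_cong)
  moreover have "translation smul \<phi> (star smul V \<Lambda> z a b) =
      star smul V \<Lambda> z (translation smul \<phi> a) (translation smul \<phi> b)" if "a \<in> ?A" "b \<in> ?A" for a b
    using that A by (simp add: eq star_in_T[OF \<Lambda>] translate_star[OF \<phi> \<Lambda>])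
  ultimately show ?thesis
    using \<phi> by (auto simp: algebra_automorphism_def unital_algebra_hom_def eq bij_betw_def)
qed

end

section \<open>Continuity\<close>

context tensor_space
begin

abbreviation is_seminorm :: "('v \<Rightarrow> real) \<Rightarrow> bool" where
  "is_seminorm p \<equiv> (\<forall>c v. p (smul c v) = norm c * p v) \<and> (\<forall>v w. p (v + w) \<le> p v + p w)"

lemma seminorm_nonneg:
  assumes "is_seminorm p"
  shows "0 \<le> p v"
proof -
  have "p (0 :: 'v) = 0"
    using assms scale_zero_left[of 0] by (metis mult_zero_left norm_zero)
  moreover have "p (- v) = p v"
    using assms scale_minus_left[of 1 v] by (metis mult_1 norm_minus_cancel norm_one scale_one)
  moreover have "p (v + - v) \<le> p v + p (- v)"
    using assms by blast
  ultimately show ?thesis by simp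
qed

abbreviation combination :: "('k \<times> 'v list) list \<Rightarrow> ('k, 'v) tensor" where
  "combination L \<equiv> (\<Sum>(c, xs)\<leftarrow>L. fscale c (W xs))"

abbreviation cost :: "('v \<Rightarrow> real) \<Rightarrow> ('k \<times> 'v list) list \<Rightarrow> real" where
  "cost p L \<equiv> (\<Sum>(c, xs)\<leftarrow>L. norm c * prod_list (map p xs))"

abbreviation degrees :: "(nat \<Rightarrow> bool) \<Rightarrow> ('k \<times> 'v list) list \<Rightarrow> bool" where
  "degrees D L \<equiv> (\<forall>(c, xs)\<in>set L. D (length xs))"

abbreviation proj :: "('v \<Rightarrow> real) \<Rightarrow> nat \<Rightarrow> ('k, 'v) tensor \<Rightarrow> real" where
  "proj \<equiv> projective_seminorm smul"

lemma prod_list_seminorm_nonneg: "is_seminorm p \<Longrightarrow> 0 \<le> prod_list (map p xs)"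
  using seminorm_nonneg by (intro prod_list_nonneg) auto

lemma cost_nonneg: "is_seminorm p \<Longrightarrow> 0 \<le> cost p L"
  using prod_list_seminorm_nonneg by (induction L) auto

lemma TP_combination:
  assumes "t \<in> TP n"
  shows "\<exists>L. degrees (\<lambda>k. k = n) L \<and> t = combination L"
  using assms unfolding tensor_power_def
proof (induction rule: span_combination_induct)
  case zero
  have "degrees (\<lambda>k. k = n) [] \<and> 0 = combination []" by simp
  then show ?case by blast
next
  case (step c w t)
  then obtain xs L where "w = W xs" "length xs = n" "degrees (\<lambda>k. k = n) L" "t = combination L"
    by blast
  then have "degrees (\<lambda>k. k = n) ((c, xs) # L) \<and> fscale c w + t = combination ((c, xs) # L)"
    by simp
  then show ?case by blast
qed

lemma proj_le:
  assumes "is_seminorm p" "degrees (\<lambda>k. k = n) L" "t = combination L"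
  shows "proj p n t \<le> cost p L"
  unfolding projective_seminorm_def
  by (rule cInf_lower) (use assms cost_nonneg[OF assms(1)] in \<open>auto intro!: bdd_belowI[of _ 0]\<close>)

lemma proj_greatest:
  assumes "t \<in> TP n" "\<And>L. degrees (\<lambda>k. k = n) L \<Longrightarrow> t = combination L \<Longrightarrow> x \<le> cost p L"
  shows "x \<le> proj p n t"
  unfolding projective_seminorm_def
  by (rule cInf_greatest) (use TP_combination[OF assms(1)] assms(2) in auto)

lemma proj_nonneg: "is_seminorm p \<Longrightarrow> t \<in> TP n \<Longrightarrow> 0 \<le> proj p n t"
  by (rule proj_greatest) (simp_all add: cost_nonneg)

lemma proj_zero:
  assumes "is_seminorm p"
  shows "proj p n 0 = 0"
  using proj_le[OF assms, where n = n and L = "[]" and t = 0] proj_nonneg[OF assms, where n = n and t = 0]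
  by (simp add: fun_vs.subspace_0)

lemma proj_triangle:
  assumes p: "is_seminorm p" and s: "s \<in> TP n" and t: "t \<in> TP n"
  shows "proj p n (s + t) \<le> proj p n s + proj p n t"
proof -
  have "proj p n (s + t) - cost p M \<le> proj p n s" if M: "degrees (\<lambda>k. k = n) M" "t = combination M" for M
  proof (rule proj_greatest[OF s])
    fix L assume L: "degrees (\<lambda>k. k = n) L" "s = combination L"
    have "proj p n (s + t) \<le> cost p (L @ M)"
      by (rule proj_le[OF p]) (use L M in auto)
    then show "proj p n (s + t) - cost p M \<le> cost p L" by simp
  qed
  then have "proj p n (s + t) - proj p n s \<le> proj p n t"
    using proj_greatest[OF t, of "proj p n (s + t) - proj p n s" p] by (simp add: algebra_simps)
  then show ?thesis by simp
qed

abbreviation tsn :: "('v \<Rightarrow> real) \<Rightarrow> real \<Rightarrow> ('k, 'v) tensor \<Rightarrow> real" where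
  "tsn \<equiv> tensor_seminorm smul"

lemma tensor_seminorm_sum:
  assumes "is_seminorm p" "t \<in> T" "\<And>n. n \<ge> N \<Longrightarrow> component n t = 0"
  shows "tsn p R t = (\<Sum>n<N. proj p n (component n t) * fact n powr R)"
proof -
  have "n < N" if "proj p n (component n t) * fact n powr R \<noteq> 0" for n
    using assms(3)[of n] proj_zero[OF assms(1)] that by (cases "n < N") simp_all
  then have "{n. proj p n (component n t) * fact n powr R \<noteq> 0} \<subseteq> {..<N}"
    by blast
  then show ?thesis
    using assms(2) by (simp add: tensor_seminorm_def tensor_component_eq Sum_any.expand_superset)
qed

lemma tensor_seminorm_zero: "is_seminorm p \<Longrightarrow> tsn p R 0 = 0"
  using tensor_seminorm_sum[of p 0 0] linear_on_zero[OF linear_on_component[of UNIV]] by simp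

lemma tensor_seminorm_triangle:
  assumes p: "is_seminorm p" and s: "s \<in> T" and t: "t \<in> T"
  shows "tsn p R (s + t) \<le> tsn p R s + tsn p R t"
proof -
  obtain M N where M: "\<forall>n\<ge>M. component n s = 0" and N: "\<forall>n\<ge>N. component n t = 0"
    using components_finite s t by blast
  let ?N = "max M N"
  have add: "component n (s + t) = component n s + component n t" for n
    by (simp add: linear_on_add[OF linear_on_component[of UNIV]])
  have "tsn p R (s + t) = (\<Sum>n<?N. proj p n (component n (s + t)) * fact n powr R)"
    by (rule tensor_seminorm_sum) (use p s t M N add in simp_all)
  also have "\<dots> \<le> (\<Sum>n<?N. (proj p n (component n s) + proj p n (component n t)) * fact n powr R)"
    unfolding add by (intro sum_mono mult_right_mono proj_triangle p component_in_TP s t) simp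
  also have "\<dots> = tsn p R s + tsn p R t"
    using tensor_seminorm_sum[OF p s, of ?N] tensor_seminorm_sum[OF p t, of ?N] M N
    by (simp add: distrib_right sum.distrib)
  finally show ?thesis .
qed

lemma tensor_seminorm_word:
  assumes p: "is_seminorm p"
  shows "tsn p R (fscale c (W xs)) \<le> norm c * prod_list (map p xs) * fact (length xs) powr R"
proof -
  let ?t = "fscale c (W xs)" and ?n = "length xs"
  have comp: "component n ?t = (if n = ?n then ?t else 0)" for n
    by (simp add: linear_on_scale[OF linear_on_component[of UNIV]] component_word)
  have "tsn p R ?t = (\<Sum>n<Suc ?n. proj p n (component n ?t) * fact n powr R)"
    by (rule tensor_seminorm_sum) (use p comp in auto)
  also have "\<dots> = proj p ?n ?t * fact ?n powr R"
    using proj_zero[OF p] by (simp add: comp)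
  also have "\<dots> \<le> norm c * prod_list (map p xs) * fact ?n powr R"
    using proj_le[OF p, where n = ?n and L = "[(c, xs)]" and t = ?t] by (intro mult_right_mono) simp_all
  finally show ?thesis .
qed

lemma combination_in_T [simp]: "combination L \<in> T"
  by (induction L) auto

text \<open>The weights \<open>k!\<^sup>R\<close> increase with the degree \<open>k\<close> because \<open>R \<ge> 0\<close>.\<close>

lemma tensor_seminorm_combination:
  assumes p: "is_seminorm p" and R: "R \<ge> 0" and L: "degrees (\<lambda>k. k \<le> n) L"
  shows "tsn p R (combination L) \<le> fact n powr R * cost p L"
  using L
proof (induction L)
  case Nil
  then show ?case by (simp add: tensor_seminorm_zero[OF p])
next
  case (Cons x L)
  obtain c xs where x: "x = (c, xs)" by (cases x)
  have "tsn p R (fscale c (W xs)) \<le> norm c * prod_list (map p xs) * fact (length xs) powr R"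
    by (rule tensor_seminorm_word[OF p])
  also have "\<dots> \<le> norm c * prod_list (map p xs) * fact n powr R"
    using Cons.prems R prod_list_seminorm_nonneg[OF p]
    by (intro mult_left_mono powr_mono2) (auto simp: x fact_mono)
  finally show ?case
    using Cons tensor_seminorm_triangle[OF p, of "fscale c (W xs)" "combination L" R]
    by (simp add: x algebra_simps)
qed

text \<open>Expanding \<open>(v\<^sub>1 + \<phi>(v\<^sub>1)) \<otimes> \<dots> \<otimes> (v\<^sub>n + \<phi>(v\<^sub>n))\<close> yields the products \<open>(p(v\<^sub>1) + |\<phi>(v\<^sub>1)|) \<cdots> (p(v\<^sub>n) + |\<phi>(v\<^sub>n)|)\<close>
  and words of length at most \<open>n\<close>.\<close>

lemma translate_word_combination:
  "\<exists>M. degrees (\<lambda>k. k \<le> length xs) M \<and> fscale c (translate_word \<phi> xs) = combination M \<and>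
    cost p M = norm c * prod_list (map (\<lambda>v. p v + norm (\<phi> v)) xs)"
proof (induction xs arbitrary: c)
  case Nil
  show ?case by (rule exI[of _ "[(c, [])]"]) simp
next
  case (Cons x xs)
  obtain M where M: "degrees (\<lambda>k. k \<le> length xs) M" "fscale c (translate_word \<phi> xs) = combination M"
    "cost p M = norm c * prod_list (map (\<lambda>v. p v + norm (\<phi> v)) xs)"
    using Cons.IH by blast
  obtain M' where M': "degrees (\<lambda>k. k \<le> length xs) M'"
    "fscale (c * \<phi> x) (translate_word \<phi> xs) = combination M'"
    "cost p M' = norm (c * \<phi> x) * prod_list (map (\<lambda>v. p v + norm (\<phi> v)) xs)"
    using Cons.IH by blast
  let ?N = "map (\<lambda>(d, ys). (d, x # ys)) M"
  have "combination ?N = W [x] \<otimes> combination L" if "?N = map (\<lambda>(d, ys). (d, x # ys)) L" "L = M" for L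
    unfolding that(1)
    by (induction L) (auto simp: linear_on_zero[OF mult_linear_right] linear_on_add[OF mult_linear_right]
        linear_on_scale[OF mult_linear_right] tensor_mult_word)
  then have comb: "combination ?N = W [x] \<otimes> fscale c (translate_word \<phi> xs)"
    using M(2) by simp
  have cost: "cost p (map (\<lambda>(d, ys). (d, x # ys)) L) = p x * cost p L" for L
    by (induction L) (auto simp: algebra_simps)
  have "degrees (\<lambda>k. k \<le> length (x # xs)) (?N @ M')"
    using M(1) M'(1) by fastforce
  moreover have "fscale c (translate_word \<phi> (x # xs)) = combination (?N @ M')"
    using comb M'(2) by (simp add: fun_vs.scale_right_distrib linear_on_scale[OF mult_linear_right])
  moreover have "cost p (?N @ M') = norm c * prod_list (map (\<lambda>v. p v + norm (\<phi> v)) (x # xs))"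
    using M(3) M'(3) cost[of M] by (simp add: norm_mult algebra_simps)
  ultimately show ?case by blast
qed

lemma translate_combination:
  assumes \<phi>: "linear_form \<phi>" and "degrees (\<lambda>k. k \<le> n) L"
  shows "\<exists>M. degrees (\<lambda>k. k \<le> n) M \<and> translate \<phi> (combination L) = combination M \<and>
    cost p M = cost (\<lambda>v. p v + norm (\<phi> v)) L"
  using assms(2)
proof (induction L)
  case Nil
  show ?case
    by (rule exI[of _ "[]"]) (simp add: linear_on_zero[OF linear_on_translate[of UNIV]])
next
  case (Cons x L)
  obtain c xs where x: "x = (c, xs)" by (cases x)
  obtain M where M: "degrees (\<lambda>k. k \<le> n) M" "translate \<phi> (combination L) = combination M"
    "cost p M = cost (\<lambda>v. p v + norm (\<phi> v)) L"
    using Cons by auto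
  obtain N where N: "degrees (\<lambda>k. k \<le> length xs) N" "fscale c (translate_word \<phi> xs) = combination N"
    "cost p N = norm c * prod_list (map (\<lambda>v. p v + norm (\<phi> v)) xs)"
    using translate_word_combination by blast
  have "degrees (\<lambda>k. k \<le> n) (N @ M)"
    using M(1) N(1) Cons.prems by (fastforce simp: x)
  moreover have "translate \<phi> (combination (x # L)) = combination (N @ M)"
    using M(2) N(2) \<phi> by (simp add: x linear_on_add[OF linear_on_translate[of UNIV]]
        linear_on_scale[OF linear_on_translate[of UNIV]])
  moreover have "cost p (N @ M) = cost (\<lambda>v. p v + norm (\<phi> v)) (x # L)"
    using M(3) N(3) by (simp add: x)
  ultimately show ?case by blast
qed

lemma tensor_seminorm_translate_TP:
  assumes \<phi>: "linear_form \<phi>" and p: "is_seminorm p" and R: "R \<ge> 0" and t: "t \<in> TP n"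
  shows "tsn p R (translate \<phi> t) \<le> fact n powr R * proj (\<lambda>v. p v + norm (\<phi> v)) n t"
proof -
  have "tsn p R (translate \<phi> t) / fact n powr R \<le> proj (\<lambda>v. p v + norm (\<phi> v)) n t"
  proof (rule proj_greatest[OF t])
    fix L assume L: "degrees (\<lambda>k. k = n) L" "t = combination L"
    have "degrees (\<lambda>k. k \<le> n) L" using L(1) by auto
    then obtain M where M: "degrees (\<lambda>k. k \<le> n) M" "translate \<phi> (combination L) = combination M"
      "cost p M = cost (\<lambda>v. p v + norm (\<phi> v)) L"
      using translate_combination[OF \<phi>, where n = n and L = L and p = p] by blast
    then show "tsn p R (translate \<phi> t) / fact n powr R \<le> cost (\<lambda>v. p v + norm (\<phi> v)) L"
      using tensor_seminorm_combination[OF p R M(1)] by (simp add: L(2) divide_le_eq mult.commute)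
  qed
  then show ?thesis by (simp add: divide_le_eq mult.commute)
qed

lemma is_seminorm_plus_norm:
  assumes "linear_form \<phi>" "is_seminorm p"
  shows "is_seminorm (\<lambda>v. p v + norm (\<phi> v))"
proof (intro conjI allI)
  show "p (smul c v) + norm (\<phi> (smul c v)) = norm c * (p v + norm (\<phi> v))" for c v
    using assms by (simp add: linear_form_scale norm_mult distrib_left)
  show "p (v + w) + norm (\<phi> (v + w)) \<le> p v + norm (\<phi> v) + (p w + norm (\<phi> w))" for v w
  proof -
    have "p (v + w) \<le> p v + p w" using assms(2) by blast
    then show ?thesis
      using norm_triangle_ineq[of "\<phi> v" "\<phi> w"] by (simp add: linear_form_add[OF assms(1)])
  qed
qed

lemma tensor_seminorm_sum_le:
  assumes "is_seminorm p" "\<And>i. i \<in> A \<Longrightarrow> f i \<in> T"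
  shows "tsn p R (sum f A) \<le> (\<Sum>i\<in>A. tsn p R (f i))"
  using assms(2)
proof (induction A rule: infinite_finite_induct)
  case (insert x A)
  then show ?case
    using tensor_seminorm_triangle[OF assms(1), of "f x" "sum f A" R] by (simp add: T_sum)
qed (simp_all add: tensor_seminorm_zero[OF assms(1)])

lemma tensor_seminorm_translate:
  assumes \<phi>: "linear_form \<phi>" and p: "is_seminorm p" and R: "R \<ge> 0" and t: "t \<in> T"
  shows "tsn p R (translate \<phi> t) \<le> tsn (\<lambda>v. p v + norm (\<phi> v)) R t"
proof -
  obtain N where N: "\<forall>n\<ge>N. component n t = 0" "t = (\<Sum>n<N. component n t)"
    using components_finite[OF t] by blast
  have "tsn p R (translate \<phi> t) = tsn p R (\<Sum>n<N. translate \<phi> (component n t))"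
    using linear_on_sum[OF linear_on_translate[of UNIV \<phi>], of "{..<N}" "\<lambda>n. component n t"] N(2)
    by simp
  also have "\<dots> \<le> (\<Sum>n<N. tsn p R (translate \<phi> (component n t)))"
    by (rule tensor_seminorm_sum_le[OF p]) (rule translate_in_T[OF \<phi> TP_in_T[OF component_in_TP[OF t]]])
  also have "\<dots> \<le> (\<Sum>n<N. fact n powr R * proj (\<lambda>v. p v + norm (\<phi> v)) n (component n t))"
    by (intro sum_mono tensor_seminorm_translate_TP \<phi> p R component_in_TP t)
  also have "\<dots> = tsn (\<lambda>v. p v + norm (\<phi> v)) R t"
    using tensor_seminorm_sum[OF is_seminorm_plus_norm[OF \<phi> p] t, of N R] N(1) by (simp add: mult.commute)
  finally show ?thesis .
qed

lemma tensor_seminorm_mono_exponent: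
  assumes p: "is_seminorm p" and t: "t \<in> T" and "R \<le> R'"
  shows "tsn p R t \<le> tsn p R' t"
proof -
  obtain N where N: "\<forall>n\<ge>N. component n t = 0"
    using components_finite[OF t] by blast
  have "(\<Sum>n<N. proj p n (component n t) * fact n powr R) \<le> (\<Sum>n<N. proj p n (component n t) * fact n powr R')"
    using \<open>R \<le> R'\<close>
    by (intro sum_mono mult_left_mono powr_mono proj_nonneg p component_in_TP t) (simp_all add: fact_ge_1)
  then show ?thesis
    using tensor_seminorm_sum[OF p t, of N R] tensor_seminorm_sum[OF p t, of N R'] N by simp
qed

end

lemma openin_seminorm_ball:
  assumes "a \<in> D" "q \<in> Q" "e > 0"
  shows "openin (seminorm_topology D Q) {b \<in> D. q (b - a) < e}"
  unfolding seminorm_topology_def by (rule topology_generated_by_Basis) (use assms in blast)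

text \<open>The usual criterion for linear maps. For \<open>x\<close> in the preimage of a ball of \<open>q\<close>, the ball of the dominating
  seminorm around \<open>x\<close> whose radius is the remaining distance lies in this preimage.\<close>

lemma continuous_map_seminorm_topology:
  assumes D: "fun_vs.subspace D" and F: "linear_on D F" "\<And>a. a \<in> D \<Longrightarrow> F a \<in> D"
    and zero: "\<And>q. q \<in> Q \<Longrightarrow> q 0 = 0"
    and triangle: "\<And>q a b. q \<in> Q \<Longrightarrow> a \<in> D \<Longrightarrow> b \<in> D \<Longrightarrow> q (a + b) \<le> q a + q b"
    and bound: "\<And>q. q \<in> Q \<Longrightarrow> \<exists>r\<in>Q. \<forall>a\<in>D. q (F a) \<le> r a"
  shows "continuous_map (seminorm_topology D Q) (seminorm_topology D Q) F"
proof -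
  let ?X = "seminorm_topology D Q"
  let ?S = "{{b \<in> D. q (b - a) < e} |a q e. a \<in> D \<and> q \<in> Q \<and> e > 0}"
  have top: "topspace ?X = \<Union>?S" by (simp add: seminorm_topology_def)
  then have topD: "topspace ?X \<subseteq> D" by auto
  have "openin ?X (F -` {b \<in> D. q (b - a) < e} \<inter> topspace ?X)"
    if q: "a \<in> D" "q \<in> Q" "e > 0" for a q e
  proof (subst openin_subopen, intro ballI)
    fix x assume x: "x \<in> F -` {b \<in> D. q (b - a) < e} \<inter> topspace ?X"
    then have xD: "x \<in> D" "q (F x - a) < e" using topD by auto
    obtain r where r: "r \<in> Q" "\<forall>b\<in>D. q (F b) \<le> r b" using bound[OF q(2)] by blast
    let ?B = "{b \<in> D. r (b - x) < e - q (F x - a)}"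
    have B: "openin ?X ?B"
      by (rule openin_seminorm_ball) (use xD r in auto)
    moreover have "x \<in> ?B" using xD zero[OF r(1)] by simp
    moreover have "?B \<subseteq> F -` {b \<in> D. q (b - a) < e} \<inter> topspace ?X"
    proof
      fix b assume b: "b \<in> ?B"
      then have bx: "b \<in> D" "b - x \<in> D" using xD fun_vs.subspace_diff[OF D] by auto
      have "q (F b - a) = q (F (b - x) + (F x - a))"
        using linear_on_diff[OF F(1) D] b xD by simp
      also have "\<dots> \<le> q (F (b - x)) + q (F x - a)"
        using bx xD q by (intro triangle F(2) fun_vs.subspace_diff[OF D]) auto
      also have "\<dots> < e" using r(2) bx b by fastforce
      finally show "b \<in> F -` {b \<in> D. q (b - a) < e} \<inter> topspace ?X"
        using b F(2) openin_subset[OF B] by auto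
    qed
    ultimately show "\<exists>U. openin ?X U \<and> x \<in> U \<and> U \<subseteq> F -` {b \<in> D. q (b - a) < e} \<inter> topspace ?X"
      by blast
  qed
  moreover have "F ` topspace ?X \<subseteq> \<Union>?S"
  proof
    fix y assume "y \<in> F ` topspace ?X"
    then obtain x where x: "y = F x" "x \<in> topspace ?X" by blast
    then obtain q where q: "q \<in> Q" unfolding top by blast
    have yD: "y \<in> D" using x topD F(2) by blast
    then have "y \<in> {b \<in> D. q (b - y) < 1}" using zero[OF q] by simp
    moreover have "{b \<in> D. q (b - y) < 1} \<in> ?S" using yD q zero_less_one by blast
    ultimately show "y \<in> \<Union>?S" by blast
  qed
  ultimately show ?thesis
    unfolding seminorm_topology_def by (intro continuous_on_generated_topo) auto
qed

theorem proposition5p4: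
  fixes smul :: "'k::real_normed_field \<Rightarrow> 'v::{topological_ab_group_add, t2_space} \<Rightarrow> 'v"
    and V :: "bit \<Rightarrow> 'v set"
    and \<Lambda> :: "'v \<Rightarrow> 'v \<Rightarrow> 'k" and z :: 'k
    and \<phi> :: "'v \<Rightarrow> 'k" and R :: real
  assumes "graded_lcs smul V"
    and "even_continuous_bilinear_form smul V \<Lambda>"
    and "even_continuous_functional smul V \<phi>"
    and "R \<ge> 0"
  shows
    "(algebra_automorphism (tensor_algebra smul) (tensor_mult smul) (word smul [])
        (translation smul \<phi>) \<and>
      continuous_map (tensor_topology smul R) (tensor_topology smul R) (translation smul \<phi>)) \<and>
     (R \<ge> 1/2 \<longrightarrow>
      algebra_automorphism (sym_algebra smul V) (star smul V \<Lambda> z) (word smul [])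
        (translation smul \<phi>) \<and>
      continuous_map (weyl_topology smul V R) (weyl_topology smul V R) (translation smul \<phi>)) \<and>
     (R > 1/2 \<longrightarrow>
      algebra_automorphism (sym_algebra smul V) (star smul V \<Lambda> z) (word smul [])
        (translation smul \<phi>) \<and>
      continuous_map (weyl_minus_topology smul V R) (weyl_minus_topology smul V R)
        (translation smul \<phi>))"
proof -
  interpret graded_lcs smul V by (rule assms(1))
  interpret graded_space smul V
    by unfold_locales (fact subspace_graded direct_sum)+
  have \<phi>: "even_form \<phi>" "continuous_on UNIV \<phi>"
    using assms(3) by (simp_all add: even_continuous_functional_def)
  have \<Lambda>: "even_pairing \<Lambda>"
    using assms(2) by (simp add: even_continuous_bilinear_form_def)
  have eq: "translation smul \<phi> t = translate \<phi> t" if "t \<in> T" for t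
    using \<phi> that by (simp add: translation_eq)
  have T: "algebra_automorphism T (tensor_mult smul) (W []) (translation smul \<phi>)"
    using \<phi> by (intro translation_automorphism) simp
  have Sym: "algebra_automorphism (sym_algebra smul V) (star smul V \<Lambda> z) (W []) (translation smul \<phi>)"
    using \<phi>(1) \<Lambda> by (rule translation_star_automorphism)
  have linear: "linear_on D (translation smul \<phi>)" "\<And>a. a \<in> D \<Longrightarrow> translation smul \<phi> a \<in> D"
    if "algebra_automorphism D mul one (translation smul \<phi>)" for D mul one
    using that by (auto simp: algebra_automorphism_def unital_algebra_hom_def)
  have seminorm: "is_seminorm p" if "continuous_seminorm smul p" for p
    using that by (simp add: continuous_seminorm_def)
  define shift where "shift p = (\<lambda>v. p v + norm (\<phi> v))" for p
  have shift: "continuous_seminorm smul (shift p)" if p: "continuous_seminorm smul p" for p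
    using is_seminorm_plus_norm[OF _ seminorm[OF p]] \<phi> p
    unfolding continuous_seminorm_def shift_def by (auto intro!: continuous_intros)
  have bound: "tensor_seminorm smul p S (translation smul \<phi> t) \<le> tensor_seminorm smul (shift p) S t"
    if "continuous_seminorm smul p" "S \<ge> 0" "t \<in> T" for p S t
    using tensor_seminorm_translate[OF _ seminorm[OF that(1)] that(2,3)] \<phi> that(3)
    by (simp add: eq shift_def)
  have continuous: "continuous_map (seminorm_topology D Q) (seminorm_topology D Q) (translation smul \<phi>)"
    if D: "algebra_automorphism D mul one (translation smul \<phi>)" "fun_vs.subspace D" "D \<subseteq> T"
      and Q: "\<And>q. q \<in> Q \<Longrightarrow> \<exists>p S. continuous_seminorm smul p \<and> q = tensor_seminorm smul p S"
      and dominated: "\<And>q. q \<in> Q \<Longrightarrow> \<exists>r\<in>Q. \<forall>a\<in>D. q (translation smul \<phi> a) \<le> r a" for D mul one Q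
  proof (rule continuous_map_seminorm_topology[OF D(2) linear[OF D(1)] _ _ dominated])
    fix q assume "q \<in> Q"
    then obtain p S where p: "continuous_seminorm smul p" and q: "q = tensor_seminorm smul p S"
      using Q by blast
    show "q 0 = 0"
      unfolding q by (rule tensor_seminorm_zero[OF seminorm[OF p]])
    show "q (a + b) \<le> q a + q b" if "a \<in> D" "b \<in> D" for a b
      unfolding q using that D(3) by (intro tensor_seminorm_triangle[OF seminorm[OF p]]) auto
  qed
  have A: "fun_vs.subspace (sym_algebra smul V)" "sym_algebra smul V \<subseteq> T"
    using sym_algebra_in_T by (auto simp: sym_algebra_def)
  have dominated: "\<exists>r\<in>{tensor_seminorm smul p R |p. continuous_seminorm smul p}.
      \<forall>a\<in>D. q (translation smul \<phi> a) \<le> r a"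
    if q: "q \<in> {tensor_seminorm smul p R |p. continuous_seminorm smul p}" and D: "D \<subseteq> T" for q D
  proof -
    obtain p where p: "continuous_seminorm smul p" "q = tensor_seminorm smul p R" using q by blast
    have "\<forall>a\<in>D. q (translation smul \<phi> a) \<le> tensor_seminorm smul (shift p) R a"
      unfolding p(2) using bound[OF p(1) assms(4)] D by blast
    then show ?thesis using shift[OF p(1)] by blast
  qed
  have 1: "continuous_map (tensor_topology smul R) (tensor_topology smul R) (translation smul \<phi>)"
    unfolding tensor_topology_def
    by (rule continuous[OF T subspace_T order_refl _ dominated[OF _ order_refl]]) blast
  have 2: "continuous_map (weyl_topology smul V R) (weyl_topology smul V R) (translation smul \<phi>)"
    unfolding weyl_topology_def
    by (rule continuous[OF Sym A _ dominated[OF _ A(2)]]) blast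
  have 3: "continuous_map (weyl_minus_topology smul V R) (weyl_minus_topology smul V R) (translation smul \<phi>)"
    if R: "R > 1 / 2"
    unfolding weyl_minus_topology_def
  proof (rule continuous[OF Sym A])
    fix q assume "q \<in> {tensor_seminorm smul p (R - \<epsilon>) |p \<epsilon>. continuous_seminorm smul p \<and> \<epsilon> > 0}"
    then obtain p \<epsilon> where p: "continuous_seminorm smul p" "\<epsilon> > 0" "q = tensor_seminorm smul p (R - \<epsilon>)"
      by blast
    \<comment> \<open>The estimate needs a nonnegative exponent, so a negative one is first raised to \<open>0 = R - R\<close>.\<close>
    define \<delta> where "\<delta> = min \<epsilon> R"
    have \<delta>: "\<delta> > 0" "R - \<delta> \<ge> 0" "R - \<epsilon> \<le> R - \<delta>" using p(2) R by (auto simp: \<delta>_def)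
    have "q (translation smul \<phi> t) \<le> tensor_seminorm smul (shift p) (R - \<delta>) t" if "t \<in> T" for t
      using tensor_seminorm_mono_exponent[OF seminorm[OF p(1)] linear(2)[OF T that] \<delta>(3)]
        bound[OF p(1) \<delta>(2) that] by (simp add: p(3))
    then show "\<exists>r\<in>{tensor_seminorm smul p (R - \<epsilon>) |p \<epsilon>. continuous_seminorm smul p \<and> \<epsilon> > 0}.
        \<forall>a\<in>sym_algebra smul V. q (translation smul \<phi> a) \<le> r a"
      using shift[OF p(1)] \<delta>(1) A(2) by blast
  qed blast
  show ?thesis
    using T Sym 1 2 3 by blast
qed

end
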